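(* Let $S$ and $E$ be finite-dimensional quantum systems of dimensions $d_S,d_E$, let $\sigma=\sigma_S\otimes\sigma_E$ and $\sigma'=\sigma'_S\otimes\sigma'_E$ be full-rank product states on $SE$, let $\mathcal E$ be a quantum channel on states of $SE$ with $\mathcal E(\sigma)=\sigma'$, and let $\rho_E$ be a full-rank state on $E$. Define the channel $\mathcal C(\cdot)=\mathrm{Tr}_E[\mathcal E(\cdot\otimes\rho_E)]$ on $S$. Let $\rho_S$ be a state on $S$ such that $\rho_S\otimes\rho_E$ commutes with $\sigma$ and $\mathcal E(\rho_S\otimes\rho_E)$ commutes with $\sigma'$. Put $\rho'_S=\mathcal C(\rho_S)$, $\rho'_E=\mathrm{Tr}_S[\mathcal E(\rho_S\otimes\rho_E)]$, $\Delta S_S=S(\rho_S\|\sigma_S)-S(\rho'_S\|\sigma'_S)$, $\Delta S_E=S(\rho_E\|\sigma_E)-S(\rho'_E\|\sigma'_E)$, $\Delta V_S=V(\rho_S\|\sigma_S)-V(\rho'_S\|\sigma'_S)$, $\Delta V_E=V(\rho_E\|\sigma_E)-V(\rho'_E\|\sigma'_E)$, and $I_{S:E}=S(\mathcal E(\rho_S\otimes\rho_E)\|\rho'_S\otimes\rho'_E)$. Then $$\Delta S_S+\Delta S_E\ge\frac{\Delta V_S+\Delta V_E-K\,f(I_{S:E})}{2\sqrt{M_{s_{\min}}(\rho_S\otimes\rho_E\|\sigma)}},$$ where $K=\sqrt{2\ln 2}\left(12+\log^2(s_{\min})+8\log^2(d_Sd_E)\right)$, $f(x)=\max\{\sqrt[4]{x},x^2\}$,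 and $s_{\min}$ is the smallest eigenvalue of $\sigma$.
   Context: Logs are base 2 unless written $\ln$. $S(\rho\|\sigma)=\mathrm{Tr}(\rho(\log\rho-\log\sigma))$, $V(\rho\|\sigma)=\mathrm{Tr}(\rho(\log\rho-\log\sigma)^2)-S(\rho\|\sigma)^2$, and $M_x(\rho\|\sigma)=V(\rho\|\sigma)+\left(\frac1{\ln2}-\log x-S(\rho\|\sigma)\right)^2$. *)

theory Defs
  imports "Jordan_Normal_Form.Spectral_Radius"
begin

text \<open>Finite-dimensional quantum states are complex matrices (Jordan_Normal_Form).
Composite system SE of dimension dS*dE, basis index (iS,iE) encoded as iS*dE+iE.\<close>

definition mtrace :: "complex mat \<Rightarrow> complex" where
  "mtrace A = (\<Sum>i<dim_row A. A $$ (i,i))"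

definition adj :: "complex mat \<Rightarrow> complex mat" where
  "adj A = mat (dim_col A) (dim_row A) (\<lambda>(i,j). cnj (A $$ (j,i)))"

definition psd :: "nat \<Rightarrow> complex mat \<Rightarrow> bool" where
  "psd n A \<longleftrightarrow> A \<in> carrier_mat n n \<and> adj A = A \<and>
     (\<forall>v \<in> carrier_vec n. Re ((A *\<^sub>v v) \<bullet>c v) \<ge> 0)"

definition density :: "nat \<Rightarrow> complex mat \<Rightarrow> bool" where
  "density n \<rho> \<longleftrightarrow> psd n \<rho> \<and> mtrace \<rho> = 1"

definition full_rank_state :: "nat \<Rightarrow> complex mat \<Rightarrow> bool" where
  "full_rank_state n \<rho> \<longleftrightarrow> density n \<rho> \<and> det \<rho> \<noteq> 0"

definition unitary :: "nat \<Rightarrow> complex mat \<Rightarrow> bool" where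
  "unitary n U \<longleftrightarrow> U \<in> carrier_mat n n \<and> adj U * U = 1\<^sub>m n"

definition mat_fun :: "nat \<Rightarrow> (real \<Rightarrow> real) \<Rightarrow> complex mat \<Rightarrow> complex mat" where
  "mat_fun n f A = (SOME B. \<exists>U (lam :: nat \<Rightarrow> real). unitary n U \<and>
      A = U * mat_diag n (\<lambda>i. complex_of_real (lam i)) * adj U \<and>
      B = U * mat_diag n (\<lambda>i. complex_of_real (f (lam i))) * adj U)"

text \<open>Matrix logarithm base 2, with the usual support convention (log of 0 eigenvalue taken as 0,
  which is harmless since it is always multiplied by the state).\<close>
definition mlog :: "nat \<Rightarrow> complex mat \<Rightarrow> complex mat" where
  "mlog n A = mat_fun n (\<lambda>x. if x > 0 then log 2 x else 0) A"

definition rel_ent :: "nat \<Rightarrow> complex mat \<Rightarrow> complex mat \<Rightarrow> real" where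
  "rel_ent n \<rho> \<sigma> = Re (mtrace (\<rho> * (mlog n \<rho> - mlog n \<sigma>)))"

definition rel_var :: "nat \<Rightarrow> complex mat \<Rightarrow> complex mat \<Rightarrow> real" where
  "rel_var n \<rho> \<sigma> = Re (mtrace (\<rho> * ((mlog n \<rho> - mlog n \<sigma>) * (mlog n \<rho> - mlog n \<sigma>))))
      - (rel_ent n \<rho> \<sigma>)\<^sup>2"

definition M_x :: "nat \<Rightarrow> real \<Rightarrow> complex mat \<Rightarrow> complex mat \<Rightarrow> real" where
  "M_x n x \<rho> \<sigma> = rel_var n \<rho> \<sigma> + (1 / ln 2 - log 2 x - rel_ent n \<rho> \<sigma>)\<^sup>2"

definition kron :: "complex mat \<Rightarrow> complex mat \<Rightarrow> complex mat" where
  "kron A B = mat (dim_row A * dim_row B) (dim_col A * dim_col B)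
     (\<lambda>(i,j). A $$ (i div dim_row B, j div dim_col B) * B $$ (i mod dim_row B, j mod dim_col B))"

definition ptrace_E :: "nat \<Rightarrow> nat \<Rightarrow> complex mat \<Rightarrow> complex mat" where
  "ptrace_E dS dE M = mat dS dS (\<lambda>(i,j). \<Sum>k<dE. M $$ (i*dE+k, j*dE+k))"

definition ptrace_S :: "nat \<Rightarrow> nat \<Rightarrow> complex mat \<Rightarrow> complex mat" where
  "ptrace_S dS dE M = mat dE dE (\<lambda>(i,j). \<Sum>k<dS. M $$ (k*dE+i, k*dE+j))"

definition block :: "nat \<Rightarrow> complex mat \<Rightarrow> nat \<Rightarrow> nat \<Rightarrow> complex mat" where
  "block n X a b = mat n n (\<lambda>(p,q). X $$ (a*n+p, b*n+q))"

definition id_tensor :: "nat \<Rightarrow> nat \<Rightarrow> (complex mat \<Rightarrow> complex mat) \<Rightarrow> complex mat \<Rightarrow> complex mat" where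
  "id_tensor k n \<Phi> X = mat (k*n) (k*n) (\<lambda>(i,j). \<Phi> (block n X (i div n) (j div n)) $$ (i mod n, j mod n))"

definition channel :: "nat \<Rightarrow> (complex mat \<Rightarrow> complex mat) \<Rightarrow> bool" where
  "channel n \<Phi> \<longleftrightarrow>
     (\<forall>A \<in> carrier_mat n n. \<Phi> A \<in> carrier_mat n n) \<and>
     (\<forall>A \<in> carrier_mat n n. \<forall>B \<in> carrier_mat n n. \<Phi> (A + B) = \<Phi> A + \<Phi> B) \<and>
     (\<forall>A \<in> carrier_mat n n. \<forall>c. \<Phi> (c \<cdot>\<^sub>m A) = c \<cdot>\<^sub>m \<Phi> A) \<and>
     (\<forall>A \<in> carrier_mat n n. mtrace (\<Phi> A) = mtrace A) \<and>
     (\<forall>k X. psd (k*n) X \<longrightarrow> psd (k*n) (id_tensor k n \<Phi> X))"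

definition smallest_eigenvalue :: "complex mat \<Rightarrow> real" where
  "smallest_eigenvalue A = Min {x. eigenvalue A (complex_of_real x)}"

end

theory Submission
  imports Defs
begin

text \<open>
  Commuting pairs of states are simultaneously diagonalizable. Since the two partial traces of the
  output commute with the factors of \<open>\<sigma>'\<close>, one may follow the channel by the dephasing in a common
  product eigenbasis of \<open>(\<rho>'_S, \<sigma>'_S)\<close> and \<open>(\<rho>'_E, \<sigma>'_E)\<close>: this keeps \<open>\<sigma>'\<close> and both marginals and can
  only decrease the mutual information, so everything reduces to a stochastic matrix taking
  distributions \<open>(p, q)\<close> to \<open>(w, r \<otimes> s)\<close>, where \<open>w\<close> has marginals \<open>u\<close> and \<open>v\<close>.

  With \<open>l = - ln s_min\<close> all likelihood ratios are at most \<open>exp l\<close>, where \<open>t (1 + l - ln t)\<^sup>2\<close> is concave.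
  Hence \<open>M\<close> can only increase, and with the data processing inequality this gives
  \<open>\<Delta>S \<ge> \<Delta>V / (2 sqrt M)\<close> for the joint distributions. The variances of \<open>w\<close> and of \<open>u \<otimes> v\<close> relative to
  \<open>r \<otimes> s\<close> differ by at most the Hellinger distance of \<open>w\<close> and \<open>u \<otimes> v\<close>, itself at most the square root of
  the mutual information, times a quadratic polynomial in \<open>l\<close>; this uses the Lipschitz property of
  \<open>t (ln t - m)\<^sup>2\<close> in \<open>sqrt t\<close>.
\<close>

section \<open>Scalar inequalities\<close>

text \<open>The variance is neither monotone under stochastic maps nor additive over correlated
  factors; these two failures shape the proof. Monotonicity holds instead for the second moment of
  the log ratio about \<open>1 + l\<close>: with \<open>c = 1 + l - ln t\<close> the function
  \<open>t * c^2\<close> has second derivative \<open>- 2 * (c - 1) / t\<close>, so 1 is the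
  smallest offset for which concavity reaches \<open>t = exp l\<close>. Divided by
  \<open>ln 2\<close>, this shift is the term \<open>1 / ln 2 - log 2 x\<close> of
  \<open>M_x\<close>. Additivity is repaired by comparing \<open>w\<close> with the product of its
  marginals; the relative entropy, in contrast, splits exactly, and its surplus, the mutual
  information, has a favourable sign. The slope of \<open>t * (ln t - m)^2\<close> in
  \<open>t\<close> is unbounded near 0, but in \<open>s = sqrt t\<close> it is bounded there. For
  large \<open>s\<close> the bound is kept affine in \<open>s\<close>, since replacing
  \<open>s\<close> by \<open>exp (l/2)\<close> would cost a factor exponential in \<open>l\<close>.
  The rational constants below are tuned so that everything fits under
  \<open>12 * (ln 2)^2 + l^2\<close>.\<close>

lemma exp_one_ge: "(8/3::real) \<le> exp 1"
proof -
  \<comment> \<open>The quadratic Taylor bound is used at 1/4 because at 1 or 1/2 it falls short of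
    8/3.\<close>
  have "exp (1/4::real) ^ 4 = exp 1" by (simp flip: exp_of_nat_mult)
  moreover have "(1 + 1/4 + (1/4)\<^sup>2 / 2 :: real) ^ 4 \<le> exp (1/4) ^ 4"
    by (intro power_mono exp_lower_Taylor_quadratic) auto
  moreover have "(8/3::real) \<le> (1 + 1/4 + (1/4)\<^sup>2 / 2) ^ 4" by (simp add: power_divide)
  ultimately show ?thesis by linarith
qed

text \<open>The value 2/3 is what later yields \<open>12 * (ln 2)^2 >= 16/3\<close> and
  \<open>sqrt (2 * ln 2) >= 23/20\<close>.\<close>

lemma ln_2_ge: "(2/3::real) \<le> ln 2"
proof -
  have "exp (2/3::real) = exp (1/12) ^ 8" by (simp flip: exp_of_nat_mult)
  also have "\<dots> \<le> (1 + 1/12 + (1/12)\<^sup>2) ^ 8" by (intro power_mono exp_bound) auto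
  also have "\<dots> \<le> 2" by (simp add: power_divide)
  finally show ?thesis by (subst ln_ge_iff) auto
qed

text \<open>The maximum is \<open>1 / exp 1\<close>, attained at 1; 3/8 is a rational stand-in for
  it.\<close>

lemma mult_exp_neg_le:
  fixes y :: real
  assumes "0 \<le> y"
  shows "y * exp (- y) \<le> 3/8"
proof -
  have "y \<le> exp (y - 1)" using exp_ge_add_one_self[of "y - 1"] by simp
  then have "y * exp (- y) \<le> exp (y - 1) * exp (- y)" by (rule mult_right_mono) simp
  also have "\<dots> = 1 / exp 1" by (simp add: exp_minus exp_diff field_simps)
  also have "\<dots> \<le> 3/8" using exp_one_ge by (simp add: field_simps)
  finally show ?thesis .
qed

lemma square_mult_exp_neg_le:
  fixes y :: real
  assumes "0 \<le> y"
  shows "y\<^sup>2 * exp (- y) \<le> 9/16"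
proof -
  \<comment> \<open>Halving \<open>y\<close> reduces the squared case to the square of the linear
    one, at the price of a factor 4.\<close>
  have "(y/2 * exp (- (y/2)))\<^sup>2 \<le> (3/8)\<^sup>2"
    using assms by (intro power_mono mult_exp_neg_le) auto
  moreover have "(exp (- (y/2)))\<^sup>2 = exp (- y)" by (simp flip: exp_of_nat_mult)
  ultimately show ?thesis by (simp add: power_mult_distrib power_divide mult.commute)
qed

text \<open>Expanding in \<open>y = - ln s\<close> leaves only \<open>s\<close>,
  \<open>s * y\<close> and \<open>s * y^2\<close>, all bounded on the unit interval. The
  coefficients 3 and 9/2 are 8 times 3/8 and 8 times 9/16.\<close>

lemma mult_ln_square_le:
  fixes s :: real
  assumes "0 < s" "s \<le> 1" "0 \<le> m"
  shows "2 * s * (2 * ln s - m)\<^sup>2 \<le> 2 * m\<^sup>2 + 3 * m + 9/2"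
proof -
  define y where "y = - ln s"
  have y: "0 \<le> y" "s = exp (- y)" using assms by (auto simp: y_def)
  have "m * (s * y) \<le> m * (3/8)" 
    using mult_exp_neg_le[OF y(1)] assms y by (intro mult_left_mono) (auto simp: mult.commute)
  moreover have "s * y\<^sup>2 \<le> 9/16" using square_mult_exp_neg_le[OF y(1)] y by (simp add: mult.commute)
  moreover have "s * m\<^sup>2 \<le> m\<^sup>2" using assms by (simp add: mult_left_le_one_le)
  moreover have "2 * s * (2 * ln s - m)\<^sup>2 = 2 * (s * m\<^sup>2) + 8 * (m * (s * y)) + 8 * (s * y\<^sup>2)"
    by (simp add: y_def power2_eq_square algebra_simps)
  ultimately show ?thesis by linarith
qed

text \<open>The centre \<open>l/2\<close> is the midpoint of the range of \<open>ln x\<close> for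
  \<open>x\<close> between 1 and \<open>exp l\<close>, where the square is at most
  \<open>l^2/4\<close>. Below 1 the logarithm is unbounded, but the factor \<open>x\<close> tames it
  into an additive constant. Scaled by a reference probability, such a constant sums to
  itself.\<close>

lemma square_sub_ln_le:
  fixes x l :: real
  assumes "0 \<le> x" "x \<le> exp l" "0 \<le> l"
  shows "x * (ln x - l/2)\<^sup>2 \<le> x * (l\<^sup>2/4) + (3/8 * l + 9/16)"
proof (cases "x \<le> 1")
  case True
  show ?thesis
  proof (cases "x = 0")
    case False
    define y where "y = - ln x"
    have y: "0 \<le> y" "x = exp (- y)" using assms True False by (auto simp: y_def)
    have "l * (x * y) \<le> l * (3/8)"
      using mult_exp_neg_le[OF y(1)] assms y by (intro mult_left_mono) (auto simp: mult.commute)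
    moreover have "x * y\<^sup>2 \<le> 9/16" using square_mult_exp_neg_le[OF y(1)] y by (simp add: mult.commute)
    moreover have "x * (ln x - l/2)\<^sup>2 = x * (l\<^sup>2/4) + l * (x * y) + x * y\<^sup>2"
      by (simp add: y_def power2_eq_square algebra_simps)
    ultimately show ?thesis by linarith
  qed (use assms in auto)
next
  case False
  then have "0 \<le> ln x" "ln x \<le> l" using assms ln_le_cancel_iff[of x "exp l"] by auto
  then have "0 \<le> ln x * (l - ln x)" by simp
  then have "(ln x - l/2)\<^sup>2 \<le> l\<^sup>2/4" by (simp add: power2_eq_square algebra_simps)
  then have "x * (ln x - l/2)\<^sup>2 \<le> x * (l\<^sup>2/4)" using assms by (intro mult_left_mono) auto
  then show ?thesis using assms by simp
qed

text \<open>With \<open>t = s\<^sup>2\<close> this is the derivative of \<open>t (ln t - m)\<^sup>2\<close> with respect to \<open>s\<close>;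
  the square-root scale makes it comparable with the Hellinger distance.\<close>

lemma abs_deriv_le:
  fixes s l m :: real
  assumes s: "0 < s" "2 * ln s \<le> l" and m: "0 \<le> m" "m \<le> l"
  shows "\<bar>2 * s * ((2 * ln s - m)\<^sup>2 + 2 * (2 * ln s - m))\<bar>
    \<le> 2 * (l\<^sup>2 + 1 + 2 * (l - m)) * s + (2 * m\<^sup>2 + 3 * m + 9/2)"
proof -
  define k where "k = 2 * ln s - m"
  have k: "k \<le> l - m" using s by (simp add: k_def)
  have lower: "- 1 \<le> k\<^sup>2 + 2 * k"
    using zero_le_power2[of "k + 1"] by (simp add: power2_eq_square algebra_simps)
  have m2: "m\<^sup>2 \<le> l\<^sup>2" using m by (intro power_mono)
  have A: "1 \<le> l\<^sup>2 + 1 + 2 * (l - m)" using m by simp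
  have "\<bar>2 * s * (k\<^sup>2 + 2 * k)\<bar> \<le> 2 * (l\<^sup>2 + 1 + 2 * (l - m)) * s + (2 * m\<^sup>2 + 3 * m + 9/2)"
  proof (cases "s \<le> 1")
    case True
    then have "ln s \<le> 0" using s by simp
    then have "k \<le> 0" using m unfolding k_def by linarith
    then have "2 * s * (k\<^sup>2 + 2 * k) \<le> 2 * s * k\<^sup>2" using s by (intro mult_left_mono) auto
    also have "\<dots> \<le> 2 * m\<^sup>2 + 3 * m + 9/2"
      unfolding k_def using s True m by (intro mult_ln_square_le)
    finally have "2 * s * (k\<^sup>2 + 2 * k) \<le> 2 * m\<^sup>2 + 3 * m + 9/2" .
    moreover have "- (2 * s * 1) \<le> 2 * s * (k\<^sup>2 + 2 * k)" 
      using mult_left_mono[OF lower, of "2 * s"] s by simp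
    moreover have "0 \<le> 2 * (l\<^sup>2 + 1 + 2 * (l - m)) * s" using A s by simp
    moreover have "0 \<le> m\<^sup>2" by simp
    ultimately show ?thesis using True m unfolding abs_le_iff by linarith
  next
    case False
    then have "- m \<le> k" by (simp add: k_def)
    have "k\<^sup>2 + 2 * k \<le> l\<^sup>2 + 1 + 2 * (l - m)"
    proof (cases "k \<le> 0")
      case True
      then have "k\<^sup>2 \<le> m\<^sup>2" using \<open>- m \<le> k\<close> by (simp add: abs_le_square_iff[symmetric])
      then have "k\<^sup>2 \<le> l\<^sup>2" using m2 by (rule order_trans)
      then show ?thesis using True m by (smt (verit))
    next
      case False
      then have "k\<^sup>2 \<le> l\<^sup>2" using k m by (intro power_mono) auto
      then show ?thesis using k by (smt (verit))
    qed
    then have "\<bar>k\<^sup>2 + 2 * k\<bar> \<le> l\<^sup>2 + 1 + 2 * (l - m)" using lower A by linarith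
    then have "2 * s * \<bar>k\<^sup>2 + 2 * k\<bar> \<le> 2 * s * (l\<^sup>2 + 1 + 2 * (l - m))"
      using s by (intro mult_left_mono) auto
    moreover have "\<bar>2 * s * (k\<^sup>2 + 2 * k)\<bar> = 2 * s * \<bar>k\<^sup>2 + 2 * k\<bar>" using s by (simp add: abs_mult)
    moreover have "2 * s * (l\<^sup>2 + 1 + 2 * (l - m)) = 2 * (l\<^sup>2 + 1 + 2 * (l - m)) * s" by simp
    moreover have "0 \<le> 2 * m\<^sup>2 + 3 * m + 9/2" using m by simp
    ultimately show ?thesis by linarith
  qed
  then show ?thesis by (simp add: k_def)
qed

text \<open>Mean value theorem. The bound on the derivative increases with the point, hence the
  larger of \<open>s\<close> and \<open>t\<close>.\<close>

lemma sqrt_scale_lipschitz: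
  fixes l m s t :: real
  assumes s: "0 < s" "2 * ln s \<le> l" and t: "0 < t" "2 * ln t \<le> l" and m: "0 \<le> m" "m \<le> l"
  shows "s\<^sup>2 * (2 * ln s - m)\<^sup>2 - t\<^sup>2 * (2 * ln t - m)\<^sup>2
    \<le> \<bar>s - t\<bar> * (2 * (l\<^sup>2 + 1 + 2 * (l - m)) * max s t + (2 * m\<^sup>2 + 3 * m + 9/2))"
proof -
  define g where "g = (\<lambda>s. s\<^sup>2 * (2 * ln s - m)\<^sup>2)"
  define A where "A = 2 * (l\<^sup>2 + 1 + 2 * (l - m))"
  define B where "B = 2 * m\<^sup>2 + 3 * m + 9/2"
  have A: "0 \<le> A" using m by (simp add: A_def)
  have der: "(g has_real_derivative 2 * x * ((2 * ln x - m)\<^sup>2 + 2 * (2 * ln x - m))) (at x)"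
    if "0 < x" for x
    unfolding g_def using that
    by (auto intro!: derivative_eq_intros simp: field_simps power2_eq_square)
  have key: "\<bar>g b - g a\<bar> \<le> (b - a) * (A * b + B)"
    if ab: "0 < a" "a < b" "2 * ln b \<le> l" for a b
  proof -
    obtain z where z: "a < z" "z < b" "g b - g a = (b - a) * (2 * z * ((2 * ln z - m)\<^sup>2 + 2 * (2 * ln z - m)))"
      using MVT2[OF ab(2), of g "\<lambda>x. 2 * x * ((2 * ln x - m)\<^sup>2 + 2 * (2 * ln x - m))"] der ab by auto
    have "ln z \<le> ln b" using z ab by simp
    then have "2 * ln z \<le> l" using ab by linarith
    then have "\<bar>2 * z * ((2 * ln z - m)\<^sup>2 + 2 * (2 * ln z - m))\<bar> \<le> A * z + B"
      unfolding A_def B_def using ab z m by (intro abs_deriv_le) auto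
    also have "\<dots> \<le> A * b + B" using z A by (simp add: mult_left_mono)
    finally show ?thesis using ab by (simp add: z abs_mult mult_left_mono)
  qed
  have "g s - g t \<le> \<bar>s - t\<bar> * (A * max s t + B)"
  proof (cases s t rule: linorder_cases)
    case less
    then show ?thesis using key[of s t] s t by (simp add: max_def)
  next
    case greater
    then show ?thesis using key[of t s] s t by (simp add: max_def)
  qed simp
  then show ?thesis by (simp add: g_def A_def B_def)
qed

text \<open>Here \<open>y\<close> may exceed \<open>exp l\<close>: the ratio of the product of
  marginals to the reference has no such bound among the assumptions. In that case \<open>y\<close>
  is lowered to \<open>exp l\<close>. Since \<open>ln y >= l >= m\<close>, the subtracted term
  decreases, so the left side grows, while the right side shrinks because \<open>x\<close> stays
  below both points.\<close>

lemma sqrt_scale_lipschitz':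
  fixes l m x y :: real
  assumes x: "0 < x" "x \<le> exp l" and y: "0 < y" and m: "0 \<le> m" "m \<le> l"
  shows "x * (ln x - m)\<^sup>2 - y * (ln y - m)\<^sup>2
    \<le> \<bar>sqrt x - sqrt y\<bar> * (2 * (l\<^sup>2 + 1 + 2 * (l - m)) * max (sqrt x) (sqrt y) + (2 * m\<^sup>2 + 3 * m + 9/2))"
    (is "_ \<le> _ * (?A * _ + ?B)")
proof -
  have AB: "0 \<le> ?A" "0 \<le> ?B" using m by auto
  have lnx: "ln x \<le> l" using x by (metis exp_gt_zero ln_exp ln_le_cancel_iff)
  have *: "z * (ln z - m)\<^sup>2 = (sqrt z)\<^sup>2 * (2 * ln (sqrt z) - m)\<^sup>2" "2 * ln (sqrt z) = ln z" if "0 < z" for z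
    using that by (auto simp: ln_sqrt)
  show ?thesis
  proof (cases "ln y \<le> l")
    case True
    show ?thesis unfolding *(1)[OF x(1)] *(1)[OF y]
      using x y m lnx True by (intro sqrt_scale_lipschitz) (auto simp: *)
  next
    case False
    define z where "z = exp l"
    have z: "0 < z" "ln z = l" by (auto simp: z_def)
    have zy: "z \<le> y" using False y z by (metis linear ln_le_cancel_iff)
    have "z * (ln z - m)\<^sup>2 \<le> y * (ln y - m)\<^sup>2"
      using zy z y m False by (intro mult_mono power_mono) auto
    then have "x * (ln x - m)\<^sup>2 - y * (ln y - m)\<^sup>2 \<le> x * (ln x - m)\<^sup>2 - z * (ln z - m)\<^sup>2" by simp
    also have "\<dots> \<le> \<bar>sqrt x - sqrt z\<bar> * (?A * max (sqrt x) (sqrt z) + ?B)"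
      unfolding *(1)[OF x(1)] *(1)[OF z(1)]
      using x z m lnx by (intro sqrt_scale_lipschitz) (auto simp: *)
    also have "\<dots> \<le> \<bar>sqrt x - sqrt y\<bar> * (?A * max (sqrt x) (sqrt y) + ?B)"
    proof (rule mult_mono)
      have "sqrt x \<le> sqrt z" "sqrt z \<le> sqrt y" using x zy by (auto simp: z_def)
      then show "\<bar>sqrt x - sqrt z\<bar> \<le> \<bar>sqrt x - sqrt y\<bar>" by simp
      have "max (sqrt x) (sqrt z) \<le> max (sqrt x) (sqrt y)" using zy by (auto simp: max_def)
      then show "?A * max (sqrt x) (sqrt z) + ?B \<le> ?A * max (sqrt x) (sqrt y) + ?B"
        using AB by (intro add_right_mono mult_left_mono)
      have "0 \<le> max (sqrt x) (sqrt z)" using x by (simp add: max_def)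
      then show "0 \<le> ?A * max (sqrt x) (sqrt z) + ?B" by (rule add_nonneg_nonneg[OF mult_nonneg_nonneg[OF AB(1)] AB(2)])
    qed simp
    finally show ?thesis .
  qed
qed

section \<open>Relative entropy and its variance for finite distributions\<close>

text \<open>Relative entropy in nats. Since \<open>ln 0 = 0\<close>, no support condition is built
  in; lemmas that depend on one state it.\<close>

definition kl :: "'a set \<Rightarrow> ('a \<Rightarrow> real) \<Rightarrow> ('a \<Rightarrow> real) \<Rightarrow> real" where
  "kl J p q = (\<Sum>i\<in>J. p i * (ln (p i) - ln (q i)))"

definition klvar :: "'a set \<Rightarrow> ('a \<Rightarrow> real) \<Rightarrow> ('a \<Rightarrow> real) \<Rightarrow> real" where
  "klvar J p q = (\<Sum>i\<in>J. p i * (ln (p i) - ln (q i))\<^sup>2) - (kl J p q)\<^sup>2"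

text \<open>Second moment equals variance plus squared bias. The centre \<open>c\<close> is used as
  \<open>l/2\<close>, as the relative entropy of the product of marginals, and as
  \<open>1 + l\<close>.\<close>

lemma sum_square_shift:
  assumes "(\<Sum>i\<in>J. p i) = 1"
  shows "(\<Sum>i\<in>J. p i * (ln (p i) - ln (q i) - c)\<^sup>2) = klvar J p q + (kl J p q - c)\<^sup>2"
proof -
  have "(\<Sum>i\<in>J. p i * (ln (p i) - ln (q i) - c)\<^sup>2) =
    (\<Sum>i\<in>J. p i * (ln (p i) - ln (q i))\<^sup>2 - 2 * c * (p i * (ln (p i) - ln (q i))) + c\<^sup>2 * p i)"
    by (intro sum.cong) (auto simp: power2_eq_square algebra_simps)
  also have "\<dots> = (\<Sum>i\<in>J. p i * (ln (p i) - ln (q i))\<^sup>2) - 2 * c * kl J p q + c\<^sup>2 * 1"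
    unfolding kl_def assms[symmetric] by (simp add: sum.distrib sum_subtractf sum_distrib_left)
  finally show ?thesis by (simp add: klvar_def power2_eq_square algebra_simps)
qed

lemma klvar_nonneg:
  assumes "(\<Sum>i\<in>J. p i) = 1" "\<And>i. i \<in> J \<Longrightarrow> 0 \<le> p i"
  shows "0 \<le> klvar J p q"
proof -
  have "0 \<le> (\<Sum>i\<in>J. p i * (ln (p i) - ln (q i) - kl J p q)\<^sup>2)"
    using assms by (intro sum_nonneg) auto
  then show ?thesis by (simp add: sum_square_shift[OF assms(1)])
qed

text \<open>The variance is at most the second moment about any centre, here \<open>l/2\<close>. The
  pointwise bound has the form \<open>p * a + q * b\<close>, so that it sums to
  \<open>a + b\<close>.\<close>

lemma klvar_le:
  assumes "(\<Sum>i\<in>J. p i) = 1" "\<And>i. i \<in> J \<Longrightarrow> 0 \<le> p i"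
    "(\<Sum>i\<in>J. q i) = 1" "\<And>i. i \<in> J \<Longrightarrow> 0 < q i"
    "\<And>i. i \<in> J \<Longrightarrow> p i \<le> exp l * q i" "0 \<le> l"
  shows "klvar J p q \<le> l\<^sup>2/4 + (3/8 * l + 9/16)"
proof -
  have "klvar J p q \<le> (\<Sum>i\<in>J. p i * (ln (p i) - ln (q i) - l/2)\<^sup>2)"
    by (simp add: sum_square_shift[OF assms(1)])
  also have "\<dots> \<le> (\<Sum>i\<in>J. p i * (l\<^sup>2/4) + q i * (3/8 * l + 9/16))"
  proof (intro sum_mono)
    fix i assume i: "i \<in> J"
    show "p i * (ln (p i) - ln (q i) - l/2)\<^sup>2 \<le> p i * (l\<^sup>2/4) + q i * (3/8 * l + 9/16)"
    proof (cases "p i = 0")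
      case True
      then show ?thesis using assms(4)[OF i] assms(6) by simp
    next
      case False
      have "q i * (p i / q i * (ln (p i / q i) - l/2)\<^sup>2)
          \<le> q i * (p i / q i * (l\<^sup>2/4) + (3/8 * l + 9/16))"
        using i assms(2,4,5)[OF i] assms(6)
        by (intro mult_left_mono square_sub_ln_le) (auto simp: field_simps)
      moreover have "ln (p i / q i) = ln (p i) - ln (q i)"
        using False assms(2,4)[OF i] by (simp add: ln_div)
      moreover have "q i \<noteq> 0" using assms(4)[OF i] by simp
      ultimately show ?thesis by (simp add: distrib_left)
    qed
  qed
  also have "\<dots> = l\<^sup>2/4 + (3/8 * l + 9/16)"
    unfolding sum.distrib sum_distrib_right[symmetric] assms by simp
  finally show ?thesis .
qed

text \<open>The bound \<open>ln x <= x - 1\<close> at \<open>x = sqrt (q / p)\<close>. The terms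
  \<open>- p i + q i\<close> cancel in total and make the inequality hold for each summand
  separately.\<close>

lemma hellinger_le_kl:
  assumes "(\<Sum>i\<in>J. p i) = 1" "\<And>i. i \<in> J \<Longrightarrow> 0 \<le> p i"
    "(\<Sum>i\<in>J. q i) = 1" "\<And>i. i \<in> J \<Longrightarrow> 0 \<le> q i"
    "\<And>i. i \<in> J \<Longrightarrow> q i = 0 \<Longrightarrow> p i = 0"
  shows "(\<Sum>i\<in>J. (sqrt (p i) - sqrt (q i))\<^sup>2) \<le> kl J p q"
proof -
  have "(\<Sum>i\<in>J. (sqrt (p i) - sqrt (q i))\<^sup>2)
      \<le> (\<Sum>i\<in>J. p i * (ln (p i) - ln (q i)) - p i + q i)"
  proof (intro sum_mono)
    fix i assume i: "i \<in> J"
    show "(sqrt (p i) - sqrt (q i))\<^sup>2 \<le> p i * (ln (p i) - ln (q i)) - p i + q i"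
    proof (cases "p i = 0")
      case True
      then show ?thesis using assms(4)[OF i] by simp
    next
      case False
      then have pos: "0 < p i" "0 < q i" using assms(2,4,5)[OF i] by force+
      have "ln (sqrt (q i) / sqrt (p i)) \<le> sqrt (q i) / sqrt (p i) - 1"
        using pos by (intro ln_le_minus_one) auto
      then have "(ln (q i) - ln (p i)) / 2 \<le> sqrt (q i) / sqrt (p i) - 1"
        using pos by (simp add: ln_div ln_sqrt diff_divide_distrib)
      then have "2 * p i * ((ln (q i) - ln (p i)) / 2) \<le> 2 * p i * (sqrt (q i) / sqrt (p i) - 1)"
        using pos by (intro mult_left_mono) auto
      moreover have "p i * (sqrt (q i) / sqrt (p i)) = sqrt (p i) * sqrt (q i)"
        using pos by (simp add: field_simps)
      moreover have "2 * p i * ((ln (q i) - ln (p i)) / 2) = p i * (ln (q i) - ln (p i))" by simp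
      ultimately show ?thesis
        using pos by (simp add: power2_eq_square algebra_simps)
    qed
  qed
  also have "\<dots> = kl J p q" using assms(1,3) by (simp add: kl_def sum.distrib sum_subtractf)
  finally show ?thesis .
qed

lemma kl_nonneg:
  assumes "(\<Sum>i\<in>J. p i) = 1" "\<And>i. i \<in> J \<Longrightarrow> 0 \<le> p i"
    "(\<Sum>i\<in>J. q i) = 1" "\<And>i. i \<in> J \<Longrightarrow> 0 \<le> q i"
    "\<And>i. i \<in> J \<Longrightarrow> q i = 0 \<Longrightarrow> p i = 0"
  shows "0 \<le> kl J p q"
  using hellinger_le_kl[OF assms] by (meson order_trans sum_nonneg zero_le_power2)

lemma sum_mult_le_sqrt:
  fixes a b :: "'a \<Rightarrow> real"
  assumes "finite J"
  shows "(\<Sum>i\<in>J. a i * b i) \<le> sqrt (\<Sum>i\<in>J. (a i)\<^sup>2) * sqrt (\<Sum>i\<in>J. (b i)\<^sup>2)"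
proof -
  define x y z where "x = (\<Sum>i\<in>J. (a i)\<^sup>2)" and "y = (\<Sum>i\<in>J. (b i)\<^sup>2)" and "z = (\<Sum>i\<in>J. a i * b i)"
  have nn: "0 \<le> x" "0 \<le> y" by (auto simp: x_def y_def sum_nonneg)
  have *: "0 \<le> s\<^sup>2 * x - 2 * s * t * z + t\<^sup>2 * y" for s t
  proof -
    have "0 \<le> (\<Sum>i\<in>J. (s * a i - t * b i)\<^sup>2)" by (simp add: sum_nonneg)
    also have "\<dots> = (\<Sum>i\<in>J. s\<^sup>2 * (a i)\<^sup>2 - 2 * s * t * (a i * b i) + t\<^sup>2 * (b i)\<^sup>2)"
      by (intro sum.cong) (auto simp: power2_eq_square algebra_simps)
    also have "\<dots> = s\<^sup>2 * x - 2 * s * t * z + t\<^sup>2 * y"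
      by (simp add: x_def y_def z_def sum.distrib sum_subtractf sum_distrib_left)
    finally show ?thesis .
  qed
  have "z\<^sup>2 \<le> x * y"
  proof (cases "y = 0")
    case True
    then have "\<forall>i\<in>J. (b i)\<^sup>2 = 0" using assms unfolding y_def by (subst (asm) sum_nonneg_eq_0_iff) auto
    then have "z = 0" by (simp add: z_def)
    then show ?thesis using nn by simp
  next
    case False
    \<comment> \<open>The nonnegative quadratic form is evaluated at its minimizing
      direction.\<close>
    have "0 \<le> y * (x * y - z\<^sup>2)" using *[of y z] by (simp add: power2_eq_square algebra_simps)
    then show ?thesis using False nn by (simp add: zero_le_mult_iff)
  qed
  then have "\<bar>z\<bar> \<le> sqrt (x * y)" using real_sqrt_le_mono by fastforce
  then show ?thesis unfolding x_def y_def z_def by (simp add: real_sqrt_mult)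
qed

text \<open>With \<open>c = kl J z R\<close> the second term below is exactly the variance, so the difference of
  variances is at most a sum of differences of \<open>t (ln t - c)\<^sup>2\<close> at \<open>w / R\<close> and \<open>z / R\<close>, and these
  are controlled by the Hellinger distance.\<close>

lemma klvar_diff_le_sqrt:
  assumes J: "finite J"
    and w: "(\<Sum>i\<in>J. w i) = 1" "\<And>i. i \<in> J \<Longrightarrow> 0 \<le> w i"
    and z: "(\<Sum>i\<in>J. z i) = 1" "\<And>i. i \<in> J \<Longrightarrow> 0 \<le> z i"
    and R: "(\<Sum>i\<in>J. R i) = 1" "\<And>i. i \<in> J \<Longrightarrow> 0 < R i"
    and wz: "\<And>i. i \<in> J \<Longrightarrow> z i = 0 \<Longrightarrow> w i = 0"
    and wR: "\<And>i. i \<in> J \<Longrightarrow> w i \<le> exp l * R i"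
    and m: "kl J z R \<le> l"
  shows "klvar J w R - klvar J z R \<le> sqrt (kl J w z) * (29/6 * l\<^sup>2 + 17/3 * l + 22/3)"
proof -
  define m where "m = kl J z R"
  have m0: "0 \<le> m" unfolding m_def using z R(1) less_imp_le[OF R(2)] R(2) by (intro kl_nonneg) force+
  have ml: "m \<le> l" using assms by (simp add: m_def)
  define A where "A = 2 * (l\<^sup>2 + 1 + 2 * (l - m))"
  define B where "B = 2 * m\<^sup>2 + 3 * m + 9/2"
  have AB: "0 \<le> A" "0 \<le> B" using m0 ml by (auto simp: A_def B_def)
  have kl0: "0 \<le> kl J w z" by (rule kl_nonneg[OF w z wz])
  define d where "d = (\<lambda>i. \<bar>sqrt (w i) - sqrt (z i)\<bar>)"
  define M where "M = (\<lambda>i. max (sqrt (w i)) (sqrt (z i)))"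
  have "klvar J w R - klvar J z R \<le> (\<Sum>i\<in>J. w i * (ln (w i) - ln (R i) - m)\<^sup>2)
      - (\<Sum>i\<in>J. z i * (ln (z i) - ln (R i) - m)\<^sup>2)"
    unfolding sum_square_shift[OF w(1)] sum_square_shift[OF z(1)] by (simp add: m_def)
  also have "\<dots> = (\<Sum>i\<in>J. w i * (ln (w i) - ln (R i) - m)\<^sup>2 - z i * (ln (z i) - ln (R i) - m)\<^sup>2)"
    by (simp add: sum_subtractf)
  also have "\<dots> \<le> (\<Sum>i\<in>J. d i * (A * M i + B * sqrt (R i)))"
  proof (intro sum_mono)
    fix i assume i: "i \<in> J"
    show "w i * (ln (w i) - ln (R i) - m)\<^sup>2 - z i * (ln (z i) - ln (R i) - m)\<^sup>2
        \<le> d i * (A * M i + B * sqrt (R i))"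
    proof (cases "w i = 0")
      case True
      then have "0 \<le> M i" using z(2)[OF i] by (simp add: M_def)
      then have "0 \<le> d i * (A * M i + B * sqrt (R i))"
        using AB less_imp_le[OF R(2)[OF i]] by (simp add: d_def)
      moreover have "0 \<le> z i * (ln (z i) - ln (R i) - m)\<^sup>2" using z(2)[OF i] by simp
      ultimately show ?thesis using True by simp
    next
      case False
      then have pos: "0 < w i" "0 < z i" "0 < R i" using w(2)[OF i] z(2)[OF i] wz[OF i] R(2)[OF i] by force+
      have ln: "ln (w i / R i) = ln (w i) - ln (R i)" "ln (z i / R i) = ln (z i) - ln (R i)"
        using pos by (auto simp: ln_div)
      have div: "sqrt (w i / R i) = sqrt (w i) / sqrt (R i)" "sqrt (z i / R i) = sqrt (z i) / sqrt (R i)"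
        by (auto simp: real_sqrt_divide)
      have d: "\<bar>sqrt (w i / R i) - sqrt (z i / R i)\<bar> = d i / sqrt (R i)"
        unfolding div d_def using pos by (simp flip: diff_divide_distrib)
      have M: "max (sqrt (w i / R i)) (sqrt (z i / R i)) = M i / sqrt (R i)"
        unfolding div M_def using pos by (simp add: max_def divide_le_cancel)
      have "R i * (w i / R i * (ln (w i / R i) - m)\<^sup>2 - z i / R i * (ln (z i / R i) - m)\<^sup>2)
          \<le> R i * (d i / sqrt (R i) * (A * (M i / sqrt (R i)) + B))"
        unfolding d[symmetric] M[symmetric] A_def B_def using pos m0 ml wR[OF i]
        by (intro mult_left_mono sqrt_scale_lipschitz') (auto simp: field_simps)
      moreover have "R i * (d i / sqrt (R i) * (A * (M i / sqrt (R i)) + B)) = d i * (A * M i + B * sqrt (R i))"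
      proof -
        have "s * s * (a / s * (A * (b / s) + B)) = a * (A * b + B * s)" if "0 < s" for a b s
          using that by (simp add: field_simps)
        from this[of "sqrt (R i)"] show ?thesis using pos by simp
      qed
      moreover have "R i * (w i / R i * a - z i / R i * b) = w i * a - z i * b" for a b
        using pos by (simp add: field_simps)
      ultimately show ?thesis unfolding ln by (simp only:)
    qed
  qed
  also have "(\<Sum>i\<in>J. d i * (A * M i + B * sqrt (R i)))
      = (\<Sum>i\<in>J. A * (d i * M i)) + (\<Sum>i\<in>J. B * (d i * sqrt (R i)))"
    unfolding sum.distrib[symmetric] by (intro sum.cong) (auto simp: algebra_simps)
  finally have "klvar J w R - klvar J z R \<le> A * (\<Sum>i\<in>J. d i * M i) + B * (\<Sum>i\<in>J. d i * sqrt (R i))"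
    unfolding sum_distrib_left .
  \<comment> \<open>Cauchy-Schwarz twice: \<open>d\<close> has squared norm at most the relative
    entropy, \<open>M\<close> at most 2 because \<open>(M i)^2 <= w i + z i\<close>, and
    \<open>sqrt R\<close> exactly 1.\<close>
  also have "A * (\<Sum>i\<in>J. d i * M i) + B * (\<Sum>i\<in>J. d i * sqrt (R i)) \<le> A * (sqrt (kl J w z) * sqrt 2) + B * (sqrt (kl J w z) * 1)"
  proof -
    have d2: "(\<Sum>i\<in>J. (d i)\<^sup>2) \<le> kl J w z"
    proof -
      have "(d i)\<^sup>2 = (sqrt (w i) - sqrt (z i))\<^sup>2" for i by (simp add: d_def)
      then show ?thesis using hellinger_le_kl[OF w z wz] by (simp only:)
    qed
    have M2: "(\<Sum>i\<in>J. (M i)\<^sup>2) \<le> 2"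
    proof -
      have "(\<Sum>i\<in>J. (M i)\<^sup>2) \<le> (\<Sum>i\<in>J. w i + z i)"
        using w(2) z(2) by (intro sum_mono) (auto simp: M_def max_def)
      then show ?thesis by (simp add: sum.distrib w z)
    qed
    have R2: "(\<Sum>i\<in>J. (sqrt (R i))\<^sup>2) = 1"
      unfolding R(1)[symmetric] using less_imp_le[OF R(2)] by (intro sum.cong) auto
    have "(\<Sum>i\<in>J. d i * M i) \<le> sqrt (\<Sum>i\<in>J. (d i)\<^sup>2) * sqrt (\<Sum>i\<in>J. (M i)\<^sup>2)"
      by (rule sum_mult_le_sqrt[OF J])
    also have "\<dots> \<le> sqrt (kl J w z) * sqrt 2"
      using d2 M2 kl0 by (intro mult_mono) (auto simp: sum_nonneg)
    finally have 1: "(\<Sum>i\<in>J. d i * M i) \<le> sqrt (kl J w z) * sqrt 2" .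
    have "(\<Sum>i\<in>J. d i * sqrt (R i)) \<le> sqrt (\<Sum>i\<in>J. (d i)\<^sup>2) * sqrt (\<Sum>i\<in>J. (sqrt (R i))\<^sup>2)"
      by (rule sum_mult_le_sqrt[OF J])
    also have "\<dots> \<le> sqrt (kl J w z) * 1"
      unfolding R2 using d2 by simp
    finally have 2: "(\<Sum>i\<in>J. d i * sqrt (R i)) \<le> sqrt (kl J w z) * 1" .
    show ?thesis using 1 2 AB by (intro add_mono mult_left_mono)
  qed
  also have "\<dots> = sqrt (kl J w z) * (A * sqrt 2 + B)" by (simp add: algebra_simps)
  also have "\<dots> \<le> sqrt (kl J w z) * (29/6 * l\<^sup>2 + 17/3 * l + 22/3)"
  proof (rule mult_left_mono)
    \<comment> \<open>With 17/12 the coefficient of \<open>m\<close> becomes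
      \<open>3 - 17/3\<close>, which is negative, so the worst case is \<open>m = 0\<close> there
      and \<open>m^2 = l^2\<close> in the square.\<close>
    have "sqrt 2 \<le> 17/12" by (rule real_le_lsqrt) (auto simp: power2_eq_square)
    then have "A * sqrt 2 \<le> A * (17/12)" using AB by (intro mult_left_mono)
    moreover have "A * (17/12) + B \<le> 29/6 * l\<^sup>2 + 17/3 * l + 22/3"
    proof -
      have "2 * (b + 1 + 2 * (l - m)) * (17/12) + (2 * a + 3 * m + 9/2) \<le> 29/6 * b + 17/3 * l + 22/3"
        if "a \<le> b" for a b using that m0 ml by argo
      moreover have "m\<^sup>2 \<le> l\<^sup>2" using m0 ml by (intro power_mono)
      ultimately show ?thesis unfolding A_def B_def by blast
    qed
    ultimately show "A * sqrt 2 + B \<le> 29/6 * l\<^sup>2 + 17/3 * l + 22/3" by linarith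
    show "0 \<le> sqrt (kl J w z)" using kl0 by simp
  qed
  finally show ?thesis .
qed

section \<open>Monotonicity under stochastic maps\<close>

lemma mult_ln_tangent:
  fixes x y :: real
  assumes "0 \<le> x" "0 < y"
  shows "y * ln y + (ln y + 1) * (x - y) \<le> x * ln x"
proof (cases "x = 0")
  case False
  then have x: "0 < x" using assms by simp
  have "ln (y / x) \<le> y / x - 1" using x assms by (intro ln_le_minus_one) simp
  then have "x * (ln y - ln x) \<le> x * (y / x - 1)"
    using x assms by (intro mult_left_mono) (auto simp: ln_div)
  then show ?thesis using x by (simp add: algebra_simps)
qed (use assms in \<open>simp add: algebra_simps\<close>)


text \<open>Equality holds at 0 and the derivative \<open>2 * k * (1 - exp (- k))\<close> is
  nonnegative. Rearranged, it reads \<open>k^2 <= (2 + 2 * k) * (k - 1 + exp (- k))\<close>.\<close>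

lemma exp_neg_bound:
  fixes k :: real
  assumes "0 \<le> k"
  shows "2 \<le> exp (- k) * (2 + 2 * k) + k\<^sup>2"
proof -
  have "exp (- 0) * (2 + 2 * 0) + 0\<^sup>2 \<le> exp (- k) * (2 + 2 * k) + k\<^sup>2"
  proof (rule DERIV_nonneg_imp_nondecreasing[OF assms])
    fix x :: real assume x: "0 \<le> x"
    have "((\<lambda>k. exp (- k) * (2 + 2 * k) + k\<^sup>2) has_real_derivative 2 * x * (1 - exp (- x))) (at x)"
      by (auto intro!: derivative_eq_intros simp: algebra_simps)
    moreover have "0 \<le> 2 * x * (1 - exp (- x))" using x by simp
    ultimately show "\<exists>y. ((\<lambda>k. exp (- k) * (2 + 2 * k) + k\<^sup>2) has_real_derivative y) (at x) \<and> 0 \<le> y" by blast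
  qed
  then show ?thesis by simp
qed

text \<open>The bracket is the Bregman divergence of \<open>x * ln x\<close> between
  \<open>z\<close> and 1. Divided by \<open>z\<close> it is \<open>k - 1 + exp (- k)\<close> with
  \<open>k = ln z\<close>: about \<open>k^2 / 2\<close> near 0, which explains the factor 2, and
  only linear for large positive \<open>k\<close>, where \<open>c >= 1 + k\<close> supplies the
  missing growth.\<close>

lemma mult_ln_square_le_bregman:
  fixes z c :: real
  assumes z: "0 < z" and c: "1 \<le> c" "1 \<le> c - ln z"
  shows "z * (ln z)\<^sup>2 \<le> 2 * c * (z * ln z - z + 1)"
proof -
  define k where "k = ln z"
  have zk: "z = exp k" using z by (simp add: k_def)
  have *: "k\<^sup>2 \<le> 2 * c * (k - 1 + exp (- k))"
  proof (cases "0 \<le> k")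
    case True
    have "k\<^sup>2 \<le> (2 + 2 * k) * (k - 1 + exp (- k))"
      using exp_neg_bound[OF True] by (simp add: power2_eq_square algebra_simps)
    also have "\<dots> \<le> 2 * c * (k - 1 + exp (- k))"
      using c exp_ge_add_one_self[of "- k"] by (intro mult_right_mono) (auto simp: k_def)
    finally show ?thesis .
  next
    case False
    then have "1 + (- k) + (- k)\<^sup>2 / 2 \<le> exp (- k)" by (intro exp_lower_Taylor_quadratic) simp
    then have "k\<^sup>2 \<le> 2 * 1 * (k - 1 + exp (- k))" by simp
    also have "\<dots> \<le> 2 * c * (k - 1 + exp (- k))"
      using c exp_ge_add_one_self[of "- k"] by (intro mult_right_mono mult_left_mono) auto
    finally show ?thesis .
  qed
  have "z * k\<^sup>2 \<le> z * (2 * c * (k - 1 + exp (- k)))" using z * by (intro mult_left_mono) auto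
  also have "\<dots> = 2 * c * (z * k - z + z * exp (- k))" by (simp add: algebra_simps)
  also have "z * exp (- k) = 1" by (simp add: zk flip: exp_add)
  finally show ?thesis by (simp add: k_def)
qed

text \<open>With \<open>k = ln (x / y)\<close> the gap to the tangent line is
  \<open>2 * c * (x * k - x + y) - x * k^2\<close>, which is \<open>y\<close> times the gap of the
  preceding inequality at \<open>z = x / y\<close>. Its two conditions, that \<open>c\<close> and
  \<open>c - k\<close> are at least 1, say that \<open>y\<close> and \<open>x\<close> do not exceed
  \<open>exp l\<close>.\<close>

lemma mult_square_ln_tangent:
  fixes x y l :: real
  assumes x: "0 \<le> x" "x \<le> exp l" and y: "0 < y" "y \<le> exp l"
  defines "c \<equiv> 1 + l - ln y"
  shows "x * (1 + l - ln x)\<^sup>2 \<le> y * c\<^sup>2 + (c\<^sup>2 - 2 * c) * (x - y)"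
proof (cases "x = 0")
  case True
  have "ln y \<le> l" using y by (metis exp_gt_zero ln_exp ln_le_cancel_iff)
  then have "0 \<le> 2 * c * y" using y by (simp add: c_def)
  then show ?thesis using True by (simp add: algebra_simps)
next
  case False
  then have "0 < x" using x by simp
  define k where "k = ln (x / y)"
  have lx: "ln x = ln y + k" using \<open>0 < x\<close> y by (simp add: k_def ln_div)
  have "ln y \<le> l" "ln x \<le> l" using x y \<open>0 < x\<close> by (metis exp_gt_zero ln_exp ln_le_cancel_iff)+
  then have "x / y * k\<^sup>2 \<le> 2 * c * (x / y * k - x / y + 1)"
    using \<open>0 < x\<close> y lx unfolding k_def by (intro mult_ln_square_le_bregman) (auto simp: c_def)
  then have "y * (x / y * k\<^sup>2) \<le> y * (2 * c * (x / y * k - x / y + 1))"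
    using y by (intro mult_left_mono) auto
  moreover have "y * (x / y * k\<^sup>2) = x * k\<^sup>2"
    "y * (2 * c * (x / y * k - x / y + 1)) = 2 * c * (x * k - x + y)"
    using y by (simp_all add: field_simps)
  ultimately have "x * k\<^sup>2 \<le> 2 * c * (x * k - x + y)" by (simp only:)
  then have "x * (c - k)\<^sup>2 \<le> y * c\<^sup>2 + (c\<^sup>2 - 2 * c) * (x - y)"
    by (simp add: power2_eq_square algebra_simps)
  moreover have "1 + l - ln x = c - k" by (simp add: c_def lx)
  ultimately show ?thesis by simp
qed

text \<open>Jensen's inequality for the column-stochastic matrix \<open>T\<close>, stated through supporting lines
  \<open>y \<mapsto> F y + G y (x - y)\<close> so that no convexity on a closed interval is needed.\<close>

lemma stochastic_sum_mono:
  fixes T :: "'b \<Rightarrow> 'a \<Rightarrow> real" and F G :: "real \<Rightarrow> real"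
  assumes T: "\<And>i j. i \<in> X \<Longrightarrow> j \<in> Y \<Longrightarrow> 0 \<le> T j i"
    and T1: "\<And>i. i \<in> X \<Longrightarrow> (\<Sum>j\<in>Y. T j i) = 1"
    and p: "\<And>i. i \<in> X \<Longrightarrow> 0 \<le> p i" and q: "\<And>i. i \<in> X \<Longrightarrow> 0 < q i"
    and w: "\<And>j. j \<in> Y \<Longrightarrow> w j = (\<Sum>i\<in>X. T j i * p i)"
    and R: "\<And>j. j \<in> Y \<Longrightarrow> R j = (\<Sum>i\<in>X. T j i * q i)" and R0: "\<And>j. j \<in> Y \<Longrightarrow> 0 < R j"
    and tangent: "\<And>i j. i \<in> X \<Longrightarrow> j \<in> Y \<Longrightarrow> 0 < w j \<Longrightarrow>
      F (p i / q i) \<le> F (w j / R j) + G (w j / R j) * (p i / q i - w j / R j)"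
    and F0: "F 0 = 0" and fin: "finite X"
  shows "(\<Sum>i\<in>X. q i * F (p i / q i)) \<le> (\<Sum>j\<in>Y. R j * F (w j / R j))"
proof -
  have "(\<Sum>i\<in>X. q i * F (p i / q i)) = (\<Sum>i\<in>X. \<Sum>j\<in>Y. T j i * q i * F (p i / q i))"
    by (intro sum.cong refl) (simp add: T1 flip: sum_distrib_right)
  also have "\<dots> = (\<Sum>j\<in>Y. \<Sum>i\<in>X. T j i * q i * F (p i / q i))" by (rule sum.swap)
  also have "\<dots> \<le> (\<Sum>j\<in>Y. R j * F (w j / R j))"
  proof (rule sum_mono)
    fix j assume j: "j \<in> Y"
    have w0: "0 \<le> w j" unfolding w[OF j] using T p j by (intro sum_nonneg) auto
    show "(\<Sum>i\<in>X. T j i * q i * F (p i / q i)) \<le> R j * F (w j / R j)"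
    proof (cases "w j = 0")
      \<comment> \<open>No supporting line is available at 0. Yet \<open>w j = 0\<close> forces
        every \<open>T j i * p i\<close> to vanish, and \<open>F 0 = 0\<close> then removes every
        term.\<close>
      case True
      then have "\<forall>i\<in>X. T j i * p i = 0"
        using T p j fin unfolding w[OF j] by (subst (asm) sum_nonneg_eq_0_iff) auto
      then have "(\<Sum>i\<in>X. T j i * q i * F (p i / q i)) = 0" using F0 by (intro sum.neutral) auto
      then show ?thesis using True F0 by simp
    next
      case False
      define y where "y = w j / R j"
      have "(\<Sum>i\<in>X. T j i * q i * F (p i / q i))
          \<le> (\<Sum>i\<in>X. T j i * q i * (F y + G y * (p i / q i - y)))"
        using tangent[OF _ j] T[OF _ j] less_imp_le[OF q] w0 False
        by (intro sum_mono mult_left_mono) (auto simp: y_def)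
      also have "\<dots> = (\<Sum>i\<in>X. (F y - G y * y) * (T j i * q i) + G y * (T j i * p i))"
      proof (intro sum.cong refl)
        fix i assume "i \<in> X"
        then have "q i \<noteq> 0" using q by force
        then show "T j i * q i * (F y + G y * (p i / q i - y)) = (F y - G y * y) * (T j i * q i) + G y * (T j i * p i)"
          by (simp add: field_simps)
      qed
      also have "\<dots> = (F y - G y * y) * R j + G y * w j"
        unfolding sum.distrib sum_distrib_left[symmetric] w[OF j] R[OF j] by simp
      also have "\<dots> = R j * F y" using R0[OF j] by (simp add: y_def field_simps)
      finally show ?thesis by (simp add: y_def)
    qed
  qed
  finally show ?thesis .
qed

text \<open>Applied with \<open>v\<close> a variance and \<open>a = 1 + l - kl\<close>, so that \<open>a' - a\<close> is the loss of relative
  entropy and \<open>v + a\<^sup>2\<close> is the quantity \<open>M\<close>, up to the unit of the logarithm.\<close>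

lemma quadratic_transfer:
  fixes a a' v v' :: real
  assumes "0 < a" "a \<le> a'" "0 \<le> v" "0 \<le> v'" "v + a\<^sup>2 \<le> v' + a'\<^sup>2"
  shows "(v - v') / (2 * sqrt (v + a\<^sup>2)) \<le> a' - a"
proof -
  define r where "r = sqrt (v + a\<^sup>2)"
  have r: "0 < r" "r\<^sup>2 = v + a\<^sup>2" "a \<le> r"
    using assms by (auto simp: r_def add_nonneg_pos intro: real_le_rsqrt)
  have "v - v' \<le> 2 * r * (a' - a)"
  \<comment> \<open>If \<open>a'\<close> exceeds \<open>r\<close>, then \<open>a' + a\<close> need
    not be below \<open>2 * r\<close>, so the comparison of second moments does not suffice;
    \<open>v' >= 0\<close> and \<open>v = r^2 - a^2\<close> do. Otherwise \<open>v - v'\<close> is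
    at most a difference of squares whose sum factor is at most \<open>2 * r\<close>.\<close>
  proof (cases "r \<le> a'")
    case True
    have "v \<le> 2 * r * (r - a)"
      using r zero_le_power2[of "r - a"] by (simp add: power2_eq_square algebra_simps)
    also have "\<dots> \<le> 2 * r * (a' - a)" using r True by (intro mult_left_mono) auto
    finally show ?thesis using assms by simp
  next
    case False
    have "v - v' \<le> (a' + a) * (a' - a)" using assms by (simp add: power2_eq_square algebra_simps)
    also have "\<dots> \<le> 2 * r * (a' - a)" using r False assms by (intro mult_right_mono) auto
    finally show ?thesis .
  qed
  then show ?thesis using r(1) by (simp add: r_def[symmetric] divide_le_eq mult.commute)
qed

text \<open>Jensen is used twice: for \<open>- x * ln x\<close> it gives \<open>a <= a'\<close>, for
  \<open>x * (1 + l - ln x)^2\<close> it gives the growth of variance plus squared shift, and the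
  quadratic transfer combines them. The ratio bound is inherited by the output, so tangent points
  stay where concavity holds; \<open>kl <= l\<close> keeps \<open>a\<close> positive.\<close>

lemma stochastic_kl_decrease:
  fixes T :: "'b \<Rightarrow> 'a \<Rightarrow> real"
  assumes T: "\<And>i j. i \<in> X \<Longrightarrow> j \<in> Y \<Longrightarrow> 0 \<le> T j i"
    and T1: "\<And>i. i \<in> X \<Longrightarrow> (\<Sum>j\<in>Y. T j i) = 1"
    and p: "\<And>i. i \<in> X \<Longrightarrow> 0 \<le> p i" "(\<Sum>i\<in>X. p i) = 1" and q: "\<And>i. i \<in> X \<Longrightarrow> 0 < q i"
    and w: "\<And>j. j \<in> Y \<Longrightarrow> w j = (\<Sum>i\<in>X. T j i * p i)"
    and R: "\<And>j. j \<in> Y \<Longrightarrow> R j = (\<Sum>i\<in>X. T j i * q i)" and R0: "\<And>j. j \<in> Y \<Longrightarrow> 0 < R j"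
    and fin: "finite X" "finite Y"
    and l: "\<And>i. i \<in> X \<Longrightarrow> p i \<le> exp l * q i"
  shows "(klvar X p q - klvar Y w R) / (2 * sqrt (klvar X p q + (1 + l - kl X p q)\<^sup>2)) \<le> kl X p q - kl Y w R"
    and "\<And>j. j \<in> Y \<Longrightarrow> w j \<le> exp l * R j"
    and "\<And>j. j \<in> Y \<Longrightarrow> 0 \<le> w j" and "(\<Sum>j\<in>Y. w j) = 1"
    and "kl X p q \<le> l"
proof -
  show w0: "0 \<le> w j" if "j \<in> Y" for j unfolding w[OF that] using T p that by (intro sum_nonneg) auto
  have "(\<Sum>j\<in>Y. w j) = (\<Sum>i\<in>X. \<Sum>j\<in>Y. T j i * p i)" by (subst sum.swap) (simp add: w)
  also have "\<dots> = (\<Sum>i\<in>X. p i)" by (intro sum.cong) (auto simp: T1 simp flip: sum_distrib_right)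
  finally show w1: "(\<Sum>j\<in>Y. w j) = 1" using p by simp
  show wR: "w j \<le> exp l * R j" if "j \<in> Y" for j
  proof -
    have "w j \<le> (\<Sum>i\<in>X. T j i * (exp l * q i))"
      unfolding w[OF that] using T l that by (intro sum_mono mult_left_mono) auto
    also have "\<dots> = exp l * R j" by (simp add: R that sum_distrib_left algebra_simps)
    finally show ?thesis .
  qed
  show kl_l: "kl X p q \<le> l"
  proof -
    have "kl X p q \<le> (\<Sum>i\<in>X. p i * l)" unfolding kl_def
    proof (intro sum_mono)
      fix i assume i: "i \<in> X"
      show "p i * (ln (p i) - ln (q i)) \<le> p i * l"
      proof (cases "p i = 0")
        case False
        then have "0 < p i" using p i by force
        then have "ln (p i) \<le> ln (exp l * q i)" using l[OF i] q[OF i] by (subst ln_le_cancel_iff) auto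
        then have "ln (p i) - ln (q i) \<le> l" using q[OF i] by (simp add: ln_mult)
        then show ?thesis using \<open>0 < p i\<close> by (intro mult_left_mono) auto
      qed simp
    qed
    then show ?thesis using p by (simp flip: sum_distrib_right)
  qed
  \<comment> \<open>The logarithm of the quotient and the difference of logarithms disagree at
    \<open>p i = 0\<close>, but there both are multiplied by 0.\<close>
  have ratio: "q i * (p i / q i * g (ln (p i / q i))) = p i * g (ln (p i) - ln (q i))"
    if "0 \<le> p i" "0 < q i" for g and p q :: "'c \<Rightarrow> real" and i
    using that by (cases "p i = 0") (auto simp: ln_div)
  have ratio1: "(\<Sum>i\<in>X. q i * (p i / q i * g (ln (p i / q i)))) = (\<Sum>i\<in>X. p i * g (ln (p i) - ln (q i)))" for g
    using p q by (intro sum.cong ratio) auto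
  have ratio2: "(\<Sum>i\<in>Y. R i * (w i / R i * g (ln (w i / R i)))) = (\<Sum>i\<in>Y. w i * g (ln (w i) - ln (R i)))" for g
    using w0 R0 by (intro sum.cong ratio) auto
  have "(\<Sum>i\<in>X. q i * (p i / q i * (- ln (p i / q i)))) \<le> (\<Sum>j\<in>Y. R j * (w j / R j * (- ln (w j / R j))))"
  proof (rule stochastic_sum_mono[OF T T1 p(1) q w R R0, where F = "\<lambda>x. x * (- ln x)" and G = "\<lambda>y. - (ln y + 1)"])
    fix i j assume "i \<in> X" "j \<in> Y" "0 < w j"
    then have "0 \<le> p i / q i" "0 < w j / R j" using p q R0 by (auto simp: less_imp_le)
    from mult_ln_tangent[OF this]
    show "p i / q i * (- ln (p i / q i))
        \<le> w j / R j * (- ln (w j / R j)) + - (ln (w j / R j) + 1) * (p i / q i - w j / R j)"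
      by (simp only: minus_mult_left[symmetric] mult_minus_right)
  qed (use fin in auto)
  then have "(\<Sum>i\<in>X. p i * - (ln (p i) - ln (q i))) \<le> (\<Sum>j\<in>Y. w j * - (ln (w j) - ln (R j)))"
    unfolding ratio1[of uminus] ratio2[of uminus] .
  then have kl_mono: "kl Y w R \<le> kl X p q"
    unfolding kl_def mult_minus_right sum_negf neg_le_iff_le .
  have "(\<Sum>i\<in>X. q i * (p i / q i * (1 + l - ln (p i / q i))\<^sup>2)) \<le> (\<Sum>j\<in>Y. R j * (w j / R j * (1 + l - ln (w j / R j))\<^sup>2))"
  proof (rule stochastic_sum_mono[OF T T1 p(1) q w R R0, where F = "\<lambda>x. x * (1 + l - ln x)\<^sup>2"
        and G = "\<lambda>y. (1 + l - ln y)\<^sup>2 - 2 * (1 + l - ln y)"])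
    fix i j assume ij: "i \<in> X" "j \<in> Y" "0 < w j"
    then have "0 \<le> p i / q i" "p i / q i \<le> exp l" "0 < w j / R j" "w j / R j \<le> exp l"
      using p(1) q R0 l wR by (auto simp: less_imp_le divide_le_eq)
    from mult_square_ln_tangent[OF this]
    show "p i / q i * (1 + l - ln (p i / q i))\<^sup>2 \<le> w j / R j * (1 + l - ln (w j / R j))\<^sup>2
      + ((1 + l - ln (w j / R j))\<^sup>2 - 2 * (1 + l - ln (w j / R j))) * (p i / q i - w j / R j)" .
  qed (use fin in auto)
  then have "(\<Sum>i\<in>X. p i * (1 + l - (ln (p i) - ln (q i)))\<^sup>2) \<le> (\<Sum>j\<in>Y. w j * (1 + l - (ln (w j) - ln (R j)))\<^sup>2)"
    unfolding ratio1[of "\<lambda>x. (1 + l - x)\<^sup>2"] ratio2[of "\<lambda>x. (1 + l - x)\<^sup>2"] .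
  then have "(\<Sum>i\<in>X. p i * (ln (p i) - ln (q i) - (1 + l))\<^sup>2) \<le> (\<Sum>j\<in>Y. w j * (ln (w j) - ln (R j) - (1 + l))\<^sup>2)"
    by (simp only: power2_commute[of "1 + l"])
  then have "klvar X p q + (1 + l - kl X p q)\<^sup>2 \<le> klvar Y w R + (1 + l - kl Y w R)\<^sup>2"
    unfolding sum_square_shift[OF p(2)] sum_square_shift[OF w1] by (simp only: power2_commute[of "1 + l"])
  then show "(klvar X p q - klvar Y w R) / (2 * sqrt (klvar X p q + (1 + l - kl X p q)\<^sup>2)) \<le> kl X p q - kl Y w R"
    using quadratic_transfer[of "1 + l - kl X p q" "1 + l - kl Y w R" "klvar X p q" "klvar Y w R"]
      kl_mono kl_l klvar_nonneg[OF p(2,1)] klvar_nonneg[OF w1 w0] by simp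
qed

section \<open>Correlation error and the classical bound\<close>

text \<open>For \<open>t = root 4 x\<close> at least \<open>13/50\<close> the variance of \<open>w\<close> alone is already small enough;
  below this threshold \<open>sqrt x = t\<^sup>2\<close> compensates the larger constants of the Hellinger estimate.\<close>

lemma correlation_bound:
  assumes J: "finite J"
    and w: "(\<Sum>i\<in>J. w i) = 1" "\<And>i. i \<in> J \<Longrightarrow> 0 \<le> w i"
    and z: "(\<Sum>i\<in>J. z i) = 1" "\<And>i. i \<in> J \<Longrightarrow> 0 \<le> z i"
    and R: "(\<Sum>i\<in>J. R i) = 1" "\<And>i. i \<in> J \<Longrightarrow> 0 < R i"
    and wz: "\<And>i. i \<in> J \<Longrightarrow> z i = 0 \<Longrightarrow> w i = 0"
    and wR: "\<And>i. i \<in> J \<Longrightarrow> w i \<le> exp l * R i"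
    and m: "kl J z R \<le> l" and l: "0 \<le> l" and x: "kl J w z \<le> ln 2 * x"
  shows "klvar J w R - klvar J z R
    \<le> sqrt (2 * ln 2) * (12 * (ln 2)\<^sup>2 + l\<^sup>2) * max (root 4 x) (x\<^sup>2)"
proof -
  have kl0: "0 \<le> kl J w z" by (rule kl_nonneg[OF w z wz])
  have "0 \<le> ln 2 * x" using kl0 x by linarith
  then have x0: "0 \<le> x" by (simp add: zero_le_mult_iff)
  define t where "t = root 4 x"
  have t: "0 \<le> t" "t \<le> max (root 4 x) (x\<^sup>2)" using x0 by (auto simp: t_def)
  have "(2/3::real)\<^sup>2 \<le> (ln 2)\<^sup>2" using ln_2_ge by (intro power_mono) auto
  then have K: "16/3 + l\<^sup>2 \<le> 12 * (ln 2)\<^sup>2 + l\<^sup>2" by (simp add: power2_eq_square)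
  have D: "klvar J w R - klvar J z R \<le> sqrt (2 * ln 2) * (16/3 + l\<^sup>2) * t"
  \<comment> \<open>Comparing coefficients of \<open>l^2\<close>, the first estimate needs
    \<open>t >= 5/23\<close> and the second needs \<open>t\<close> below about 0.29; 13/50 lies in
    between and leaves room for the lower-order terms.\<close>
  proof (cases "13/50 \<le> t")
    case True
    have "klvar J w R - klvar J z R \<le> klvar J w R" using klvar_nonneg[OF z, of R] by linarith
    also have "\<dots> \<le> l\<^sup>2/4 + (3/8 * l + 9/16)" by (rule klvar_le[OF w R wR l])
    \<comment> \<open>The difference of the two sides is a positive multiple of the square below
      plus a positive constant.\<close>
    also have "\<dots> \<le> 23/20 * (16/3 + l\<^sup>2) * (13/50)"
      using zero_le_power2[of "49 * l - 375/2"] by (simp add: power2_eq_square algebra_simps)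
    also have "\<dots> \<le> sqrt (2 * ln 2) * (16/3 + l\<^sup>2) * t"
    proof (intro mult_mono)
      show "23/20 \<le> sqrt (2 * ln 2)"
        using ln_2_ge by (intro real_le_rsqrt) (simp add: power2_eq_square)
    qed (use True in auto)
    finally show ?thesis .
  next
    case False
    have "x = t ^ 4" using x0 by (simp add: t_def)
    then have "ln 2 * x = ln 2 * (t\<^sup>2)\<^sup>2" by simp
    then have "sqrt (kl J w z) \<le> sqrt (ln 2 * (t\<^sup>2)\<^sup>2)" using x by simp
    moreover have "sqrt ((t\<^sup>2)\<^sup>2) = t\<^sup>2" by (rule real_sqrt_unique) auto
    ultimately have s: "sqrt (kl J w z) \<le> sqrt (ln 2) * t\<^sup>2" by (simp only: real_sqrt_mult)
    have l2: "29/6 * l\<^sup>2 + 17/3 * l + 22/3 \<ge> 0" using l by simp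
    have "klvar J w R - klvar J z R \<le> sqrt (kl J w z) * (29/6 * l\<^sup>2 + 17/3 * l + 22/3)"
      by (rule klvar_diff_le_sqrt[OF J w z R wz wR m])
    also have "\<dots> \<le> sqrt (ln 2) * t\<^sup>2 * (29/6 * l\<^sup>2 + 17/3 * l + 22/3)"
      using s l2 by (rule mult_right_mono)
    also have "\<dots> = sqrt (ln 2) * t * (t * (29/6 * l\<^sup>2 + 17/3 * l + 22/3))"
      by (simp only: power2_eq_square mult.assoc)
    also have "\<dots> \<le> sqrt (ln 2) * t * (sqrt 2 * (16/3 + l\<^sup>2))"
    proof (rule mult_left_mono)
      have "t * (29/6 * l\<^sup>2 + 17/3 * l + 22/3) \<le> 13/50 * (29/6 * l\<^sup>2 + 17/3 * l + 22/3)"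
        using False l2 by (intro mult_right_mono) auto
      \<comment> \<open>Again a completed square with a positive remainder; 707/500 is a rational
        lower bound for \<open>sqrt 2\<close>.\<close>
      also have "\<dots> \<le> 707/500 * (16/3 + l\<^sup>2)"
        using zero_le_power2[of "236 * l - 1105"] by (simp add: power2_eq_square algebra_simps)
      also have "\<dots> \<le> sqrt 2 * (16/3 + l\<^sup>2)"
        by (intro mult_right_mono real_le_rsqrt) (auto simp: power2_eq_square)
      finally show "t * (29/6 * l\<^sup>2 + 17/3 * l + 22/3) \<le> sqrt 2 * (16/3 + l\<^sup>2)" .
      show "0 \<le> sqrt (ln 2) * t" using t by simp
    qed
    also have "\<dots> = sqrt (2 * ln 2) * (16/3 + l\<^sup>2) * t" by (simp add: real_sqrt_mult)
    finally show ?thesis .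
  qed
  also have "\<dots> \<le> sqrt (2 * ln 2) * (12 * (ln 2)\<^sup>2 + l\<^sup>2) * max (root 4 x) (x\<^sup>2)"
    using K t by (intro mult_mono) auto
  finally show ?thesis .
qed

text \<open>Inserting \<open>ln (u a * v b)\<close> splits the log ratio into two marginal ones and
  that of the mutual information. The latter being nonnegative, the joint loss of relative entropy
  is at most the sum of the marginal losses. The second claim is the support condition that comes
  with it.\<close>

lemma kl_marginal_decomposition:
  assumes fin: "finite A" "finite B"
    and w: "\<And>a b. a \<in> A \<Longrightarrow> b \<in> B \<Longrightarrow> 0 \<le> w (a, b)"
    and u: "\<And>a. a \<in> A \<Longrightarrow> u a = (\<Sum>b\<in>B. w (a, b))"
    and v: "\<And>b. b \<in> B \<Longrightarrow> v b = (\<Sum>a\<in>A. w (a, b))"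
    and r: "\<And>a. a \<in> A \<Longrightarrow> 0 < r a" and s: "\<And>b. b \<in> B \<Longrightarrow> 0 < s b"
  shows "kl (A \<times> B) w (\<lambda>(a, b). r a * s b)
    = kl A u r + kl B v s + kl (A \<times> B) w (\<lambda>(a, b). u a * v b)"
    and "\<And>a b. a \<in> A \<Longrightarrow> b \<in> B \<Longrightarrow> u a * v b = 0 \<Longrightarrow> w (a, b) = 0"
proof -
  have le: "w (a, b) \<le> u a" "w (a, b) \<le> v b" if "a \<in> A" "b \<in> B" for a b
    using that fin w member_le_sum[of b B "\<lambda>b. w (a, b)"] member_le_sum[of a A "\<lambda>a. w (a, b)"]
    by (auto simp: u v)
  show zero: "w (a, b) = 0" if "a \<in> A" "b \<in> B" "u a * v b = 0" for a b
    using le[OF that(1,2)] w[OF that(1,2)] that(3) by auto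
  have "kl (A \<times> B) w (\<lambda>(a, b). r a * s b) =
     (\<Sum>(a, b)\<in>A \<times> B. w (a, b) * (ln (u a) - ln (r a)) + w (a, b) * (ln (v b) - ln (s b))
        + w (a, b) * (ln (w (a, b)) - ln (u a * v b)))"
    unfolding kl_def
  proof (intro sum.cong refl, clarsimp)
    fix a b assume ab: "a \<in> A" "b \<in> B"
    show "w (a, b) * (ln (w (a, b)) - ln (r a * s b)) = w (a, b) * (ln (u a) - ln (r a))
        + w (a, b) * (ln (v b) - ln (s b)) + w (a, b) * (ln (w (a, b)) - ln (u a * v b))"
    proof (cases "w (a, b) = 0")
      case False
      then have "0 < u a" "0 < v b" "0 < r a" "0 < s b" using le[OF ab] w[OF ab] r s ab by force+
      then show ?thesis by (simp add: ln_mult algebra_simps)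
    qed simp
  qed
  also have "\<dots> = (\<Sum>a\<in>A. \<Sum>b\<in>B. w (a, b) * (ln (u a) - ln (r a)))
      + (\<Sum>b\<in>B. \<Sum>a\<in>A. w (a, b) * (ln (v b) - ln (s b))) + kl (A \<times> B) w (\<lambda>(a, b). u a * v b)"
    unfolding kl_def case_prod_unfold sum.distrib
    using sum.swap[of "\<lambda>b a. w (a, b) * (ln (v b) - ln (s b))" A B]
    by (simp add: sum.cartesian_product case_prod_unfold)
  also have "(\<Sum>a\<in>A. \<Sum>b\<in>B. w (a, b) * (ln (u a) - ln (r a))) = kl A u r"
    unfolding kl_def by (intro sum.cong) (auto simp: u sum_distrib_right)
  also have "(\<Sum>b\<in>B. \<Sum>a\<in>A. w (a, b) * (ln (v b) - ln (s b))) = kl B v s"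
    unfolding kl_def by (intro sum.cong) (auto simp: v sum_distrib_right)
  finally show "kl (A \<times> B) w (\<lambda>(a, b). r a * s b)
    = kl A u r + kl B v s + kl (A \<times> B) w (\<lambda>(a, b). u a * v b)" .
qed

text \<open>Under a product distribution the two log ratios are independent: the mixed term of the
  second moment is twice the product of the means and cancels against the square of the total
  mean.\<close>

lemma kl_product:
  assumes fin: "finite A" "finite B"
    and u: "\<And>a. a \<in> A \<Longrightarrow> 0 \<le> u a" "(\<Sum>a\<in>A. u a) = 1"
    and v: "\<And>b. b \<in> B \<Longrightarrow> 0 \<le> v b" "(\<Sum>b\<in>B. v b) = 1"
    and r: "\<And>a. a \<in> A \<Longrightarrow> 0 < r a" and s: "\<And>b. b \<in> B \<Longrightarrow> 0 < s b"
  shows "kl (A \<times> B) (\<lambda>(a, b). u a * v b) (\<lambda>(a, b). r a * s b) = kl A u r + kl B v s"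
    and "klvar (A \<times> B) (\<lambda>(a, b). u a * v b) (\<lambda>(a, b). r a * s b) = klvar A u r + klvar B v s"
proof -
  have "kl (A \<times> B) (\<lambda>(a, b). u a * v b) (\<lambda>(a, b). r a * s b)
    = kl A u r + kl B v s + kl (A \<times> B) (\<lambda>(a, b). u a * v b) (\<lambda>(a, b). u a * v b)"
    by (rule kl_marginal_decomposition(1)[OF fin _ _ _ r s])
      (simp_all add: u v flip: sum_distrib_left sum_distrib_right)
  then show kl: "kl (A \<times> B) (\<lambda>(a, b). u a * v b) (\<lambda>(a, b). r a * s b) = kl A u r + kl B v s"
    by (simp add: kl_def[of "A \<times> B" "\<lambda>(a, b). u a * v b" "\<lambda>(a, b). u a * v b"])
  define x where "x = (\<lambda>a. ln (u a) - ln (r a))"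
  define y where "y = (\<lambda>b. ln (v b) - ln (s b))"
  have "(\<Sum>i\<in>A \<times> B. (case i of (a, b) \<Rightarrow> u a * v b) *
      (ln (case i of (a, b) \<Rightarrow> u a * v b) - ln (case i of (a, b) \<Rightarrow> r a * s b))\<^sup>2)
    = (\<Sum>(a, b)\<in>A \<times> B. u a * (x a)\<^sup>2 * v b + u a * (v b * (y b)\<^sup>2) + 2 * ((u a * x a) * (v b * y b)))"
  proof (intro sum.cong refl, clarsimp)
    fix a b assume ab: "a \<in> A" "b \<in> B"
    show "u a * v b * (ln (u a * v b) - ln (r a * s b))\<^sup>2
        = u a * (x a)\<^sup>2 * v b + u a * (v b * (y b)\<^sup>2) + 2 * (u a * x a * (v b * y b))"
    proof (cases "u a * v b = 0")
      case False
      then have "0 < u a" "0 < v b" "0 < r a" "0 < s b" using u v r s ab by force+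
      then have "ln (u a * v b) - ln (r a * s b) = x a + y b" by (simp add: ln_mult x_def y_def)
      then show ?thesis by (simp add: power2_eq_square algebra_simps)
    qed auto
  qed
  also have "\<dots> = (\<Sum>a\<in>A. u a * (x a)\<^sup>2) * (\<Sum>b\<in>B. v b) + (\<Sum>a\<in>A. u a) * (\<Sum>b\<in>B. v b * (y b)\<^sup>2)
      + 2 * ((\<Sum>a\<in>A. u a * x a) * (\<Sum>b\<in>B. v b * y b))"
    unfolding sum_product sum.cartesian_product
    by (simp add: case_prod_unfold sum.distrib flip: sum_distrib_left)
  finally show "klvar (A \<times> B) (\<lambda>(a, b). u a * v b) (\<lambda>(a, b). r a * s b) = klvar A u r + klvar B v s"
    unfolding klvar_def kl u v by (simp add: kl_def x_def y_def power2_eq_square algebra_simps)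
qed

text \<open>The stochastic map controls the variance of the joint output \<open>w\<close>, while the
  claim is about its marginals, that is about their product \<open>z\<close>. The correlation error
  pays for the exchange in the numerator; on the right the mutual information can simply be dropped.
  The number \<open>x\<close> is measured in bits and may exceed the mutual information of
  \<open>w\<close>.\<close>

lemma classical_bound:
  fixes T :: "'b \<times> 'c \<Rightarrow> 'a \<Rightarrow> real"
  assumes fin: "finite X" "finite A" "finite B"
    and T: "\<And>i j. i \<in> X \<Longrightarrow> j \<in> A \<times> B \<Longrightarrow> 0 \<le> T j i"
    and T1: "\<And>i. i \<in> X \<Longrightarrow> (\<Sum>j\<in>A \<times> B. T j i) = 1"
    and p: "\<And>i. i \<in> X \<Longrightarrow> 0 \<le> p i" "(\<Sum>i\<in>X. p i) = 1"
    and q: "\<And>i. i \<in> X \<Longrightarrow> 0 < q i"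
    and w: "\<And>j. j \<in> A \<times> B \<Longrightarrow> w j = (\<Sum>i\<in>X. T j i * p i)"
    and R: "\<And>a b. a \<in> A \<Longrightarrow> b \<in> B \<Longrightarrow> r a * s b = (\<Sum>i\<in>X. T (a, b) i * q i)"
    and r: "\<And>a. a \<in> A \<Longrightarrow> 0 < r a" "(\<Sum>a\<in>A. r a) = 1"
    and s: "\<And>b. b \<in> B \<Longrightarrow> 0 < s b" "(\<Sum>b\<in>B. s b) = 1"
    and u: "\<And>a. a \<in> A \<Longrightarrow> u a = (\<Sum>b\<in>B. w (a, b))"
    and v: "\<And>b. b \<in> B \<Longrightarrow> v b = (\<Sum>a\<in>A. w (a, b))"
    and l: "\<And>i. i \<in> X \<Longrightarrow> p i \<le> exp l * q i" "0 \<le> l"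
    and x: "kl (A \<times> B) w (\<lambda>(a, b). u a * v b) \<le> ln 2 * x"
  shows "(klvar X p q - klvar A u r - klvar B v s
      - sqrt (2 * ln 2) * (12 * (ln 2)\<^sup>2 + l\<^sup>2) * max (root 4 x) (x\<^sup>2))
      / (2 * sqrt (klvar X p q + (1 + l - kl X p q)\<^sup>2)) \<le> kl X p q - kl A u r - kl B v s"
proof -
  define R' where "R' = (\<lambda>(a, b). r a * s b)"
  define z where "z = (\<lambda>(a, b). u a * v b)"
  have R': "R' j = (\<Sum>i\<in>X. T j i * q i)" if "j \<in> A \<times> B" for j
    using that R by (auto simp: R'_def)
  have R'0: "0 < R' j" if "j \<in> A \<times> B" for j
    using that r s by (auto simp: R'_def)
  have fAB: "finite (A \<times> B)" using fin by simp
  note S = stochastic_kl_decrease[OF T T1 p q w R' R'0 fin(1) fAB l(1)]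
  have dec: "(klvar X p q - klvar (A \<times> B) w R') / (2 * sqrt (klvar X p q + (1 + l - kl X p q)\<^sup>2))
      \<le> kl X p q - kl (A \<times> B) w R'"
    and wR: "\<And>j. j \<in> A \<times> B \<Longrightarrow> w j \<le> exp l * R' j"
    and w0: "\<And>j. j \<in> A \<times> B \<Longrightarrow> 0 \<le> w j" and w1: "(\<Sum>j\<in>A \<times> B. w j) = 1"
    using S(1-4) by blast+
  have u0: "0 \<le> u a" if "a \<in> A" for a unfolding u[OF that] using w0 that by (intro sum_nonneg) auto
  have v0: "0 \<le> v b" if "b \<in> B" for b unfolding v[OF that] using w0 that by (intro sum_nonneg) auto
  have u1: "(\<Sum>a\<in>A. u a) = 1"
    using w1 unfolding sum.cartesian_product[symmetric, of "\<lambda>a b. w (a, b)", simplified] by (simp add: u)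
  have v1: "(\<Sum>b\<in>B. v b) = 1"
    using u1 sum.swap[of "\<lambda>b a. w (a, b)" A B] by (simp add: u v)
  have z0: "\<And>j. j \<in> A \<times> B \<Longrightarrow> 0 \<le> z j" using u0 v0 by (auto simp: z_def)
  have z1: "(\<Sum>j\<in>A \<times> B. z j) = 1"
    unfolding z_def sum.cartesian_product[symmetric] by (simp add: u1 v1 flip: sum_distrib_left sum_distrib_right)
  have R1: "(\<Sum>j\<in>A \<times> B. R' j) = 1"
    unfolding R'_def sum.cartesian_product[symmetric] by (simp add: r s flip: sum_distrib_left sum_distrib_right)
  have wz: "w j = 0" if "j \<in> A \<times> B" "z j = 0" for j
    using kl_marginal_decomposition(2)[OF fin(2,3) _ u v r(1) s(1)] w0 that by (auto simp: z_def)
  have kl_w: "kl (A \<times> B) w R' = kl A u r + kl B v s + kl (A \<times> B) w z"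
    unfolding R'_def z_def using w0 by (intro kl_marginal_decomposition(1)[OF fin(2,3) _ u v r(1) s(1)]) auto
  have kl_z: "kl (A \<times> B) z R' = kl A u r + kl B v s"
    and var_z: "klvar (A \<times> B) z R' = klvar A u r + klvar B v s"
    unfolding R'_def z_def by (rule kl_product[OF fin(2,3) u0 u1 v0 v1 r(1) s(1)]; assumption)+
  have kl0: "0 \<le> kl (A \<times> B) w z" by (rule kl_nonneg[OF w1 w0 z1 z0 wz])
  have "kl (A \<times> B) w R' \<le> l"
  proof -
    \<comment> \<open>The map onto a single point is a stochastic map, so the bound of the relative
      entropy by \<open>l\<close> can be reused for \<open>w\<close>.\<close>
    define T' where "T' = (\<lambda>(j :: unit) (i :: 'b \<times> 'c). 1 :: real)"
    show ?thesis
      by (rule stochastic_kl_decrease(5)[where X = "A \<times> B" and Y = "{()}" and T = T' and p = w and q = R'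
            and w = "\<lambda>_. 1" and R = "\<lambda>_. 1"]) (use w0 w1 R'0 R1 wR fAB in \<open>auto simp: T'_def\<close>)
  qed
  then have kl_z_le: "kl (A \<times> B) z R' \<le> l" using kl_w kl_z kl0 by linarith
  define K where "K = sqrt (2 * ln 2) * (12 * (ln 2)\<^sup>2 + l\<^sup>2) * max (root 4 x) (x\<^sup>2)"
  have "klvar (A \<times> B) w R' - klvar (A \<times> B) z R' \<le> K"
    unfolding K_def
    by (rule correlation_bound[OF fAB w1 w0 z1 z0 R1 R'0 wz wR kl_z_le l(2)]) (use x in \<open>auto simp: z_def\<close>)
  then have "(klvar X p q - klvar A u r - klvar B v s - K) / (2 * sqrt (klvar X p q + (1 + l - kl X p q)\<^sup>2))
    \<le> (klvar X p q - klvar (A \<times> B) w R') / (2 * sqrt (klvar X p q + (1 + l - kl X p q)\<^sup>2))"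
    using var_z klvar_nonneg[OF p(2,1), of q] by (intro divide_right_mono) auto
  also note dec
  also have "kl X p q - kl (A \<times> B) w R' \<le> kl X p q - kl A u r - kl B v s"
    using kl_w kl0 by linarith
  finally show ?thesis unfolding K_def .
qed

section \<open>Unitary diagonalization\<close>

lemma index_mult_sum:
  assumes "A \<in> carrier_mat n m" "B \<in> carrier_mat m k" "i < n" "j < k"
  shows "(A * B) $$ (i, j) = (\<Sum>l<m. A $$ (i, l) * B $$ (l, j))"
  using assms by (auto simp: scalar_prod_def lessThan_atLeast0 intro!: sum.cong)

lemma adj_carrier [simp]: "A \<in> carrier_mat n m \<Longrightarrow> adj A \<in> carrier_mat m n"
  by (auto simp: adj_def)

lemma adj_index [simp]: "i < dim_col A \<Longrightarrow> j < dim_row A \<Longrightarrow> adj A $$ (i, j) = cnj (A $$ (j, i))"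
  by (auto simp: adj_def)

lemma dim_adj [simp]: "dim_row (adj A) = dim_col A" "dim_col (adj A) = dim_row A"
  by (auto simp: adj_def)

lemma mult_carrier_square [simp]:
  "A \<in> carrier_mat n n \<Longrightarrow> B \<in> carrier_mat n n \<Longrightarrow> A * B \<in> carrier_mat n n"
  by (rule mult_carrier_mat)

lemma adj_adj [simp]: "adj (adj A) = A"
  by (rule eq_matI) (auto simp: adj_def)

lemma adj_mult:
  assumes A: "A \<in> carrier_mat n m" and B: "B \<in> carrier_mat m k"
  shows "adj (A * B) = adj B * adj A"
proof (rule eq_matI)
  fix i j assume "i < dim_row (adj B * adj A)" "j < dim_col (adj B * adj A)"
  then have ij: "i < k" "j < n" using A B by (auto simp: adj_def)
  have "adj (A * B) $$ (i, j) = cnj (\<Sum>l<m. A $$ (j, l) * B $$ (l, i))"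
    using index_mult_sum[OF A B ij(2,1)] A B ij by simp
  also have "\<dots> = (\<Sum>l<m. adj B $$ (i, l) * adj A $$ (l, j))"
    using A B ij by (simp add: mult.commute)
  also have "\<dots> = (adj B * adj A) $$ (i, j)"
    using A B ij by (intro index_mult_sum[symmetric]) auto
  finally show "adj (A * B) $$ (i, j) = (adj B * adj A) $$ (i, j)" .
qed (use A B in \<open>auto simp: adj_def\<close>)

lemma unitary_carrier: "unitary n U \<Longrightarrow> U \<in> carrier_mat n n"
  by (simp add: unitary_def)

lemma unitary_right: 
  assumes "unitary n U"
  shows "U * adj U = 1\<^sub>m n"
  using assms mat_mult_left_right_inverse[of "adj U" n U] by (auto simp: unitary_def)

lemma unitary_adj: "unitary n U \<Longrightarrow> unitary n (adj U)"
  using unitary_right by (auto simp: unitary_def)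

lemma unitary_mult:
  assumes U: "unitary n U" and V: "unitary n V"
  shows "unitary n (U * V)"
proof -
  have c: "U \<in> carrier_mat n n" "V \<in> carrier_mat n n" using assms by (auto simp: unitary_def)
  have "adj U * (U * V) = V"
    using U c by (simp add: unitary_def flip: assoc_mult_mat[of _ n n _ n _ n])
  then have "adj (U * V) * (U * V) = adj V * V"
    using c by (simp add: adj_mult[of _ n n _ n] assoc_mult_mat[of _ n n _ n _ n])
  then show ?thesis using V c by (simp add: unitary_def)
qed

lemma unitaryI_entries:
  assumes "U \<in> carrier_mat n n"
    "\<And>i j. i < n \<Longrightarrow> j < n \<Longrightarrow> (\<Sum>k<n. cnj (U $$ (k, i)) * U $$ (k, j)) = (if i = j then 1 else 0)"
  shows "unitary n U"
proof -
  have "adj U * U = 1\<^sub>m n"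
  proof (rule eq_matI)
    fix i j assume ij: "i < dim_row (1\<^sub>m n :: complex mat)" "j < dim_col (1\<^sub>m n :: complex mat)"
    then have "(adj U * U) $$ (i, j) = (\<Sum>k<n. adj U $$ (i, k) * U $$ (k, j))"
      using assms(1) by (intro index_mult_sum) auto
    also have "\<dots> = (\<Sum>k<n. cnj (U $$ (k, i)) * U $$ (k, j))" using assms(1) ij by (intro sum.cong) auto
    finally show "(adj U * U) $$ (i, j) = 1\<^sub>m n $$ (i, j)" using assms(2)[of i j] ij by simp
  qed (use assms in \<open>auto simp: adj_def\<close>)
  then show ?thesis using assms by (simp add: unitary_def)
qed

lemma unitary_entries:
  assumes "unitary n U" "i < n" "j < n"
  shows "(\<Sum>k<n. cnj (U $$ (k, i)) * U $$ (k, j)) = (if i = j then 1 else 0)"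
    and "(\<Sum>k<n. U $$ (i, k) * cnj (U $$ (j, k))) = (if i = j then 1 else 0)"
proof -
  have U: "U \<in> carrier_mat n n" using assms by (simp add: unitary_def)
  have "(adj U * U) $$ (i, j) = (\<Sum>k<n. adj U $$ (i, k) * U $$ (k, j))"
    using assms U by (intro index_mult_sum) auto
  also have "\<dots> = (\<Sum>k<n. cnj (U $$ (k, i)) * U $$ (k, j))" using U assms by (intro sum.cong) auto
  finally show "(\<Sum>k<n. cnj (U $$ (k, i)) * U $$ (k, j)) = (if i = j then 1 else 0)"
    using assms by (simp add: unitary_def)
  have "(U * adj U) $$ (i, j) = (\<Sum>k<n. U $$ (i, k) * adj U $$ (k, j))"
    using assms U by (intro index_mult_sum) auto
  also have "\<dots> = (\<Sum>k<n. U $$ (i, k) * cnj (U $$ (j, k)))" using U assms by (intro sum.cong) auto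
  finally show "(\<Sum>k<n. U $$ (i, k) * cnj (U $$ (j, k))) = (if i = j then 1 else 0)"
    using assms unitary_right[OF assms(1)] by simp
qed

lemma diagonalized_entry:
  assumes U: "U \<in> carrier_mat n n" and ij: "i < n" "j < n"
  shows "(U * mat_diag n d * adj U) $$ (i, j) = (\<Sum>k<n. U $$ (i, k) * d k * cnj (U $$ (j, k)))"
proof -
  have "(U * mat_diag n d * adj U) $$ (i, j) = (\<Sum>k<n. (U * mat_diag n d) $$ (i, k) * adj U $$ (k, j))"
    using U ij by (intro index_mult_sum[of _ n]) auto
  also have "\<dots> = (\<Sum>k<n. U $$ (i, k) * d k * cnj (U $$ (j, k)))"
    using U ij by (intro sum.cong) (auto simp: mat_diag_mult_right)
  finally show ?thesis .
qed

lemma conj_mult_cancel: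
  assumes U: "unitary n U" and A: "A \<in> carrier_mat n n"
  shows "U * (adj U * A * U) * adj U = A"
proof -
  have c: "U \<in> carrier_mat n n" "adj U \<in> carrier_mat n n" using U by (auto simp: unitary_def)
  have *: "U * (adj U * X) = X" if "X \<in> carrier_mat n n" for X
    using c that by (simp add: unitary_right[OF U] flip: assoc_mult_mat[of _ n n _ n _ n])
  show ?thesis
    using c A by (simp add: assoc_mult_mat[of _ n n _ n _ n] * unitary_right[OF U])
qed

text \<open>Gram-Schmidt leaves its first vector unchanged, but its output is only orthogonal;
  normalizing the columns introduces the scalar \<open>c\<close>.\<close>

lemma unitary_first_column:
  assumes v: "v \<in> carrier_vec n" and v0: "v \<noteq> 0\<^sub>v n"
  obtains W c where "unitary n W" "\<And>i. i < n \<Longrightarrow> W $$ (i, 0) = c * v $ i"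
proof -
  have n: "n \<noteq> 0" using v v0 by (auto intro!: eq_vecI)
  interpret cof_vec_space n "TYPE(complex)" .
  define b where "b = basis_completion v"
  define ws where "ws = gram_schmidt n b"
  note bc = basis_completion[OF v v0, folded b_def]
  obtain vs where bv: "b = v # vs" using bc(6,7) n by (cases b) auto
  from gram_schmidt_result[OF bc(2,4,5) refl, folded ws_def]
  have ws: "set ws \<subseteq> carrier_vec n" "corthogonal ws" "length ws = n" using bc(6) by auto
  have hd: "ws ! 0 = v" using gram_schmidt_hd[OF v, of vs, folded bv ws_def] ws(3) n by (cases ws) auto
  have wsc: "ws ! i \<in> carrier_vec n" if "i < n" for i using ws that by force
  define s where "s = (\<lambda>i. sqrt (Re (ws ! i \<bullet>c ws ! i)))"
  have norm: "ws ! i \<bullet>c ws ! i = complex_of_real ((s i)\<^sup>2)" "s i \<noteq> 0" if "i < n" for i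
  proof -
    have ge: "0 \<le> ws ! i \<bullet>c ws ! i" by (rule conjugate_square_ge_0_vec)
    have ne: "ws ! i \<bullet>c ws ! i \<noteq> 0" using corthogonalD[OF ws(2), of i i] ws(3) that by auto
    show "ws ! i \<bullet>c ws ! i = complex_of_real ((s i)\<^sup>2)" "s i \<noteq> 0"
      using ge ne by (auto simp: s_def less_eq_complex_def complex_eq_iff)
  qed
  define W where "W = mat n n (\<lambda>(i, j). ws ! j $ i / complex_of_real (s j))"
  have W: "W \<in> carrier_mat n n" by (simp add: W_def)
  have "unitary n W"
  proof (rule unitaryI_entries[OF W])
    fix i j assume ij: "i < n" "j < n"
    have "(\<Sum>k<n. cnj (W $$ (k, i)) * W $$ (k, j))
        = (\<Sum>k<n. (ws ! j $ k * cnj (ws ! i $ k)) / complex_of_real (s i * s j))"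
      using ij by (intro sum.cong) (auto simp: W_def)
    also have "\<dots> = (ws ! j \<bullet>c ws ! i) / complex_of_real (s i * s j)"
      using wsc[OF ij(1)] by (simp add: scalar_prod_def lessThan_atLeast0 sum_divide_distrib)
    also have "\<dots> = (if i = j then 1 else 0)"
      using norm[OF ij(1)] corthogonalD[OF ws(2), of j i] ws(3) ij by (auto simp: power2_eq_square)
    finally show "(\<Sum>k<n. cnj (W $$ (k, i)) * W $$ (k, j)) = (if i = j then 1 else 0)" .
  qed
  moreover have "W $$ (i, 0) = (1 / complex_of_real (s 0)) * v $ i" if "i < n" for i
    using that n by (simp add: W_def hd)
  ultimately show thesis by (rule that)
qed

text \<open>Deflation by one eigenvector: in a basis starting with it, column 0 is zero below the
  corner. Normality then clears row 0 as well, and the remaining block is again normal.\<close>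

lemma normal_unitarily_diagonalizable:
  assumes "N \<in> carrier_mat n n" "N * adj N = adj N * N"
  shows "\<exists>U d. unitary n U \<and> N = U * mat_diag n d * adj U"
  using assms
proof (induction n arbitrary: N)
  case 0
  then show ?case by (intro exI[of _ "1\<^sub>m 0"] exI[of _ "\<lambda>_. 0"]) (auto simp: unitary_def adj_def)
next
  case (Suc m)
  let ?n = "Suc m"
  have N: "N \<in> carrier_mat ?n ?n" by fact
  obtain e where "eigenvalue N e" using spectrum_non_empty[OF N] by (auto simp: spectrum_def)
  then obtain v where v: "v \<in> carrier_vec ?n" "v \<noteq> 0\<^sub>v ?n" "N *\<^sub>v v = e \<cdot>\<^sub>v v"
    using N by (auto simp: eigenvalue_def eigenvector_def)
  obtain W c where W: "unitary ?n W" and W0: "\<And>i. i < ?n \<Longrightarrow> W $$ (i, 0) = c * v $ i"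
    using unitary_first_column[OF v(1,2)] by blast
  have Wc: "W \<in> carrier_mat ?n ?n" "adj W \<in> carrier_mat ?n ?n" "adj N \<in> carrier_mat ?n ?n"
    using W N by (auto simp: unitary_def)
  define M where "M = adj W * N * W"
  have M: "M \<in> carrier_mat ?n ?n" "adj M \<in> carrier_mat ?n ?n" using Wc N by (simp_all add: M_def)
  have adjM: "adj M = adj W * adj N * W"
    using Wc N by (simp add: M_def adj_mult[of _ ?n ?n _ ?n] assoc_mult_mat[of _ ?n ?n _ ?n _ ?n])
  have cancel: "W * (adj W * X) = X" if "X \<in> carrier_mat ?n ?n" for X
    using Wc that by (simp add: unitary_right[OF W] flip: assoc_mult_mat[of _ ?n ?n _ ?n _ ?n])
  have normal: "M * adj M = adj M * M"
  proof -
    have "M * adj M = adj W * (N * adj N) * W"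
      unfolding adjM unfolding M_def using Wc N cancel by (simp add: assoc_mult_mat[of _ ?n ?n _ ?n _ ?n])
    also have "\<dots> = adj M * M"
      unfolding adjM Suc.prems(2) unfolding M_def using Wc N cancel by (simp add: assoc_mult_mat[of _ ?n ?n _ ?n _ ?n])
    finally show ?thesis .
  qed
  have Nv: "(\<Sum>k<?n. N $$ (i, k) * v $ k) = e * v $ i" if "i < ?n" for i
  proof -
    have "(N *\<^sub>v v) $ i = (\<Sum>k<?n. N $$ (i, k) * v $ k)"
      using N v(1) that by (auto simp: scalar_prod_def lessThan_atLeast0 simp del: sum.op_ivl_Suc intro!: sum.cong)
    then show ?thesis using v that by simp
  qed
  have col0: "M $$ (i, 0) = (if i = 0 then e else 0)" if i: "i < ?n" for i
  proof -
    have NW: "(N * W) $$ (k, 0) = e * W $$ (k, 0)" if "k < ?n" for k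
    proof -
      have "(N * W) $$ (k, 0) = (\<Sum>l<?n. N $$ (k, l) * W $$ (l, 0))"
        using N Wc that by (intro index_mult_sum) auto
      also have "\<dots> = c * (\<Sum>l<?n. N $$ (k, l) * v $ l)"
        unfolding sum_distrib_left by (intro sum.cong) (auto simp: W0)
      finally show ?thesis using that by (simp only: Nv W0) simp
    qed
    have "M = adj W * (N * W)" using Wc N by (simp add: M_def assoc_mult_mat[of _ ?n ?n _ ?n _ ?n])
    then have "M $$ (i, 0) = (\<Sum>k<?n. adj W $$ (i, k) * (N * W) $$ (k, 0))"
      using Wc N i index_mult_sum[of "adj W" ?n ?n "N * W" ?n i 0] by simp
    also have "\<dots> = (\<Sum>k<?n. e * (cnj (W $$ (k, i)) * W $$ (k, 0)))"
      using Wc i by (intro sum.cong) (auto simp: NW)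
    also have "\<dots> = e * (\<Sum>k<?n. cnj (W $$ (k, i)) * W $$ (k, 0))" by (simp only: sum_distrib_left)
    finally show ?thesis using unitary_entries(1)[OF W i, of 0] by simp
  qed
  have MM: "(\<Sum>k<?n. M $$ (i, k) * cnj (M $$ (j, k))) = (\<Sum>k<?n. cnj (M $$ (k, i)) * M $$ (k, j))"
    if "i < ?n" "j < ?n" for i j
  proof -
    have "(M * adj M) $$ (i, j) = (\<Sum>k<?n. M $$ (i, k) * adj M $$ (k, j))"
      using M that by (intro index_mult_sum) auto
    moreover have "(adj M * M) $$ (i, j) = (\<Sum>k<?n. adj M $$ (i, k) * M $$ (k, j))"
      using M that by (intro index_mult_sum) auto
    ultimately show ?thesis using normal M that by simp
  qed
  \<comment> \<open>The corner entries of \<open>M * adj M\<close> and \<open>adj M * M\<close> are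
    the squared norms of row 0 and column 0; both contain the corner of \<open>M\<close>, and the
    column contains nothing else.\<close>
  have row0: "M $$ (0, Suc k) = 0" if k: "k < m" for k
  proof -
    have "complex_of_real (\<Sum>k<m. (cmod (M $$ (0, Suc k)))\<^sup>2) = 0"
      using MM[of 0 0] unfolding sum.lessThan_Suc_shift of_real_sum complex_norm_square
      by (simp add: col0)
    then have "(\<Sum>k<m. (cmod (M $$ (0, Suc k)))\<^sup>2) = 0" by (simp only: of_real_eq_0_iff)
    then show ?thesis using k by (simp add: sum_nonneg_eq_0_iff)
  qed
  define N3 where "N3 = mat m m (\<lambda>(i, j). M $$ (Suc i, Suc j))"
  have N3: "N3 \<in> carrier_mat m m" "adj N3 \<in> carrier_mat m m" by (auto simp: N3_def)
  have "N3 * adj N3 = adj N3 * N3"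
  proof (rule eq_matI)
    fix i j assume "i < dim_row (adj N3 * N3)" "j < dim_col (adj N3 * N3)"
    then have ij: "i < m" "j < m" using N3 by auto
    have "(N3 * adj N3) $$ (i, j) = (\<Sum>k<m. M $$ (Suc i, Suc k) * cnj (M $$ (Suc j, Suc k)))"
      using index_mult_sum[OF N3(1,2) ij] ij N3 by (simp add: N3_def)
    also have "\<dots> = (\<Sum>k<m. cnj (M $$ (Suc k, Suc i)) * M $$ (Suc k, Suc j))"
      using MM[of "Suc i" "Suc j"] ij unfolding sum.lessThan_Suc_shift by (simp add: col0 row0)
    also have "\<dots> = (adj N3 * N3) $$ (i, j)"
      using index_mult_sum[OF N3(2,1) ij] ij N3 by (simp add: N3_def)
    finally show "(N3 * adj N3) $$ (i, j) = (adj N3 * N3) $$ (i, j)" .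
  qed (use N3 in \<open>auto simp: adj_def\<close>)
  from Suc.IH[OF N3(1) this] obtain U3 d3 where
    U3: "unitary m U3" and d3: "N3 = U3 * mat_diag m d3 * adj U3" by blast
  define V where "V = mat ?n ?n (\<lambda>(i, j). case i of 0 \<Rightarrow> (case j of 0 \<Rightarrow> 1 | Suc j' \<Rightarrow> 0)
    | Suc i' \<Rightarrow> (case j of 0 \<Rightarrow> 0 | Suc j' \<Rightarrow> U3 $$ (i', j')))"
  define d where "d = case_nat e d3"
  have Vc: "V \<in> carrier_mat ?n ?n" by (simp add: V_def)
  have V: "V $$ (0, 0) = 1" "\<And>i. i < m \<Longrightarrow> V $$ (0, Suc i) = 0" "\<And>i. i < m \<Longrightarrow> V $$ (Suc i, 0) = 0"
    "\<And>i j. i < m \<Longrightarrow> j < m \<Longrightarrow> V $$ (Suc i, Suc j) = U3 $$ (i, j)" by (auto simp: V_def)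
  have uV: "unitary ?n V"
  proof (rule unitaryI_entries[OF Vc])
    fix i j assume "i < ?n" "j < ?n"
    then show "(\<Sum>k<?n. cnj (V $$ (k, i)) * V $$ (k, j)) = (if i = j then 1 else 0)"
      unfolding sum.lessThan_Suc_shift
      by (cases i; cases j) (auto simp: V unitary_entries(1)[OF U3])
  qed
  have "M = V * mat_diag ?n d * adj V"
  proof (rule eq_matI)
    fix i j assume "i < dim_row (V * mat_diag ?n d * adj V)" "j < dim_col (V * mat_diag ?n d * adj V)"
    then have ij: "i < ?n" "j < ?n" using Vc by (auto simp: adj_def)
    have N3e: "M $$ (Suc i, Suc j) = (\<Sum>k<m. U3 $$ (i, k) * d3 k * cnj (U3 $$ (j, k)))"
      if "i < m" "j < m" for i j
      using diagonalized_entry[OF unitary_carrier[OF U3] that, of d3] that unfolding d3[symmetric] by (simp add: N3_def)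
    show "M $$ (i, j) = (V * mat_diag ?n d * adj V) $$ (i, j)"
      unfolding diagonalized_entry[OF Vc ij] sum.lessThan_Suc_shift
      using ij by (cases i; cases j) (auto simp: V col0 row0 N3e d_def)
  qed (use M Vc in \<open>auto simp: adj_def\<close>)
  then have "N = W * (V * mat_diag ?n d * adj V) * adj W"
    using conj_mult_cancel[OF W N] by (simp add: M_def)
  also have "\<dots> = (W * V) * mat_diag ?n d * adj (W * V)"
    using Wc Vc by (simp add: adj_mult[of _ ?n ?n _ ?n] assoc_mult_mat[of _ ?n ?n _ ?n _ ?n])
  finally show ?case using unitary_mult[OF W uV] by blast
qed

section \<open>Matrices with a prescribed eigenbasis\<close>

text \<open>Keeping basis and real spectrum as separate arguments lets commuting matrices share
  \<open>U\<close>, so that sums, products and logarithms act on the spectra pointwise.\<close>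

definition eig_mat :: "nat \<Rightarrow> complex mat \<Rightarrow> (nat \<Rightarrow> real) \<Rightarrow> complex mat" where
  "eig_mat n U a = U * mat_diag n (\<lambda>i. complex_of_real (a i)) * adj U"

lemma eig_mat_carrier [simp]: "U \<in> carrier_mat n n \<Longrightarrow> eig_mat n U a \<in> carrier_mat n n"
  by (simp add: eig_mat_def)

lemma dim_eig_mat [simp]: "dim_row (eig_mat n U a) = dim_row U" "dim_col (eig_mat n U a) = dim_row U"
  by (auto simp: eig_mat_def)

lemma eig_mat_entry:
  assumes "U \<in> carrier_mat n n" "i < n" "j < n"
  shows "eig_mat n U a $$ (i, j) = (\<Sum>k<n. U $$ (i, k) * complex_of_real (a k) * cnj (U $$ (j, k)))"
  unfolding eig_mat_def by (rule diagonalized_entry[OF assms])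

lemma eig_mat_eqI:
  assumes "U \<in> carrier_mat n n" "A \<in> carrier_mat n n"
    "\<And>i j. i < n \<Longrightarrow> j < n \<Longrightarrow> A $$ (i, j) = (\<Sum>k<n. U $$ (i, k) * complex_of_real (a k) * cnj (U $$ (j, k)))"
  shows "A = eig_mat n U a"
  using assms by (intro eq_matI) (auto simp: eig_mat_entry)

lemma eig_mat_cong: "(\<And>k. k < n \<Longrightarrow> a k = b k) \<Longrightarrow> eig_mat n U a = eig_mat n U b"
  unfolding eig_mat_def mat_diag_def by (rule arg_cong[where f = "\<lambda>D. U * D * adj U"]) (auto intro!: eq_matI)

lemma adj_eig_mat: "U \<in> carrier_mat n n \<Longrightarrow> adj (eig_mat n U a) = eig_mat n U a"
  by (rule eig_mat_eqI) (simp_all add: eig_mat_entry mult_ac)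

lemma eig_mat_add: "U \<in> carrier_mat n n \<Longrightarrow> eig_mat n U a + eig_mat n U b = eig_mat n U (\<lambda>i. a i + b i)"
  by (rule eig_mat_eqI) (simp_all add: eig_mat_entry sum.distrib distrib_left distrib_right)

lemma eig_mat_diff: "U \<in> carrier_mat n n \<Longrightarrow> eig_mat n U a - eig_mat n U b = eig_mat n U (\<lambda>i. a i - b i)"
  by (rule eig_mat_eqI) (simp_all add: eig_mat_entry sum_subtractf left_diff_distrib right_diff_distrib minus_carrier_mat)

lemma eig_mat_smult: "U \<in> carrier_mat n n \<Longrightarrow> complex_of_real c \<cdot>\<^sub>m eig_mat n U a = eig_mat n U (\<lambda>i. c * a i)"
  by (rule eig_mat_eqI) (simp_all add: eig_mat_entry sum_distrib_left mult_ac)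

lemma conj_eig_mat:
  assumes U: "unitary n U"
  shows "adj U * eig_mat n U a * U = mat_diag n (\<lambda>i. complex_of_real (a i))" (is "_ = ?D")
proof -
  have c: "U \<in> carrier_mat n n" "adj U \<in> carrier_mat n n" using U by (auto simp: unitary_def)
  have "adj U * (U * X) = X" if "X \<in> carrier_mat n n" for X
    using U c that by (simp add: unitary_def flip: assoc_mult_mat[of _ n n _ n _ n])
  then show ?thesis
    using U c by (simp add: eig_mat_def unitary_def assoc_mult_mat[of _ n n _ n _ n] right_mult_one_mat[of _ n n])
qed

lemma eig_mat_mult:
  assumes U: "unitary n U"
  shows "eig_mat n U a * eig_mat n U b = eig_mat n U (\<lambda>i. a i * b i)"
proof -
  have c: "U \<in> carrier_mat n n" "adj U \<in> carrier_mat n n" using U by (auto simp: unitary_def)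
  have 1: "adj U * (U * X) = X" if "X \<in> carrier_mat n n" for X
    using U c that by (simp add: unitary_def flip: assoc_mult_mat[of _ n n _ n _ n])
  have "mat_diag n f * (mat_diag n g * X) = mat_diag n (\<lambda>i. f i * g i) * X"
    if "X \<in> carrier_mat n n" for f g :: "nat \<Rightarrow> complex" and X
    using that by (simp flip: assoc_mult_mat[of _ n n _ n _ n])
  then show ?thesis
    using c 1 by (simp add: eig_mat_def assoc_mult_mat[of _ n n _ n _ n])
qed

lemma conj_entry:
  assumes U: "U \<in> carrier_mat n n" and X: "X \<in> carrier_mat n n" and W: "W \<in> carrier_mat n n"
    and ij: "i < n" "j < n"
  shows "(adj U * X * W) $$ (i, j) = (\<Sum>p<n. \<Sum>q<n. cnj (U $$ (p, i)) * X $$ (p, q) * W $$ (q, j))"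
proof -
  have "(adj U * X * W) $$ (i, j) = (\<Sum>q<n. (adj U * X) $$ (i, q) * W $$ (q, j))"
    using assms by (intro index_mult_sum) auto
  also have "\<dots> = (\<Sum>q<n. \<Sum>p<n. cnj (U $$ (p, i)) * X $$ (p, q) * W $$ (q, j))"
  proof (intro sum.cong refl)
    fix q assume "q \<in> {..<n}"
    then have "(adj U * X) $$ (i, q) = (\<Sum>p<n. adj U $$ (i, p) * X $$ (p, q))"
      using assms by (intro index_mult_sum) auto
    then show "(adj U * X) $$ (i, q) * W $$ (q, j) = (\<Sum>p<n. cnj (U $$ (p, i)) * X $$ (p, q) * W $$ (q, j))"
      using assms by (simp add: sum_distrib_right)
  qed
  finally show ?thesis by (subst sum.swap)
qed

text \<open>In the eigenbasis commutation becomes a condition on single entries, which survives the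
  summation over entries in a partial trace.\<close>

lemma commute_eig_mat_iff:
  assumes U: "unitary n U" and X: "X \<in> carrier_mat n n"
  defines "Y \<equiv> adj U * X * U"
  shows "X * eig_mat n U a = eig_mat n U a * X \<longleftrightarrow>
    (\<forall>i<n. \<forall>j<n. Y $$ (i, j) * complex_of_real (a j) = complex_of_real (a i) * Y $$ (i, j))"
proof -
  let ?D = "mat_diag n (\<lambda>i. complex_of_real (a i))"
  have c: "U \<in> carrier_mat n n" "adj U \<in> carrier_mat n n" using U by (auto simp: unitary_def)
  have Y: "Y \<in> carrier_mat n n" using c X by (simp add: Y_def)
  have XY: "X = U * Y * adj U" unfolding Y_def by (rule conj_mult_cancel[OF U X, symmetric])
  have 1: "adj U * (U * Z) = Z" if "Z \<in> carrier_mat n n" for Z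
    using U c that by (simp add: unitary_def flip: assoc_mult_mat[of _ n n _ n _ n])
  have 2: "X * eig_mat n U a = U * (Y * ?D) * adj U" "eig_mat n U a * X = U * (?D * Y) * adj U"
    unfolding XY eig_mat_def using c Y 1 by (simp_all add: assoc_mult_mat[of _ n n _ n _ n])
  have 3: "adj U * (U * Z * adj U) * U = Z" if "Z \<in> carrier_mat n n" for Z
    using conj_mult_cancel[OF unitary_adj[OF U] that] by simp
  have "X * eig_mat n U a = eig_mat n U a * X \<longleftrightarrow> Y * ?D = ?D * Y"
  proof
    assume "X * eig_mat n U a = eig_mat n U a * X"
    then have "adj U * (U * (Y * ?D) * adj U) * U = adj U * (U * (?D * Y) * adj U) * U" unfolding 2 by simp
    then show "Y * ?D = ?D * Y" using Y by (simp add: 3)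
  qed (simp add: 2)
  also have "\<dots> \<longleftrightarrow> (\<forall>i<n. \<forall>j<n. Y $$ (i, j) * complex_of_real (a j) = complex_of_real (a i) * Y $$ (i, j))"
    unfolding mat_diag_mult_left[OF Y] mat_diag_mult_right[OF Y] by (auto simp: mat_eq_iff)
  finally show ?thesis .
qed

text \<open>\<open>A + \<i> B\<close> is normal because \<open>A\<close> and \<open>B\<close> commute, and its Hermitian and
  anti-Hermitian parts are diagonal in the same basis.\<close>

lemma commuting_hermitian_diagonalizable:
  assumes A: "A \<in> carrier_mat n n" "adj A = A" and B: "B \<in> carrier_mat n n" "adj B = B"
    and AB: "A * B = B * A"
  obtains U a b where "unitary n U" "A = eig_mat n U a" "B = eig_mat n U b"
proof -
  define N where "N = A + \<i> \<cdot>\<^sub>m B"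
  have N: "N \<in> carrier_mat n n" "adj N \<in> carrier_mat n n" using A B by (auto simp: N_def)
  have hA: "cnj (A $$ (j, i)) = A $$ (i, j)" if "i < n" "j < n" for i j
    using adj_index[of i A j] A that by simp
  have hB: "cnj (B $$ (j, i)) = B $$ (i, j)" if "i < n" "j < n" for i j
    using adj_index[of i B j] B that by simp
  have Ne: "N $$ (i, j) = A $$ (i, j) + \<i> * B $$ (i, j)" "adj N $$ (i, j) = A $$ (i, j) - \<i> * B $$ (i, j)"
    if "i < n" "j < n" for i j
    using A B that N by (auto simp: N_def hA hB)
  have comm: "(\<Sum>k<n. A $$ (i, k) * B $$ (k, j)) = (\<Sum>k<n. B $$ (i, k) * A $$ (k, j))" if "i < n" "j < n" for i j
    using index_mult_sum[OF A(1) B(1) that] index_mult_sum[OF B(1) A(1) that] AB by simp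
  have "N * adj N = adj N * N"
  proof (rule eq_matI)
    fix i j assume "i < dim_row (adj N * N)" "j < dim_col (adj N * N)"
    then have ij: "i < n" "j < n" using N by auto
    have "(N * adj N) $$ (i, j) - (adj N * N) $$ (i, j)
      = (\<Sum>k<n. N $$ (i, k) * adj N $$ (k, j) - adj N $$ (i, k) * N $$ (k, j))"
      unfolding index_mult_sum[OF N(1,2) ij] index_mult_sum[OF N(2,1) ij] sum_subtractf ..
    also have "\<dots> = (\<Sum>k<n. 2 * \<i> * (B $$ (i, k) * A $$ (k, j)) - 2 * \<i> * (A $$ (i, k) * B $$ (k, j)))"
      using ij by (intro sum.cong) (auto simp: Ne algebra_simps)
    also have "\<dots> = 0" by (simp only: sum_subtractf sum_distrib_left[symmetric] comm[OF ij] diff_self)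
    finally show "(N * adj N) $$ (i, j) = (adj N * N) $$ (i, j)" by simp
  qed (use N in auto)
  then obtain U d where U: "unitary n U" and d: "N = U * mat_diag n d * adj U"
    using normal_unitarily_diagonalizable[OF N(1)] by blast
  have Uc: "U \<in> carrier_mat n n" using U by (rule unitary_carrier)
  have Nd: "N $$ (i, j) = (\<Sum>k<n. U $$ (i, k) * d k * cnj (U $$ (j, k)))" if "i < n" "j < n" for i j
    unfolding d by (rule diagonalized_entry[OF Uc that])
  have aNd: "adj N $$ (i, j) = (\<Sum>k<n. U $$ (i, k) * cnj (d k) * cnj (U $$ (j, k)))" if "i < n" "j < n" for i j
    using Nd[OF that(2,1)] N that by (simp add: mult_ac)
  show thesis
  proof (rule that[OF U])
    show "A = eig_mat n U (\<lambda>k. Re (d k))"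
    proof (rule eig_mat_eqI[OF Uc A(1)])
      fix i j assume ij: "i < n" "j < n"
      have "A $$ (i, j) = (N $$ (i, j) + adj N $$ (i, j)) / 2" unfolding Ne[OF ij] by simp
      also have "\<dots> = (\<Sum>k<n. U $$ (i, k) * ((d k + cnj (d k)) / 2) * cnj (U $$ (j, k)))"
        unfolding Nd[OF ij] aNd[OF ij] sum.distrib[symmetric] sum_divide_distrib
        by (intro sum.cong) (auto simp: field_simps)
      finally show "A $$ (i, j) = (\<Sum>k<n. U $$ (i, k) * complex_of_real (Re (d k)) * cnj (U $$ (j, k)))"
        by (simp add: complex_add_cnj)
    qed
    show "B = eig_mat n U (\<lambda>k. Im (d k))"
    proof (rule eig_mat_eqI[OF Uc B(1)])
      fix i j assume ij: "i < n" "j < n"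
      have "B $$ (i, j) = (N $$ (i, j) - adj N $$ (i, j)) / (2 * \<i>)" unfolding Ne[OF ij] by simp
      also have "\<dots> = (\<Sum>k<n. U $$ (i, k) * ((d k - cnj (d k)) / (2 * \<i>)) * cnj (U $$ (j, k)))"
        unfolding Nd[OF ij] aNd[OF ij] sum_subtractf[symmetric] sum_divide_distrib
        by (intro sum.cong) (auto simp: field_simps)
      finally show "B $$ (i, j) = (\<Sum>k<n. U $$ (i, k) * complex_of_real (Im (d k)) * cnj (U $$ (j, k)))"
      proof -
        assume *: "B $$ (i, j) = (\<Sum>k<n. U $$ (i, k) * ((d k - cnj (d k)) / (2 * \<i>)) * cnj (U $$ (j, k)))"
        have "(z - cnj z) / (2 * \<i>) = complex_of_real (Im z)" for z
          by (simp add: complex_eq_iff Re_divide Im_divide)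
        with * show ?thesis by (simp only:)
      qed
    qed
  qed
qed

text \<open>The choice in \<open>mat_fun\<close> must not depend on the diagonalization. For two of
  them, \<open>W = adj V * U\<close> intertwines the spectra, so an entry of \<open>W\<close> is
  nonzero only where the eigenvalues agree; hence \<open>W\<close> also intertwines their images
  under \<open>f\<close>.\<close>

lemma mat_fun_eig_mat:
  assumes U: "unitary n U"
  shows "mat_fun n f (eig_mat n U a) = eig_mat n U (\<lambda>i. f (a i))"
proof -
  have c: "U \<in> carrier_mat n n" "adj U \<in> carrier_mat n n" using U by (auto simp: unitary_def)
  have uniq: "eig_mat n V (\<lambda>i. f (b i)) = eig_mat n U (\<lambda>i. f (a i))" if V: "unitary n V" and eq: "eig_mat n U a = eig_mat n V b" for V b
  proof -
    have cV: "V \<in> carrier_mat n n" "adj V \<in> carrier_mat n n" using V by (auto simp: unitary_def)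
    define W where "W = adj V * U"
    have W: "W \<in> carrier_mat n n" using c cV by (simp add: W_def)
    have VW: "V * W = U" unfolding W_def
      using c cV by (simp add: unitary_right[OF V] flip: assoc_mult_mat[of _ n n _ n _ n])
    have 1: "adj U * U = 1\<^sub>m n" "adj V * V = 1\<^sub>m n" using U V by (auto simp: unitary_def)
    have 2: "adj V * (V * Z) = Z" if "Z \<in> carrier_mat n n" for Z
      using 1 cV that by (simp flip: assoc_mult_mat[of _ n n _ n _ n])
    have comm: "adj V * eig_mat n V b * U = mat_diag n (\<lambda>i. complex_of_real (b i)) * W"
      unfolding eig_mat_def W_def using c cV 2
      by (simp add: assoc_mult_mat[of _ n n _ n _ n])
    moreover have "adj V * eig_mat n U a * U = W * mat_diag n (\<lambda>i. complex_of_real (a i))"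
      unfolding eig_mat_def W_def using c cV 1
      by (simp add: assoc_mult_mat[of _ n n _ n _ n] right_mult_one_mat[of _ n n])
    ultimately have "mat_diag n (\<lambda>i. complex_of_real (b i)) * W = W * mat_diag n (\<lambda>i. complex_of_real (a i))"
      by (simp add: eq)
    then have "complex_of_real (b i) * W $$ (i, j) = W $$ (i, j) * complex_of_real (a j)" if "i < n" "j < n" for i j
      using that unfolding mat_diag_mult_left[OF W] mat_diag_mult_right[OF W] by (auto simp: mat_eq_iff)
    then have "(complex_of_real (b i) - complex_of_real (a j)) * W $$ (i, j) = 0" if "i < n" "j < n" for i j
      using that by (simp add: left_diff_distrib mult.commute)
    then have W0: "W $$ (i, j) = 0 \<or> b i = a j" if "i < n" "j < n" for i j
      using that by force
    have "complex_of_real (f (b i)) * W $$ (i, j) = W $$ (i, j) * complex_of_real (f (a j))" if "i < n" "j < n" for i j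
      using W0[OF that] by auto
    then have fW: "mat_diag n (\<lambda>i. complex_of_real (f (b i))) * W = W * mat_diag n (\<lambda>i. complex_of_real (f (a i)))"
      unfolding mat_diag_mult_left[OF W] mat_diag_mult_right[OF W]
      by (intro eq_matI) auto
    have "adj V = W * adj U" unfolding W_def
      using c cV by (simp add: assoc_mult_mat[of _ n n _ n _ n] unitary_right[OF U])
    then have "eig_mat n V (\<lambda>i. f (b i)) = V * (mat_diag n (\<lambda>i. complex_of_real (f (b i))) * W) * adj U"
      unfolding eig_mat_def using c cV W
      by (simp add: assoc_mult_mat[of _ n n _ n _ n])
    also have "\<dots> = (V * W) * mat_diag n (\<lambda>i. complex_of_real (f (a i))) * adj U"
      unfolding fW using c cV W
      by (simp add: assoc_mult_mat[of _ n n _ n _ n])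
    finally show ?thesis by (simp add: VW eig_mat_def)
  qed
  show ?thesis
    unfolding mat_fun_def eig_mat_def[symmetric]
  proof (rule some_equality)
    show "\<exists>V b. unitary n V \<and> eig_mat n U a = eig_mat n V b \<and> eig_mat n U (\<lambda>i. f (a i)) = eig_mat n V (\<lambda>i. f (b i))"
      using U by blast
  next
    fix B assume "\<exists>V b. unitary n V \<and> eig_mat n U a = eig_mat n V b \<and> B = eig_mat n V (\<lambda>i. f (b i))"
    then show "B = eig_mat n U (\<lambda>i. f (a i))" using uniq by blast
  qed
qed

section \<open>Traces and diagonals relative to a unitary basis\<close>

lemma mtrace_mult_comm:
  assumes "A \<in> carrier_mat n n" "B \<in> carrier_mat n n"
  shows "mtrace (A * B) = mtrace (B * A)"
proof -
  have "mtrace (A * B) = (\<Sum>i<n. \<Sum>k<n. A $$ (i, k) * B $$ (k, i))"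
    using assms by (auto simp: mtrace_def index_mult_sum[OF assms] simp del: index_mult_mat(1) intro!: sum.cong)
  also have "\<dots> = (\<Sum>k<n. \<Sum>i<n. B $$ (k, i) * A $$ (i, k))" by (subst sum.swap) (simp add: mult.commute)
  also have "\<dots> = mtrace (B * A)"
    using assms by (auto simp: mtrace_def index_mult_sum[OF assms(2,1)] simp del: index_mult_mat(1) intro!: sum.cong)
  finally show ?thesis .
qed

text \<open>For a state this is the outcome distribution of a measurement in the basis
  \<open>U\<close>, equivalently the spectrum of the dephased state.\<close>

definition diag_in :: "complex mat \<Rightarrow> complex mat \<Rightarrow> nat \<Rightarrow> real" where
  "diag_in U X k = Re ((adj U * X * U) $$ (k, k))"

lemma diag_in_eig_mat: "unitary n U \<Longrightarrow> k < n \<Longrightarrow> diag_in U (eig_mat n U a) k = a k"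
  by (simp add: diag_in_def conj_eig_mat mat_diag_def)

lemma mtrace_mult_eig_mat:
  assumes U: "unitary n U" and X: "X \<in> carrier_mat n n"
  shows "Re (mtrace (X * eig_mat n U b)) = (\<Sum>k<n. diag_in U X k * b k)"
proof -
  have c: "U \<in> carrier_mat n n" "adj U \<in> carrier_mat n n" using U by (auto simp: unitary_def)
  let ?D = "mat_diag n (\<lambda>i. complex_of_real (b i))"
  have Y: "adj U * X * U \<in> carrier_mat n n" using c X by simp
  have "mtrace (X * eig_mat n U b) = mtrace ((X * U * ?D) * adj U)"
    unfolding eig_mat_def using c X by (simp add: assoc_mult_mat[of _ n n _ n _ n])
  also have "\<dots> = mtrace (adj U * (X * U * ?D))"
    using c X by (intro mtrace_mult_comm[of _ n]) simp_all
  also have "\<dots> = mtrace ((adj U * X * U) * ?D)"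
    using c X by (simp add: assoc_mult_mat[of _ n n _ n _ n])
  also have "\<dots> = (\<Sum>k<n. (adj U * X * U) $$ (k, k) * complex_of_real (b k))"
    unfolding mat_diag_mult_right[OF Y] by (simp add: mtrace_def)
  finally show ?thesis by (simp add: diag_in_def)
qed

lemma sum_diag_in:
  assumes U: "unitary n U" and X: "X \<in> carrier_mat n n"
  shows "(\<Sum>k<n. diag_in U X k) = Re (mtrace X)"
proof -
  have "eig_mat n U (\<lambda>_. 1) = 1\<^sub>m n" using unitary_right[OF U] unitary_carrier[OF U] by (simp add: eig_mat_def)
  then show ?thesis using mtrace_mult_eig_mat[OF U X, of "\<lambda>_. 1"] X by simp
qed

lemma diag_in_nonneg:
  assumes X: "psd n X" and U: "U \<in> carrier_mat n n" and k: "k < n"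
  shows "0 \<le> diag_in U X k"
proof -
  have Xc: "X \<in> carrier_mat n n" using X by (simp add: psd_def)
  have "(X *\<^sub>v col U k) \<bullet>c col U k = (\<Sum>p<n. (\<Sum>q<n. X $$ (p, q) * U $$ (q, k)) * cnj (U $$ (p, k)))"
    using U Xc k by (auto simp: scalar_prod_def lessThan_atLeast0 simp del: sum.op_ivl_Suc intro!: sum.cong)
  also have "\<dots> = (\<Sum>p<n. \<Sum>q<n. cnj (U $$ (p, k)) * X $$ (p, q) * U $$ (q, k))"
    unfolding sum_distrib_right by (simp add: mult_ac)
  also have "\<dots> = (adj U * X * U) $$ (k, k)" by (rule conj_entry[OF U Xc U k k, symmetric])
  finally have "(X *\<^sub>v col U k) \<bullet>c col U k = (adj U * X * U) $$ (k, k)" .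
  moreover have "0 \<le> Re ((X *\<^sub>v col U k) \<bullet>c col U k)" using X U k by (simp add: psd_def)
  ultimately show ?thesis by (simp only: diag_in_def)
qed

lemma psd_eig_mat:
  assumes U: "unitary n U" and a: "\<And>k. k < n \<Longrightarrow> 0 \<le> a k"
  shows "psd n (eig_mat n U a)"
proof -
  have Uc: "U \<in> carrier_mat n n" using U by (rule unitary_carrier)
  have "0 \<le> Re ((eig_mat n U a *\<^sub>v v) \<bullet>c v)" if v: "v \<in> carrier_vec n" for v
  proof -
    \<comment> \<open>These are the coordinates of \<open>v\<close> in the eigenbasis; the quadratic
      form becomes a weighted sum of their squared moduli.\<close>
    define y where "y = (\<lambda>k. \<Sum>i<n. cnj (U $$ (i, k)) * v $ i)"
    have "(eig_mat n U a *\<^sub>v v) \<bullet>c v = (\<Sum>i<n. (\<Sum>j<n. eig_mat n U a $$ (i, j) * v $ j) * cnj (v $ i))"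
      using v Uc by (auto simp: scalar_prod_def lessThan_atLeast0 simp del: sum.op_ivl_Suc intro!: sum.cong)
    also have "\<dots> = (\<Sum>i<n. \<Sum>j<n. \<Sum>k<n. complex_of_real (a k) * (U $$ (i, k) * cnj (v $ i)) * (cnj (U $$ (j, k)) * v $ j))"
      using Uc by (auto simp: eig_mat_entry sum_distrib_right sum_distrib_left mult_ac intro!: sum.cong)
    also have "\<dots> = (\<Sum>i<n. \<Sum>k<n. \<Sum>j<n. complex_of_real (a k) * (U $$ (i, k) * cnj (v $ i)) * (cnj (U $$ (j, k)) * v $ j))"
      by (intro sum.cong refl sum.swap)
    also have "\<dots> = (\<Sum>k<n. \<Sum>i<n. \<Sum>j<n. complex_of_real (a k) * (U $$ (i, k) * cnj (v $ i)) * (cnj (U $$ (j, k)) * v $ j))"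
      by (rule sum.swap)
    also have "\<dots> = (\<Sum>k<n. complex_of_real (a k) * (cnj (y k) * y k))"
      by (simp add: y_def sum_product sum_distrib_left mult_ac)
    also have "\<dots> = (\<Sum>k<n. complex_of_real (a k * (cmod (y k))\<^sup>2))"
      unfolding of_real_mult complex_norm_square by (simp add: mult.commute)
    also have "Re \<dots> = (\<Sum>k<n. a k * (cmod (y k))\<^sup>2)" by simp
    finally show ?thesis using a by (auto intro!: sum_nonneg)
  qed
  then show ?thesis using Uc by (simp add: psd_def adj_eig_mat)
qed

section \<open>Kronecker products and partial traces\<close>

lemma sum_lessThan_mult:
  fixes f :: "nat \<Rightarrow> 'a :: comm_monoid_add"
  shows "(\<Sum>i<m * n. f i) = (\<Sum>a<m. \<Sum>b<n. f (a * n + b))"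
proof -
  have "(\<Sum>i\<in>{a * n..<a * n + n}. f i) = (\<Sum>b<n. f (a * n + b))" for a
    using sum.shift_bounds_nat_ivl[of f 0 "a * n" n] by (simp add: lessThan_atLeast0 add.commute)
  then show ?thesis by (simp flip: sum.nat_group)
qed

lemma index_less_mult: "a < m \<Longrightarrow> b < n \<Longrightarrow> a * n + b < m * (n :: nat)"
proof -
  assume "a < m" "b < n"
  then have "a * n + b < Suc a * n" by simp
  also have "\<dots> \<le> m * n" using \<open>a < m\<close> by (intro mult_le_mono1) simp
  finally show ?thesis .
qed

lemma divmod_less_mult:
  assumes "i < m * (n :: nat)"
  shows "i div n < m" "i mod n < n"
  using assms by (cases "n = 0"; simp add: less_mult_imp_div_less)+

lemma kron_carrier [simp]:
  "A \<in> carrier_mat m m \<Longrightarrow> B \<in> carrier_mat n n \<Longrightarrow> kron A B \<in> carrier_mat (m * n) (m * n)"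
  by (auto simp: kron_def)

lemma kron_entry:
  assumes "A \<in> carrier_mat m m" "B \<in> carrier_mat n n" "a < m" "b < n" "c < m" "d < n"
  shows "kron A B $$ (a * n + b, c * n + d) = A $$ (a, c) * B $$ (b, d)"
  using assms index_less_mult[of a m b n] index_less_mult[of c m d n] by (auto simp: kron_def)

lemma mat_eq_blockI:
  assumes "A \<in> carrier_mat (m * n) (m * n)" "B \<in> carrier_mat (m * n) (m * n)"
    and eq: "\<And>a b c d. a < m \<Longrightarrow> b < n \<Longrightarrow> c < m \<Longrightarrow> d < n \<Longrightarrow>
      A $$ (a * n + b, c * n + d) = B $$ (a * n + b, c * n + d)"
  shows "A = B"
proof (rule eq_matI)
  fix i j assume "i < dim_row B" "j < dim_col B"
  then have "i < m * n" "j < m * n" using assms by auto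
  then show "A $$ (i, j) = B $$ (i, j)"
    using eq[of "i div n" "i mod n" "j div n" "j mod n"] divmod_less_mult[of i m n] divmod_less_mult[of j m n]
    by simp
qed (use assms in auto)

lemma unitary_kron:
  assumes U: "unitary m U" and V: "unitary n V"
  shows "unitary (m * n) (kron U V)"
proof -
  have c: "U \<in> carrier_mat m m" "V \<in> carrier_mat n n" using U V by (auto simp: unitary_def)
  have kc: "kron U V \<in> carrier_mat (m * n) (m * n)" using c by simp
  have "adj (kron U V) * kron U V = 1\<^sub>m (m * n)"
  proof (rule mat_eq_blockI)
    fix a b a' b' assume ab: "a < m" "b < n" "a' < m" "b' < n"
    note il = index_less_mult[OF ab(1,2)] index_less_mult[OF ab(3,4)]
    have "(adj (kron U V) * kron U V) $$ (a * n + b, a' * n + b')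
      = (\<Sum>k<m * n. adj (kron U V) $$ (a * n + b, k) * kron U V $$ (k, a' * n + b'))"
      using il kc by (intro index_mult_sum[of _ _ "m * n"]) auto
    also have "\<dots> = (\<Sum>k<m * n. cnj (kron U V $$ (k, a * n + b)) * kron U V $$ (k, a' * n + b'))"
      using il kc by (intro sum.cong) auto
    also have "\<dots> = (\<Sum>k<m. \<Sum>l<n. (cnj (U $$ (k, a)) * U $$ (k, a')) * (cnj (V $$ (l, b)) * V $$ (l, b')))"
      unfolding sum_lessThan_mult using ab by (intro sum.cong) (auto simp: kron_entry[OF c])
    also have "\<dots> = (\<Sum>k<m. cnj (U $$ (k, a)) * U $$ (k, a')) * (\<Sum>l<n. cnj (V $$ (l, b)) * V $$ (l, b'))"
      by (simp only: sum_product)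
    also have "\<dots> = (if a = a' then 1 else 0) * (if b = b' then 1 else 0)"
      using unitary_entries(1)[OF U ab(1,3)] unitary_entries(1)[OF V ab(2,4)] by simp
    also have "\<dots> = 1\<^sub>m (m * n) $$ (a * n + b, a' * n + b')"
    proof -
      have "a * n + b = a' * n + b' \<longleftrightarrow> a = a' \<and> b = b'"
      proof
        assume eq: "a * n + b = a' * n + b'"
        from arg_cong[OF this, of "\<lambda>i. i div n"] arg_cong[OF this, of "\<lambda>i. i mod n"]
        show "a = a' \<and> b = b'" using ab by simp
      qed simp
      then show ?thesis using il by auto
    qed
    finally show "(adj (kron U V) * kron U V) $$ (a * n + b, a' * n + b') = 1\<^sub>m (m * n) $$ (a * n + b, a' * n + b')" .
  qed (use kc in auto)
  then show ?thesis using kc by (simp add: unitary_def)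
qed

lemma kron_eig_mat:
  assumes U: "U \<in> carrier_mat m m" and V: "V \<in> carrier_mat n n"
  shows "kron (eig_mat m U p) (eig_mat n V q) = eig_mat (m * n) (kron U V) (\<lambda>i. p (i div n) * q (i mod n))"
proof (rule mat_eq_blockI)
  fix a b c d assume ab: "a < m" "b < n" "c < m" "d < n"
  note il = index_less_mult[OF ab(1,2)] index_less_mult[OF ab(3,4)]
  have kc: "kron U V \<in> carrier_mat (m * n) (m * n)" using U V by simp
  have "eig_mat (m * n) (kron U V) (\<lambda>i. p (i div n) * q (i mod n)) $$ (a * n + b, c * n + d)
    = (\<Sum>k<m. \<Sum>l<n. (U $$ (a, k) * complex_of_real (p k) * cnj (U $$ (c, k)))
        * (V $$ (b, l) * complex_of_real (q l) * cnj (V $$ (d, l))))"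
    unfolding eig_mat_entry[OF kc il] sum_lessThan_mult using ab
    by (intro sum.cong) (auto simp: kron_entry[OF U V])
  also have "\<dots> = eig_mat m U p $$ (a, c) * eig_mat n V q $$ (b, d)"
    unfolding eig_mat_entry[OF U ab(1,3)] eig_mat_entry[OF V ab(2,4)] by (simp only: sum_product)
  finally show "kron (eig_mat m U p) (eig_mat n V q) $$ (a * n + b, c * n + d)
    = eig_mat (m * n) (kron U V) (\<lambda>i. p (i div n) * q (i mod n)) $$ (a * n + b, c * n + d)"
    using kron_entry[OF eig_mat_carrier[OF U] eig_mat_carrier[OF V] ab] by simp
qed (use U V in auto)

lemma ptrace_carrier [simp]:
  "ptrace_E m n X \<in> carrier_mat m m" "ptrace_S m n X \<in> carrier_mat n n"
  by (auto simp: ptrace_E_def ptrace_S_def)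

lemma ptrace_kron:
  assumes "A \<in> carrier_mat m m" "B \<in> carrier_mat n n"
  shows "mtrace B = 1 \<Longrightarrow> ptrace_E m n (kron A B) = A" "mtrace A = 1 \<Longrightarrow> ptrace_S m n (kron A B) = B"
  using assms by (auto simp: ptrace_E_def ptrace_S_def kron_entry[OF assms] mtrace_def intro!: eq_matI
      simp flip: sum_distrib_left sum_distrib_right)

lemma adj_ptrace:
  assumes X: "X \<in> carrier_mat (m * n) (m * n)" "adj X = X"
  shows "adj (ptrace_E m n X) = ptrace_E m n X" "adj (ptrace_S m n X) = ptrace_S m n X"
proof -
  have h: "cnj (X $$ (j, i)) = X $$ (i, j)" if "i < m * n" "j < m * n" for i j
    using adj_index[of i X j] X that by simp
  show "adj (ptrace_E m n X) = ptrace_E m n X" "adj (ptrace_S m n X) = ptrace_S m n X"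
    by (auto simp: ptrace_E_def ptrace_S_def h index_less_mult intro!: eq_matI)
qed

lemma conj_kron_entry:
  assumes U: "U \<in> carrier_mat m m" and V: "V \<in> carrier_mat n n" and X: "X \<in> carrier_mat (m * n) (m * n)"
    and ab: "a < m" "b < n" "c < m" "d < n"
  shows "(adj (kron U V) * X * kron U V) $$ (a * n + b, c * n + d) =
    (\<Sum>k<m. \<Sum>k'<m. \<Sum>l<n. \<Sum>l'<n. cnj (U $$ (k, a)) * U $$ (k', c) * X $$ (k * n + l, k' * n + l')
      * (cnj (V $$ (l, b)) * V $$ (l', d)))"
proof -
  have kc: "kron U V \<in> carrier_mat (m * n) (m * n)" using U V by simp
  note il = index_less_mult[OF ab(1,2)] index_less_mult[OF ab(3,4)]
  have "(adj (kron U V) * X * kron U V) $$ (a * n + b, c * n + d) =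
    (\<Sum>k<m. \<Sum>l<n. \<Sum>k'<m. \<Sum>l'<n. cnj (U $$ (k, a)) * U $$ (k', c) * X $$ (k * n + l, k' * n + l')
      * (cnj (V $$ (l, b)) * V $$ (l', d)))"
    unfolding conj_entry[OF kc X kc il] sum_lessThan_mult using ab
    by (intro sum.cong) (auto simp: kron_entry[OF U V] mult_ac)
  also have "\<dots> = (\<Sum>k<m. \<Sum>k'<m. \<Sum>l<n. \<Sum>l'<n. cnj (U $$ (k, a)) * U $$ (k', c) * X $$ (k * n + l, k' * n + l')
      * (cnj (V $$ (l, b)) * V $$ (l', d)))"
    by (intro sum.cong refl sum.swap)
  finally show ?thesis .
qed

text \<open>A partial trace may be taken in any orthonormal basis of the traced factor: exchanging
  sums until the one over \<open>b\<close> is innermost exposes the completeness relation of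
  \<open>V\<close>.\<close>

lemma conj_ptrace_E:
  assumes U: "U \<in> carrier_mat m m" and V: "unitary n V" and X: "X \<in> carrier_mat (m * n) (m * n)"
    and a: "a < m" and c: "c < m"
  shows "(adj U * ptrace_E m n X * U) $$ (a, c) = (\<Sum>b<n. (adj (kron U V) * X * kron U V) $$ (a * n + b, c * n + b))"
proof -
  have Vc: "V \<in> carrier_mat n n" using V by (rule unitary_carrier)
  have "(\<Sum>b<n. (adj (kron U V) * X * kron U V) $$ (a * n + b, c * n + b))
    = (\<Sum>b<n. \<Sum>k<m. \<Sum>k'<m. \<Sum>l<n. \<Sum>l'<n. cnj (U $$ (k, a)) * U $$ (k', c) * X $$ (k * n + l, k' * n + l')
      * (cnj (V $$ (l, b)) * V $$ (l', b)))"
    using a c by (intro sum.cong refl) (simp add: conj_kron_entry[OF U Vc X])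
  also have "\<dots> = (\<Sum>k<m. \<Sum>b<n. \<Sum>k'<m. \<Sum>l<n. \<Sum>l'<n. cnj (U $$ (k, a)) * U $$ (k', c) * X $$ (k * n + l, k' * n + l')
      * (cnj (V $$ (l, b)) * V $$ (l', b)))"
    by (rule sum.swap)
  also have "\<dots> = (\<Sum>k<m. \<Sum>k'<m. \<Sum>b<n. \<Sum>l<n. \<Sum>l'<n. cnj (U $$ (k, a)) * U $$ (k', c) * X $$ (k * n + l, k' * n + l')
      * (cnj (V $$ (l, b)) * V $$ (l', b)))"
    by (rule sum.cong[OF refl], rule sum.swap)
  also have "\<dots> = (\<Sum>k<m. \<Sum>k'<m. \<Sum>l<n. \<Sum>b<n. \<Sum>l'<n. cnj (U $$ (k, a)) * U $$ (k', c) * X $$ (k * n + l, k' * n + l')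
      * (cnj (V $$ (l, b)) * V $$ (l', b)))"
    by (rule sum.cong[OF refl], rule sum.cong[OF refl], rule sum.swap)
  also have "\<dots> = (\<Sum>k<m. \<Sum>k'<m. \<Sum>l<n. \<Sum>l'<n. \<Sum>b<n. cnj (U $$ (k, a)) * U $$ (k', c) * X $$ (k * n + l, k' * n + l')
      * (cnj (V $$ (l, b)) * V $$ (l', b)))"
    by (rule sum.cong[OF refl], rule sum.cong[OF refl], rule sum.cong[OF refl], rule sum.swap)
  also have "\<dots> = (\<Sum>k<m. \<Sum>k'<m. \<Sum>l<n. \<Sum>l'<n. cnj (U $$ (k, a)) * U $$ (k', c) * X $$ (k * n + l, k' * n + l')
      * (if l' = l then 1 else 0))"
  proof (intro sum.cong refl)
    fix k k' l l' assume "l \<in> {..<n}" "l' \<in> {..<n}"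
    then show "(\<Sum>b<n. cnj (U $$ (k, a)) * U $$ (k', c) * X $$ (k * n + l, k' * n + l') * (cnj (V $$ (l, b)) * V $$ (l', b)))
      = cnj (U $$ (k, a)) * U $$ (k', c) * X $$ (k * n + l, k' * n + l') * (if l' = l then 1 else 0)"
      using unitary_entries(2)[OF V, of l' l] by (simp only: sum_distrib_left[symmetric] mult.commute[of "cnj _" "V $$ _"]) simp
  qed
  also have "\<dots> = (\<Sum>k<m. \<Sum>k'<m. cnj (U $$ (k, a)) * ptrace_E m n X $$ (k, k') * U $$ (k', c))"
  proof (intro sum.cong refl)
    fix k k' assume k: "k \<in> {..<m}" "k' \<in> {..<m}"
    have delta: "(\<Sum>l'<n. z l' * (if l' = l then 1 else 0)) = z l" if "l < n" for z :: "nat \<Rightarrow> complex" and l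
      using that by (simp add: if_distrib[of "\<lambda>x. _ * x"] cong: if_cong)
    have "(\<Sum>l<n. \<Sum>l'<n. cnj (U $$ (k, a)) * U $$ (k', c) * X $$ (k * n + l, k' * n + l') * (if l' = l then 1 else 0))
      = (\<Sum>l<n. cnj (U $$ (k, a)) * U $$ (k', c) * X $$ (k * n + l, k' * n + l))"
      by (intro sum.cong refl delta) simp
    also have "\<dots> = cnj (U $$ (k, a)) * ptrace_E m n X $$ (k, k') * U $$ (k', c)"
      using k by (simp add: ptrace_E_def sum_distrib_left sum_distrib_right mult_ac)
    finally show "(\<Sum>l<n. \<Sum>l'<n. cnj (U $$ (k, a)) * U $$ (k', c) * X $$ (k * n + l, k' * n + l') * (if l' = l then 1 else 0))
      = cnj (U $$ (k, a)) * ptrace_E m n X $$ (k, k') * U $$ (k', c)" .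
  qed
  also have "\<dots> = (adj U * ptrace_E m n X * U) $$ (a, c)"
    by (rule conj_entry[OF U _ U a c, symmetric]) simp
  finally show ?thesis by simp
qed

lemma conj_ptrace_S:
  assumes U: "unitary m U" and V: "V \<in> carrier_mat n n" and X: "X \<in> carrier_mat (m * n) (m * n)"
    and b: "b < n" and d: "d < n"
  shows "(adj V * ptrace_S m n X * V) $$ (b, d) = (\<Sum>a<m. (adj (kron U V) * X * kron U V) $$ (a * n + b, a * n + d))"
proof -
  have Uc: "U \<in> carrier_mat m m" using U by (rule unitary_carrier)
  define Z where "Z = (\<lambda>k k'. \<Sum>l<n. \<Sum>l'<n. X $$ (k * n + l, k' * n + l') * (cnj (V $$ (l, b)) * V $$ (l', d)))"
  have "(\<Sum>a<m. (adj (kron U V) * X * kron U V) $$ (a * n + b, a * n + d))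
    = (\<Sum>a<m. \<Sum>k<m. \<Sum>k'<m. (U $$ (k', a) * cnj (U $$ (k, a))) * Z k k')"
    using b d by (intro sum.cong refl) (simp add: conj_kron_entry[OF Uc V X] Z_def sum_distrib_left mult_ac)
  also have "\<dots> = (\<Sum>k<m. \<Sum>a<m. \<Sum>k'<m. (U $$ (k', a) * cnj (U $$ (k, a))) * Z k k')"
    by (rule sum.swap)
  also have "\<dots> = (\<Sum>k<m. \<Sum>k'<m. \<Sum>a<m. (U $$ (k', a) * cnj (U $$ (k, a))) * Z k k')"
    by (intro sum.cong refl sum.swap)
  also have "\<dots> = (\<Sum>k<m. \<Sum>k'<m. (if k' = k then 1 else 0) * Z k k')"
    by (intro sum.cong refl) (simp add: unitary_entries(2)[OF U] flip: sum_distrib_right)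
  also have "\<dots> = (\<Sum>k<m. Z k k)"
    by (simp add: if_distrib[of "\<lambda>x. x * _"] cong: if_cong)
  also have "\<dots> = (\<Sum>l<n. \<Sum>k<m. \<Sum>l'<n. X $$ (k * n + l, k * n + l') * (cnj (V $$ (l, b)) * V $$ (l', d)))"
    unfolding Z_def by (rule sum.swap)
  also have "\<dots> = (\<Sum>l<n. \<Sum>l'<n. \<Sum>k<m. X $$ (k * n + l, k * n + l') * (cnj (V $$ (l, b)) * V $$ (l', d)))"
    by (intro sum.cong refl sum.swap)
  also have "\<dots> = (\<Sum>l<n. \<Sum>l'<n. cnj (V $$ (l, b)) * ptrace_S m n X $$ (l, l') * V $$ (l', d))"
    by (intro sum.cong refl) (simp add: ptrace_S_def sum_distrib_left sum_distrib_right mult_ac)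
  also have "\<dots> = (adj V * ptrace_S m n X * V) $$ (b, d)"
    by (rule conj_entry[OF V _ V b d, symmetric]) simp
  finally show ?thesis by simp
qed

text \<open>Entries of \<open>X\<close> between eigenvectors of the product with equal \<open>E\<close>-index vanish unless the
  \<open>S\<close>-eigenvalues agree, because the common factor \<open>s b\<close> is nonzero.\<close>

lemma ptrace_commute:
  assumes U: "unitary m U" and V: "unitary n V" and X: "X \<in> carrier_mat (m * n) (m * n)"
    and comm: "X * kron (eig_mat m U r) (eig_mat n V s) = kron (eig_mat m U r) (eig_mat n V s) * X"
  shows "(\<And>b. b < n \<Longrightarrow> s b \<noteq> 0) \<Longrightarrow> ptrace_E m n X * eig_mat m U r = eig_mat m U r * ptrace_E m n X"
    and "(\<And>a. a < m \<Longrightarrow> r a \<noteq> 0) \<Longrightarrow> ptrace_S m n X * eig_mat n V s = eig_mat n V s * ptrace_S m n X"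
proof -
  have c: "U \<in> carrier_mat m m" "V \<in> carrier_mat n n" using U V by (auto simp: unitary_def)
  define Y where "Y = adj (kron U V) * X * kron U V"
  have Y: "Y $$ (a * n + b, a' * n + b') * complex_of_real (r a' * s b') = complex_of_real (r a * s b) * Y $$ (a * n + b, a' * n + b')"
    if "a < m" "b < n" "a' < m" "b' < n" for a b a' b'
    using comm[unfolded kron_eig_mat[OF c] commute_eig_mat_iff[OF unitary_kron[OF U V] X], rule_format,
        OF index_less_mult index_less_mult, OF that] that
    by (simp add: Y_def)
  show "ptrace_E m n X * eig_mat m U r = eig_mat m U r * ptrace_E m n X" if s: "\<And>b. b < n \<Longrightarrow> s b \<noteq> 0"
    unfolding commute_eig_mat_iff[OF U ptrace_carrier(1)]
  proof (intro allI impI)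
    fix a a' assume a: "a < m" "a' < m"
    have "Y $$ (a * n + b, a' * n + b) * complex_of_real (r a') = complex_of_real (r a) * Y $$ (a * n + b, a' * n + b)"
      if "b < n" for b using Y[OF a(1) that a(2) that] s[OF that] by simp
    then show "(adj U * ptrace_E m n X * U) $$ (a, a') * complex_of_real (r a') = complex_of_real (r a) * (adj U * ptrace_E m n X * U) $$ (a, a')"
      unfolding conj_ptrace_E[OF c(1) V X a] Y_def[symmetric] sum_distrib_left sum_distrib_right
      by (intro sum.cong) auto
  qed
  show "ptrace_S m n X * eig_mat n V s = eig_mat n V s * ptrace_S m n X" if r: "\<And>a. a < m \<Longrightarrow> r a \<noteq> 0"
    unfolding commute_eig_mat_iff[OF V ptrace_carrier(2)]
  proof (intro allI impI)
    fix b b' assume b: "b < n" "b' < n"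
    have "Y $$ (a * n + b, a * n + b') * complex_of_real (s b') = complex_of_real (s b) * Y $$ (a * n + b, a * n + b')"
      if "a < m" for a using Y[OF that b(1) that b(2)] r[OF that] by (simp add: mult_ac)
    then show "(adj V * ptrace_S m n X * V) $$ (b, b') * complex_of_real (s b') = complex_of_real (s b) * (adj V * ptrace_S m n X * V) $$ (b, b')"
      unfolding conj_ptrace_S[OF U c(2) X b] Y_def[symmetric] sum_distrib_left sum_distrib_right
      by (intro sum.cong) auto
  qed
qed

section \<open>Reduction to finite distributions\<close>

lemma density_eig_mat:
  assumes U: "unitary n U" and d: "density n (eig_mat n U p)"
  shows "\<And>k. k < n \<Longrightarrow> 0 \<le> p k" "(\<Sum>k<n. p k) = 1"
proof -
  have c: "U \<in> carrier_mat n n" using U by (rule unitary_carrier)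
  show "0 \<le> p k" if "k < n" for k
    using diag_in_nonneg[OF _ c that, of "eig_mat n U p"] d diag_in_eig_mat[OF U that] by (simp add: density_def)
  have "(\<Sum>k<n. p k) = (\<Sum>k<n. diag_in U (eig_mat n U p) k)"
    using diag_in_eig_mat[OF U] by simp
  then show "(\<Sum>k<n. p k) = 1" using sum_diag_in[OF U eig_mat_carrier[OF c]] d by (simp add: density_def)
qed

lemma eig_mat_mult_col:
  assumes U: "unitary n U" and k: "k < n"
  shows "eig_mat n U p *\<^sub>v col U k = complex_of_real (p k) \<cdot>\<^sub>v col U k"
proof -
  have c: "U \<in> carrier_mat n n" "adj U \<in> carrier_mat n n" using U by (auto simp: unitary_def)
  have "eig_mat n U p * U = U * (adj U * eig_mat n U p * U)"
    using c by (simp add: unitary_right[OF U] flip: assoc_mult_mat[of _ n n _ n _ n])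
  also have "\<dots> = U * mat_diag n (\<lambda>i. complex_of_real (p i))" by (simp only: conj_eig_mat[OF U])
  finally have eq: "eig_mat n U p * U = mat n n (\<lambda>(i, j). U $$ (i, j) * complex_of_real (p j))"
    unfolding mat_diag_mult_right[OF c(1)] .
  have "eig_mat n U p *\<^sub>v col U k = col (eig_mat n U p * U) k"
    using c k by (intro eq_vecI) auto
  also have "\<dots> = complex_of_real (p k) \<cdot>\<^sub>v col U k" unfolding eq using c k by (intro eq_vecI) auto
  finally show ?thesis .
qed

lemma unitary_col_nonzero:
  assumes U: "unitary n U" and k: "k < n"
  shows "col U k \<noteq> 0\<^sub>v n"
proof
  assume *: "col U k = 0\<^sub>v n"
  have "U $$ (l, k) = 0" if "l < n" for l
    using arg_cong[OF *, of "\<lambda>v. v $ l"] that k unitary_carrier[OF U] by simp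
  then show False using unitary_entries(1)[OF U k k] by simp
qed

lemma full_rank_eig_mat:
  assumes U: "unitary n U" and d: "full_rank_state n (eig_mat n U p)" and k: "k < n"
  shows "0 < p k"
proof -
  have c: "U \<in> carrier_mat n n" using U by (rule unitary_carrier)
  have "p k \<noteq> 0"
  proof
    assume "p k = 0"
    then have "eig_mat n U p *\<^sub>v col U k = 0\<^sub>v n"
      unfolding eig_mat_mult_col[OF U k] using c k by (intro eq_vecI) auto
    then have "det (eig_mat n U p) = 0"
      unfolding det_0_iff_vec_prod_zero[OF eig_mat_carrier[OF c]]
      using unitary_col_nonzero[OF U k] c k by (intro exI[of _ "col U k"]) auto
    then show False using d by (simp add: full_rank_state_def)
  qed
  then show ?thesis using density_eig_mat(1)[OF U _ k, of p] d by (force simp: full_rank_state_def)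
qed

lemma smallest_eigenvalue_eig_mat:
  assumes U: "unitary n U" and n: "0 < n"
  shows "smallest_eigenvalue (eig_mat n U q) = Min (q ` {..<n})"
proof -
  have c: "U \<in> carrier_mat n n" "adj U \<in> carrier_mat n n" using U by (auto simp: unitary_def)
  have "eigenvalue (eig_mat n U q) (complex_of_real x) \<longleftrightarrow> x \<in> q ` {..<n}" for x
  proof
    assume "eigenvalue (eig_mat n U q) (complex_of_real x)"
    then obtain v where v: "v \<in> carrier_vec n" "v \<noteq> 0\<^sub>v n" "eig_mat n U q *\<^sub>v v = complex_of_real x \<cdot>\<^sub>v v"
      using c by (auto simp: eigenvalue_def eigenvector_def)
    define y where "y = adj U *\<^sub>v v"
    have y: "y \<in> carrier_vec n" using c v by (simp add: y_def mult_mat_vec_carrier[of _ n n])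
    have vy: "v = U *\<^sub>v y"
      using c v by (simp add: y_def unitary_right[OF U] flip: assoc_mult_mat_vec[of _ n n _ n])
    then have "y \<noteq> 0\<^sub>v n" using v c by auto
    then obtain k where k: "k < n" "y $ k \<noteq> 0" using y by (metis carrier_vecD eq_vecI index_zero_vec(1,2))
    have "mat_diag n (\<lambda>i. complex_of_real (q i)) *\<^sub>v y = adj U *\<^sub>v (eig_mat n U q *\<^sub>v v)"
      unfolding vy conj_eig_mat[OF U, symmetric] using c y by (simp add: assoc_mult_mat_vec[of _ n n _ n])
    also have "\<dots> = complex_of_real x \<cdot>\<^sub>v y" unfolding v(3) y_def using c v by (simp add: mult_mat_vec[of _ n n])
    finally have "(mat_diag n (\<lambda>i. complex_of_real (q i)) *\<^sub>v y) $ k = complex_of_real x * y $ k" using y k by simp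
    moreover have "(mat_diag n (\<lambda>i. complex_of_real (q i)) *\<^sub>v y) $ k = complex_of_real (q k) * y $ k"
    proof -
      have "(mat_diag n (\<lambda>i. complex_of_real (q i)) *\<^sub>v y) $ k = (\<Sum>i<n. (if k = i then complex_of_real (q i) else 0) * y $ i)"
        using y k by (auto simp: mat_diag_def scalar_prod_def lessThan_atLeast0 simp del: sum.op_ivl_Suc intro!: sum.cong)
      then show ?thesis using k by (simp add: if_distrib[of "\<lambda>x. x * _"] cong: if_cong)
    qed
    ultimately show "x \<in> q ` {..<n}" using k by auto
  next
    assume "x \<in> q ` {..<n}"
    then obtain k where k: "k < n" "x = q k" by auto
    then show "eigenvalue (eig_mat n U q) (complex_of_real x)"
      using eig_mat_mult_col[OF U k(1)] unitary_col_nonzero[OF U k(1)] c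
      by (auto simp: eigenvalue_def eigenvector_def intro!: exI[of _ "col U k"])
  qed
  then have "{x. eigenvalue (eig_mat n U q) (complex_of_real x)} = q ` {..<n}" by blast
  then show ?thesis by (simp add: smallest_eigenvalue_def)
qed

text \<open>The convention for the eigenvalue 0 agrees with \<open>ln 0 = 0\<close>, so on
  nonnegative spectra the case distinction disappears.\<close>

lemma mlog_eig_mat:
  assumes "unitary n U" "\<And>k. k < n \<Longrightarrow> 0 \<le> p k"
  shows "mlog n (eig_mat n U p) = eig_mat n U (\<lambda>k. ln (p k) / ln 2)"
  unfolding mlog_def mat_fun_eig_mat[OF assms(1)]
proof (rule eig_mat_cong)
  fix k assume "k < n"
  from assms(2)[OF this] show "(if 0 < p k then log 2 (p k) else 0) = ln (p k) / ln 2"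
    by (cases "p k = 0") (simp_all add: log_def)
qed

lemma mtrace_eig_mat_mult_eig_mat:
  assumes "unitary n U"
  shows "Re (mtrace (eig_mat n U p * eig_mat n U a)) = (\<Sum>k<n. p k * a k)"
  by (simp add: mtrace_mult_eig_mat[OF assms] unitary_carrier[OF assms] diag_in_eig_mat[OF assms])

lemma rel_ent_eig_mat:
  assumes U: "unitary n U" and p: "\<And>k. k < n \<Longrightarrow> 0 \<le> p k" and q: "\<And>k. k < n \<Longrightarrow> 0 \<le> q k"
  shows "rel_ent n (eig_mat n U p) (eig_mat n U q) = kl {..<n} p q / ln 2"
    and "rel_var n (eig_mat n U p) (eig_mat n U q) = klvar {..<n} p q / (ln 2)\<^sup>2"
proof -
  have c: "U \<in> carrier_mat n n" using U by (rule unitary_carrier)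
  have ml: "mlog n (eig_mat n U p) = eig_mat n U (\<lambda>k. ln (p k) / ln 2)"
    "mlog n (eig_mat n U q) = eig_mat n U (\<lambda>k. ln (q k) / ln 2)"
    by (rule mlog_eig_mat[OF U p], assumption) (rule mlog_eig_mat[OF U q], assumption)
  show 1: "rel_ent n (eig_mat n U p) (eig_mat n U q) = kl {..<n} p q / ln 2"
    unfolding rel_ent_def ml eig_mat_diff[OF c] mtrace_eig_mat_mult_eig_mat[OF U] kl_def
    by (simp add: sum_divide_distrib flip: diff_divide_distrib)
  show "rel_var n (eig_mat n U p) (eig_mat n U q) = klvar {..<n} p q / (ln 2)\<^sup>2"
  proof -
    define d where "d = (\<lambda>k. ln (p k) / ln 2 - ln (q k) / ln 2)"
    have d: "p k * (d k * d k) = p k * (ln (p k) - ln (q k))\<^sup>2 / (ln 2)\<^sup>2" for k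
      by (simp add: d_def power2_eq_square flip: diff_divide_distrib)
    have "rel_var n (eig_mat n U p) (eig_mat n U q) = (\<Sum>k<n. p k * (d k * d k)) - (kl {..<n} p q / ln 2)\<^sup>2"
      unfolding rel_var_def 1 ml eig_mat_diff[OF c] d_def[symmetric] eig_mat_mult[OF U, of d d] mtrace_eig_mat_mult_eig_mat[OF U] ..
    then show ?thesis
      unfolding d klvar_def sum_divide_distrib[symmetric] power_divide diff_divide_distrib .
  qed
qed

text \<open>The diagonal of a state is the image of its spectrum under a unistochastic matrix, so Jensen's
  inequality for \<open>x ln x\<close> suffices. No support condition is needed because \<open>ln 0 = 0\<close>.\<close>

lemma kl_diag_in_le_rel_ent:
  assumes K: "unitary n K" and \<rho>: "density n \<rho>" and z: "\<And>k. k < n \<Longrightarrow> 0 \<le> z k"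
  shows "kl {..<n} (diag_in K \<rho>) z \<le> ln 2 * rel_ent n \<rho> (eig_mat n K z)"
proof -
  have \<rho>c: "\<rho> \<in> carrier_mat n n" "adj \<rho> = \<rho>" using \<rho> by (auto simp: density_def psd_def)
  obtain W lam where W: "unitary n W" and \<rho>W: "\<rho> = eig_mat n W lam"
    using commuting_hermitian_diagonalizable[OF \<rho>c \<rho>c refl] by metis
  have c: "K \<in> carrier_mat n n" "W \<in> carrier_mat n n" using K W by (auto simp: unitary_def)
  have lam: "\<And>k. k < n \<Longrightarrow> 0 \<le> lam k" using density_eig_mat(1)[OF W] \<rho> \<rho>W by blast
  define Z where "Z = adj K * W"
  have Z: "unitary n Z" unfolding Z_def by (intro unitary_mult unitary_adj K W)
  have Zc: "Z \<in> carrier_mat n n" using Z by (rule unitary_carrier)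
  define T where "T = (\<lambda>j k. (cmod (Z $$ (j, k)))\<^sup>2)"
  have "adj K * \<rho> * K = eig_mat n Z lam"
    unfolding \<rho>W eig_mat_def Z_def using c by (simp add: adj_mult[of _ n n _ n] assoc_mult_mat[of _ n n _ n _ n])
  then have w: "diag_in K \<rho> j = (\<Sum>k<n. T j k * lam k)" if "j < n" for j
  proof -
    have "Re (a * complex_of_real x * cnj a) = (cmod a)\<^sup>2 * x" for a x
      by (simp add: cmod_power2) (simp add: power2_eq_square algebra_simps)
    then show ?thesis
      unfolding diag_in_def \<open>adj K * \<rho> * K = eig_mat n Z lam\<close> eig_mat_entry[OF Zc that that] T_def by simp
  qed
  have T1: "(\<Sum>j<n. T j k) = 1" if "k < n" for k
  proof -
    have "complex_of_real (\<Sum>j<n. T j k) = (\<Sum>j<n. cnj (Z $$ (j, k)) * Z $$ (j, k))"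
      unfolding T_def of_real_sum complex_norm_square by (simp add: mult.commute)
    also have "\<dots> = 1" using unitary_entries(1)[OF Z that that] by simp
    finally show ?thesis by (simp only: of_real_eq_1_iff)
  qed
  have T2: "1 = (\<Sum>k<n. T j k * 1)" if "j < n" for j
  proof -
    have "complex_of_real (\<Sum>k<n. T j k) = (\<Sum>k<n. Z $$ (j, k) * cnj (Z $$ (j, k)))"
      unfolding T_def of_real_sum complex_norm_square ..
    also have "\<dots> = 1" using unitary_entries(2)[OF Z that that] by simp
    finally show ?thesis by (simp only: of_real_eq_1_iff mult_1_right)
  qed
  \<comment> \<open>Both reference weights are the constant 1: it need not be normalized, only
    preserved, and it is because the rows of \<open>T\<close> also sum to 1.\<close>
  have "(\<Sum>k<n. 1 * (lam k / 1 * (- ln (lam k / 1)))) \<le> (\<Sum>j<n. 1 * (diag_in K \<rho> j / 1 * (- ln (diag_in K \<rho> j / 1))))"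
  proof (rule stochastic_sum_mono[where T = T and F = "\<lambda>x. x * (- ln x)" and G = "\<lambda>y. - (ln y + 1)"])
    fix i j assume ij: "i \<in> {..<n}" "j \<in> {..<n}" "0 < diag_in K \<rho> j"
    from mult_ln_tangent[OF lam ij(3), of i] ij
    show "lam i / 1 * - ln (lam i / 1) \<le> diag_in K \<rho> j / 1 * - ln (diag_in K \<rho> j / 1)
        + - (ln (diag_in K \<rho> j / 1) + 1) * (lam i / 1 - diag_in K \<rho> j / 1)"
      by (simp add: algebra_simps)
  qed (use lam w T1 T2 in \<open>auto simp: T_def\<close>)
  then have neg_ent: "(\<Sum>j<n. diag_in K \<rho> j * ln (diag_in K \<rho> j)) \<le> (\<Sum>k<n. lam k * ln (lam k))"
    by (simp add: sum_negf)
  have "rel_ent n \<rho> (eig_mat n K z) = Re (mtrace (\<rho> * eig_mat n W (\<lambda>k. ln (lam k) / ln 2)))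
      - Re (mtrace (\<rho> * eig_mat n K (\<lambda>k. ln (z k) / ln 2)))"
  proof -
    have "mlog n \<rho> = eig_mat n W (\<lambda>k. ln (lam k) / ln 2)" unfolding \<rho>W by (rule mlog_eig_mat[OF W lam])
    moreover have "mlog n (eig_mat n K z) = eig_mat n K (\<lambda>k. ln (z k) / ln 2)" by (rule mlog_eig_mat[OF K z])
    moreover have "mtrace (A - B) = mtrace A - mtrace B" if "A \<in> carrier_mat n n" "B \<in> carrier_mat n n" for A B
      using that by (simp add: mtrace_def sum_subtractf)
    ultimately show ?thesis unfolding rel_ent_def using \<rho>c c
      by (simp add: mult_minus_distrib_mat[of _ n n _ n])
  qed
  also have "\<dots> = (\<Sum>k<n. lam k * (ln (lam k) / ln 2)) - (\<Sum>k<n. diag_in K \<rho> k * (ln (z k) / ln 2))"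
    unfolding mtrace_mult_eig_mat[OF K \<rho>c(1)] mtrace_mult_eig_mat[OF W \<rho>c(1)]
    using diag_in_eig_mat[OF W] by (simp add: \<rho>W)
  finally have "ln 2 * rel_ent n \<rho> (eig_mat n K z) = (\<Sum>k<n. lam k * ln (lam k)) - (\<Sum>k<n. diag_in K \<rho> k * ln (z k))"
    by (simp add: right_diff_distrib sum_distrib_left)
  then show ?thesis using neg_ent by (simp add: kl_def right_diff_distrib sum_subtractf)
qed

section \<open>Channels as stochastic matrices between spectra\<close>

lemma channel_psd:
  assumes "channel n \<Phi>" "psd n X"
  shows "psd n (\<Phi> X)"
proof -
  have X: "X \<in> carrier_mat n n" using assms by (simp add: psd_def)
  have \<Phi>X: "\<Phi> X \<in> carrier_mat n n" using assms X by (simp add: channel_def)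
  \<comment> \<open>Positivity is complete positivity with a one-dimensional ancilla.\<close>
  have "block n X 0 0 = X" using X by (intro eq_matI) (auto simp: block_def)
  then have "id_tensor 1 n \<Phi> X = \<Phi> X" using \<Phi>X by (intro eq_matI) (auto simp: id_tensor_def)
  moreover have "psd (1 * n) (id_tensor 1 n \<Phi> X)" using assms unfolding channel_def by (metis mult_1)
  ultimately show ?thesis by simp
qed

lemma channel_density:
  assumes "channel n \<Phi>" "density n X"
  shows "density n (\<Phi> X)"
proof -
  have "mtrace (\<Phi> X) = mtrace X" using assms by (simp add: channel_def density_def psd_def)
  moreover have "psd n (\<Phi> X)" by (rule channel_psd[OF assms(1)]) (use assms(2) in \<open>simp add: density_def\<close>)
  ultimately show ?thesis using assms by (simp add: density_def)
qed

lemma diag_in_add: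
  assumes "K \<in> carrier_mat n n" "X \<in> carrier_mat n n" "Y \<in> carrier_mat n n" "j < n"
  shows "diag_in K (X + Y) j = diag_in K X j + diag_in K Y j"
proof -
  have XY: "X + Y \<in> carrier_mat n n" using assms by simp
  have "(adj K * (X + Y) * K) $$ (j, j) = (adj K * X * K) $$ (j, j) + (adj K * Y * K) $$ (j, j)"
    unfolding conj_entry[OF assms(1) XY assms(1,4,4)] conj_entry[OF assms(1,2,1,4,4)] conj_entry[OF assms(1,3,1,4,4)]
      sum.distrib[symmetric]
    using assms by (intro sum.cong refl) (simp add: algebra_simps)
  then show ?thesis by (simp add: diag_in_def)
qed

lemma diag_in_smult:
  assumes "K \<in> carrier_mat n n" "X \<in> carrier_mat n n" "j < n"
  shows "diag_in K (complex_of_real c \<cdot>\<^sub>m X) j = c * diag_in K X j"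
proof -
  have cX: "complex_of_real c \<cdot>\<^sub>m X \<in> carrier_mat n n" using assms by simp
  have "(adj K * (complex_of_real c \<cdot>\<^sub>m X) * K) $$ (j, j) = complex_of_real c * (adj K * X * K) $$ (j, j)"
    unfolding conj_entry[OF assms(1) cX assms(1,3,3)] conj_entry[OF assms(1,2,1,3,3)] sum_distrib_left
    using assms by (intro sum.cong refl) simp
  then show ?thesis by (simp add: diag_in_def)
qed

text \<open>By linearity the coefficients are transition weights: prepare the \<open>i\<close>-th
  eigenvector of \<open>G\<close>, apply the channel, read off outcome \<open>j\<close> in
  \<open>K\<close>. The induction is over the spectrum truncated to its first \<open>m\<close>
  values.\<close>

lemma diag_in_channel_eig_mat:
  assumes \<Phi>: "channel n \<Phi>" and K: "K \<in> carrier_mat n n" and G: "G \<in> carrier_mat n n" and j: "j < n"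
  shows "diag_in K (\<Phi> (eig_mat n G p)) j = (\<Sum>i<n. diag_in K (\<Phi> (eig_mat n G (\<lambda>k. if k = i then 1 else 0))) j * p i)"
proof -
  have c: "\<Phi> X \<in> carrier_mat n n" if "X \<in> carrier_mat n n" for X using \<Phi> that by (simp add: channel_def)
  have smult: "diag_in K (\<Phi> (eig_mat n G (\<lambda>k. x * a k))) j = x * diag_in K (\<Phi> (eig_mat n G a)) j" for x a
  proof -
    have "\<Phi> (eig_mat n G (\<lambda>k. x * a k)) = complex_of_real x \<cdot>\<^sub>m \<Phi> (eig_mat n G a)"
      unfolding eig_mat_smult[OF G, symmetric] using \<Phi> G by (simp add: channel_def)
    then show ?thesis using diag_in_smult[OF K c[OF eig_mat_carrier[OF G]] j] by simp
  qed
  have add: "diag_in K (\<Phi> (eig_mat n G (\<lambda>k. a k + b k))) j = diag_in K (\<Phi> (eig_mat n G a)) j + diag_in K (\<Phi> (eig_mat n G b)) j" for a b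
  proof -
    have "\<Phi> (eig_mat n G (\<lambda>k. a k + b k)) = \<Phi> (eig_mat n G a) + \<Phi> (eig_mat n G b)"
      unfolding eig_mat_add[OF G, symmetric] using \<Phi> G by (simp add: channel_def)
    then show ?thesis using diag_in_add[OF K c[OF eig_mat_carrier[OF G]] c[OF eig_mat_carrier[OF G]] j] by simp
  qed
  have "diag_in K (\<Phi> (eig_mat n G (\<lambda>k. if k < m then p k else 0))) j
    = (\<Sum>i<m. diag_in K (\<Phi> (eig_mat n G (\<lambda>k. if k = i then 1 else 0))) j * p i)" for m
  proof (induction m)
    case 0
    show ?case using smult[of 0 "\<lambda>_. 0"] by simp
  next
    case (Suc m)
    have "(\<lambda>k. if k < Suc m then p k else 0) = (\<lambda>k. (if k < m then p k else 0) + p m * (if k = m then 1 else 0))"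
      by (auto simp: fun_eq_iff less_Suc_eq)
    then show ?case using Suc add[of "\<lambda>k. if k < m then p k else 0" "\<lambda>k. p m * (if k = m then 1 else 0)"]
        smult[of "p m" "\<lambda>k. if k = m then 1 else 0"] by simp
  qed
  from this[of n] show ?thesis by (simp cong: eig_mat_cong add: eig_mat_cong[of n "\<lambda>k. if k < n then p k else 0" p])
qed

text \<open>Separate eigenbases of the two factors first give the commutation of each marginal with
  its factor; only then are common eigenbases chosen. In their product basis the diagonal of
  \<open>X\<close> has the spectra of its partial traces as marginals.\<close>

lemma marginals_diagonalizable:
  assumes S: "full_rank_state m \<sigma>S" and E: "full_rank_state n \<sigma>E"
    and X: "X \<in> carrier_mat (m * n) (m * n)" "adj X = X"
    and comm: "X * kron \<sigma>S \<sigma>E = kron \<sigma>S \<sigma>E * X"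
  obtains U V u v r s where "unitary m U" "unitary n V"
    "ptrace_E m n X = eig_mat m U u" "\<sigma>S = eig_mat m U r" "\<And>a. a < m \<Longrightarrow> 0 < r a" "(\<Sum>a<m. r a) = 1"
    "ptrace_S m n X = eig_mat n V v" "\<sigma>E = eig_mat n V s" "\<And>b. b < n \<Longrightarrow> 0 < s b" "(\<Sum>b<n. s b) = 1"
    "\<And>a. a < m \<Longrightarrow> u a = (\<Sum>b<n. diag_in (kron U V) X (a * n + b))"
    "\<And>b. b < n \<Longrightarrow> v b = (\<Sum>a<m. diag_in (kron U V) X (a * n + b))"
proof -
  have Sc: "\<sigma>S \<in> carrier_mat m m" "adj \<sigma>S = \<sigma>S" and Ec: "\<sigma>E \<in> carrier_mat n n" "adj \<sigma>E = \<sigma>E"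
    using S E by (auto simp: full_rank_state_def density_def psd_def)
  obtain U0 r0 where U0: "unitary m U0" "\<sigma>S = eig_mat m U0 r0"
    using commuting_hermitian_diagonalizable[OF Sc Sc refl] by metis
  obtain V0 s0 where V0: "unitary n V0" "\<sigma>E = eig_mat n V0 s0"
    using commuting_hermitian_diagonalizable[OF Ec Ec refl] by metis
  have r0: "r0 a \<noteq> 0" if "a < m" for a using full_rank_eig_mat[OF U0(1) _ that, of r0] S U0(2) by force
  have s0: "s0 b \<noteq> 0" if "b < n" for b using full_rank_eig_mat[OF V0(1) _ that, of s0] E V0(2) by force
  note pc = ptrace_commute[OF U0(1) V0(1) X(1) comm[unfolded U0(2) V0(2)]]
  obtain U u r where U: "unitary m U" "ptrace_E m n X = eig_mat m U u" "\<sigma>S = eig_mat m U r"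
    using commuting_hermitian_diagonalizable[OF ptrace_carrier(1) adj_ptrace(1)[OF X] Sc pc(1)[OF s0, folded U0(2)]] by metis
  obtain V v s where V: "unitary n V" "ptrace_S m n X = eig_mat n V v" "\<sigma>E = eig_mat n V s"
    using commuting_hermitian_diagonalizable[OF ptrace_carrier(2) adj_ptrace(2)[OF X] Ec pc(2)[OF r0, folded V0(2)]] by metis
  have Uc: "U \<in> carrier_mat m m" and Vc: "V \<in> carrier_mat n n" using U V by (auto simp: unitary_def)
  show thesis
  proof (rule that[OF U(1) V(1) U(2,3) _ _ V(2,3)])
    show "0 < r a" if "a < m" for a using full_rank_eig_mat[OF U(1) _ that] S U(3) by blast
    show "0 < s b" if "b < n" for b using full_rank_eig_mat[OF V(1) _ that] E V(3) by blast
    show "(\<Sum>a<m. r a) = 1" using density_eig_mat(2)[OF U(1)] S U(3) by (simp add: full_rank_state_def)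
    show "(\<Sum>b<n. s b) = 1" using density_eig_mat(2)[OF V(1)] E V(3) by (simp add: full_rank_state_def)
    show "u a = (\<Sum>b<n. diag_in (kron U V) X (a * n + b))" if "a < m" for a
      using diag_in_eig_mat[OF U(1) that, of u] unfolding U(2)[symmetric] diag_in_def conj_ptrace_E[OF Uc V(1) X(1) that that] by simp
    show "v b = (\<Sum>a<m. diag_in (kron U V) X (a * n + b))" if "b < n" for b
      using diag_in_eig_mat[OF V(1) that, of v] unfolding V(2)[symmetric] diag_in_def conj_ptrace_S[OF U(1) Vc X(1) that that] by simp
  qed
qed

section \<open>Pair indices, product states and units\<close>

lemma kl_lessThan_mult:
  fixes m n :: nat
  shows "kl {..<m * n} p q = kl ({..<m} \<times> {..<n}) (\<lambda>(a, b). p (a * n + b)) (\<lambda>(a, b). q (a * n + b))"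
  "klvar {..<m * n} p q = klvar ({..<m} \<times> {..<n}) (\<lambda>(a, b). p (a * n + b)) (\<lambda>(a, b). q (a * n + b))"
proof -
  have "(\<Sum>i<m * n. f i) = (\<Sum>(a, b)\<in>{..<m} \<times> {..<n}. f (a * n + b))" for f :: "nat \<Rightarrow> real"
    by (simp only: sum_lessThan_mult sum.cartesian_product)
  then show "kl {..<m * n} p q = kl ({..<m} \<times> {..<n}) (\<lambda>(a, b). p (a * n + b)) (\<lambda>(a, b). q (a * n + b))"
    "klvar {..<m * n} p q = klvar ({..<m} \<times> {..<n}) (\<lambda>(a, b). p (a * n + b)) (\<lambda>(a, b). q (a * n + b))"
    by (simp_all only: klvar_def kl_def case_prod_unfold)
qed

lemma kl_cong:
  assumes "\<And>i. i \<in> J \<Longrightarrow> p i = p' i" "\<And>i. i \<in> J \<Longrightarrow> q i = q' i"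
  shows "kl J p q = kl J p' q'" "klvar J p q = klvar J p' q'"
  by (simp_all add: klvar_def kl_def assms cong: sum.cong)

lemma mtrace_kron:
  assumes "A \<in> carrier_mat m m" "B \<in> carrier_mat n n"
  shows "mtrace (kron A B) = mtrace A * mtrace B"
proof -
  have "mtrace (kron A B) = (\<Sum>i<m * n. kron A B $$ (i, i))" using assms by (simp add: mtrace_def kron_def)
  also have "\<dots> = (\<Sum>a<m. \<Sum>b<n. A $$ (a, a) * B $$ (b, b))"
    unfolding sum_lessThan_mult by (intro sum.cong refl) (simp add: kron_entry[OF assms])
  also have "\<dots> = mtrace A * mtrace B" using assms by (simp add: mtrace_def sum_product)
  finally show ?thesis .
qed

lemma density_kron:
  assumes A: "density m A" and B: "density n B"
  shows "density (m * n) (kron A B)"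
proof -
  have c: "A \<in> carrier_mat m m" "adj A = A" "B \<in> carrier_mat n n" "adj B = B"
    using A B by (auto simp: density_def psd_def)
  obtain U a where U: "unitary m U" "A = eig_mat m U a"
    using commuting_hermitian_diagonalizable[OF c(1,2) c(1,2) refl] by metis
  obtain V b where V: "unitary n V" "B = eig_mat n V b"
    using commuting_hermitian_diagonalizable[OF c(3,4) c(3,4) refl] by metis
  have a: "0 \<le> a k" if "k < m" for k using density_eig_mat(1)[OF U(1) _ that] A U(2) by blast
  have b: "0 \<le> b k" if "k < n" for k using density_eig_mat(1)[OF V(1) _ that] B V(2) by blast
  have "psd (m * n) (kron A B)"
    unfolding U(2) V(2) kron_eig_mat[OF unitary_carrier[OF U(1)] unitary_carrier[OF V(1)]]
    by (rule psd_eig_mat[OF unitary_kron[OF U(1) V(1)]]) (simp add: a b divmod_less_mult)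
  then show ?thesis using A B mtrace_kron[OF c(1,3)] by (simp add: density_def)
qed

text \<open>Variances and \<open>M\<close> scale with \<open>c^2\<close>, relative entropies with
  \<open>c\<close>, so both sides of the inequality scale alike. \<open>F\<close> is left alone,
  being a function of a mutual information already in bits; only its coefficient is
  rescaled.\<close>

lemma nats_to_bits:
  fixes c :: real
  assumes H: "(V - Kn * F) / (2 * sqrt M) \<le> D" and c: "0 < c" and M: "0 \<le> M" and F: "0 \<le> F"
    and K: "Kn \<le> K * c\<^sup>2"
  shows "(V / c\<^sup>2 - K * F) / (2 * sqrt (M / c\<^sup>2)) \<le> D / c"
proof -
  have sq: "sqrt (M / c\<^sup>2) = sqrt M / c" using c by (simp add: real_sqrt_divide)
  have "Kn * F \<le> (K * c\<^sup>2) * F" using K F by (rule mult_right_mono)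
  then have "V - K * c\<^sup>2 * F \<le> V - Kn * F" by simp
  moreover have "V / c\<^sup>2 - K * F = (V - K * c\<^sup>2 * F) / c\<^sup>2" using c by (simp add: field_simps)
  ultimately have "V / c\<^sup>2 - K * F \<le> (V - Kn * F) / c\<^sup>2" by (simp add: divide_right_mono)
  then have "(V / c\<^sup>2 - K * F) / (2 * (sqrt M / c)) \<le> ((V - Kn * F) / c\<^sup>2) / (2 * (sqrt M / c))"
    using c M by (intro divide_right_mono) auto
  also have "\<dots> = ((V - Kn * F) / (2 * sqrt M)) / c" using c by (simp add: power2_eq_square)
  also have "\<dots> \<le> D / c" using H c by (intro divide_right_mono) auto
  finally show ?thesis by (simp only: sq)
qed

section \<open>Spectral data of the quantum setting fed into the classical bound\<close>

theorem theorem14: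
  fixes dS dE :: nat
    and \<sigma>S \<sigma>E \<sigma>S' \<sigma>E' \<rho>S \<rho>E :: "complex mat"
    and \<E> :: "complex mat \<Rightarrow> complex mat"
  assumes "dS > 0" and "dE > 0"
    and "full_rank_state dS \<sigma>S" and "full_rank_state dE \<sigma>E"
    and "full_rank_state dS \<sigma>S'" and "full_rank_state dE \<sigma>E'"
    and "channel (dS * dE) \<E>"
    and "\<E> (kron \<sigma>S \<sigma>E) = kron \<sigma>S' \<sigma>E'"
    and "full_rank_state dE \<rho>E"
    and "density dS \<rho>S"
    and "kron \<rho>S \<rho>E * kron \<sigma>S \<sigma>E = kron \<sigma>S \<sigma>E * kron \<rho>S \<rho>E"
    and "\<E> (kron \<rho>S \<rho>E) * kron \<sigma>S' \<sigma>E' = kron \<sigma>S' \<sigma>E' * \<E> (kron \<rho>S \<rho>E)"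
  shows
    "let \<sigma> = kron \<sigma>S \<sigma>E;
         \<C> = (\<lambda>X. ptrace_E dS dE (\<E> (kron X \<rho>E)));
         \<rho>S' = \<C> \<rho>S;
         \<rho>E' = ptrace_S dS dE (\<E> (kron \<rho>S \<rho>E));
         \<Delta>SS = rel_ent dS \<rho>S \<sigma>S - rel_ent dS \<rho>S' \<sigma>S';
         \<Delta>SE = rel_ent dE \<rho>E \<sigma>E - rel_ent dE \<rho>E' \<sigma>E';
         \<Delta>VS = rel_var dS \<rho>S \<sigma>S - rel_var dS \<rho>S' \<sigma>S';
         \<Delta>VE = rel_var dE \<rho>E \<sigma>E - rel_var dE \<rho>E' \<sigma>E';
         I = rel_ent (dS * dE) (\<E> (kron \<rho>S \<rho>E)) (kron \<rho>S' \<rho>E');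
         smin = smallest_eigenvalue \<sigma>;
         K = sqrt (2 * ln 2) * (12 + (log 2 smin)\<^sup>2 + 8 * (log 2 (real (dS * dE)))\<^sup>2);
         f = (\<lambda>x::real. max (root 4 x) (x\<^sup>2))
     in \<Delta>SS + \<Delta>SE \<ge> (\<Delta>VS + \<Delta>VE - K * f I) / (2 * sqrt (M_x (dS * dE) smin (kron \<rho>S \<rho>E) \<sigma>))"
proof -
  note E = assms(7) and \<sigma>' = assms(8)
  define N where "N = dS * dE"
  define \<rho> where "\<rho> = kron \<rho>S \<rho>E"
  define \<sigma> where "\<sigma> = kron \<sigma>S \<sigma>E"
  define \<rho>' where "\<rho>' = \<E> \<rho>"
  have \<rho>E: "density dE \<rho>E" using assms(9) by (simp add: full_rank_state_def)
  have Sc: "\<rho>S \<in> carrier_mat dS dS" "\<rho>E \<in> carrier_mat dE dE" "mtrace \<rho>S = 1" "mtrace \<rho>E = 1"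
    using assms(10) \<rho>E by (auto simp: density_def psd_def)
  have \<rho>: "density N \<rho>" unfolding \<rho>_def N_def by (rule density_kron[OF assms(10) \<rho>E])
  have \<rho>c: "\<rho> \<in> carrier_mat (dS * dE) (dS * dE)" "adj \<rho> = \<rho>" using \<rho> by (auto simp: density_def psd_def N_def)
  have \<rho>': "density N \<rho>'" unfolding \<rho>'_def using E \<rho> by (simp add: N_def channel_density)
  have \<rho>'c: "\<rho>' \<in> carrier_mat (dS * dE) (dS * dE)" "adj \<rho>' = \<rho>'" using \<rho>' by (auto simp: density_def psd_def N_def)
  obtain US UE pS pE qS qE where in_diag:
    "unitary dS US" "unitary dE UE" "\<rho>S = eig_mat dS US pS" "\<sigma>S = eig_mat dS US qS"
    "\<And>a. a < dS \<Longrightarrow> 0 < qS a" "(\<Sum>a<dS. qS a) = 1"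
    "\<rho>E = eig_mat dE UE pE" "\<sigma>E = eig_mat dE UE qE" "\<And>b. b < dE \<Longrightarrow> 0 < qE b" "(\<Sum>b<dE. qE b) = 1"
  \<comment> \<open>The marginals of the product input are \<open>\<rho>S\<close> and
    \<open>\<rho>E\<close> themselves, so commutation of the products yields a common eigenbasis on
    each factor.\<close>
  proof (rule marginals_diagonalizable[OF assms(3,4) \<rho>c])
    show "\<rho> * kron \<sigma>S \<sigma>E = kron \<sigma>S \<sigma>E * \<rho>" using assms(11) by (simp add: \<rho>_def)
  next
    fix U V u v r s
    assume "unitary dS U" "unitary dE V" "ptrace_E dS dE \<rho> = eig_mat dS U u" "\<sigma>S = eig_mat dS U r"
      "\<And>a. a < dS \<Longrightarrow> 0 < r a" "(\<Sum>a<dS. r a) = 1" "ptrace_S dS dE \<rho> = eig_mat dE V v" "\<sigma>E = eig_mat dE V s"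
      "\<And>b. b < dE \<Longrightarrow> 0 < s b" "(\<Sum>b<dE. s b) = 1"
    then show thesis
      using that[of U V u r v s] ptrace_kron[OF Sc(1,2)] Sc(3,4) by (simp add: \<rho>_def)
  qed
  obtain VS VE u v r s where out_diag:
    "unitary dS VS" "unitary dE VE" "ptrace_E dS dE \<rho>' = eig_mat dS VS u" "\<sigma>S' = eig_mat dS VS r"
    "\<And>a. a < dS \<Longrightarrow> 0 < r a" "(\<Sum>a<dS. r a) = 1"
    "ptrace_S dS dE \<rho>' = eig_mat dE VE v" "\<sigma>E' = eig_mat dE VE s" "\<And>b. b < dE \<Longrightarrow> 0 < s b" "(\<Sum>b<dE. s b) = 1"
    "\<And>a. a < dS \<Longrightarrow> u a = (\<Sum>b<dE. diag_in (kron VS VE) \<rho>' (a * dE + b))"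
    "\<And>b. b < dE \<Longrightarrow> v b = (\<Sum>a<dS. diag_in (kron VS VE) \<rho>' (a * dE + b))"
    by (rule marginals_diagonalizable[OF assms(5,6) \<rho>'c])
      (use assms(12) in \<open>simp add: \<rho>'_def \<rho>_def\<close>, blast)
  note inc = unitary_carrier[OF in_diag(1)] unitary_carrier[OF in_diag(2)]
  note outc = unitary_carrier[OF out_diag(1)] unitary_carrier[OF out_diag(2)]
  have pS: "0 \<le> pS a" if "a < dS" for a
    using density_eig_mat(1)[OF in_diag(1) _ that] assms(10) in_diag(3) by blast
  have pE: "0 \<le> pE b" if "b < dE" for b
    using density_eig_mat(1)[OF in_diag(2) _ that] \<rho>E in_diag(7) by blast
  have pS1: "(\<Sum>a<dS. pS a) = 1" using density_eig_mat(2)[OF in_diag(1)] assms(10) in_diag(3) by blast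
  have pE1: "(\<Sum>b<dE. pE b) = 1" using density_eig_mat(2)[OF in_diag(2)] \<rho>E in_diag(7) by blast
  define G where "G = kron US UE"
  define K where "K = kron VS VE"
  have G: "unitary N G" unfolding G_def N_def by (rule unitary_kron[OF in_diag(1,2)])
  have K: "unitary N K" unfolding K_def N_def by (rule unitary_kron[OF out_diag(1,2)])
  note Gc = unitary_carrier[OF G] and Kc = unitary_carrier[OF K]
  define P where "P = (\<lambda>i. pS (i div dE) * pE (i mod dE))"
  define Q where "Q = (\<lambda>i. qS (i div dE) * qE (i mod dE))"
  define Z where "Z = (\<lambda>i. u (i div dE) * v (i mod dE))"
  have \<rho>_eig_mat: "\<rho> = eig_mat N G P" unfolding \<rho>_def in_diag(3,7) G_def N_def P_def by (rule kron_eig_mat[OF inc])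
  have \<sigma>_eig_mat: "\<sigma> = eig_mat N G Q" unfolding \<sigma>_def in_diag(4,8) G_def N_def Q_def by (rule kron_eig_mat[OF inc])
  have marg_eig_mat: "kron (ptrace_E dS dE \<rho>') (ptrace_S dS dE \<rho>') = eig_mat N K Z"
    unfolding out_diag(3,7) K_def N_def Z_def by (rule kron_eig_mat[OF outc])
  have P0: "0 \<le> P i" if "i < N" for i
    using pS pE divmod_less_mult[of i dS dE] that by (simp add: P_def N_def)
  have Q0: "0 < Q i" if "i < N" for i
    using in_diag(5,9) divmod_less_mult[of i dS dE] that by (simp add: Q_def N_def)
  have w0: "0 \<le> diag_in K \<rho>' k" if "k < N" for k
    by (rule diag_in_nonneg[OF _ Kc that]) (use \<rho>' in \<open>simp add: density_def\<close>)
  have il: "a * dE + b < N" if "a < dS" "b < dE" for a b unfolding N_def by (rule index_less_mult[OF that])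
  have u0: "0 \<le> u a" if "a < dS" for a
    unfolding out_diag(11)[OF that] K_def[symmetric] by (intro sum_nonneg w0 il that) simp
  have v0: "0 \<le> v b" if "b < dE" for b
    unfolding out_diag(12)[OF that] K_def[symmetric] by (intro sum_nonneg w0 il that) simp
  have Z0: "0 \<le> Z i" if "i < N" for i
    using u0 v0 divmod_less_mult[of i dS dE] that by (simp add: Z_def N_def)

  define A where "A = {..<dS}"
  define B where "B = {..<dE}"
  have sum_AB: "(\<Sum>i<N. g i) = (\<Sum>(a, b)\<in>A \<times> B. g (a * dE + b))" for g :: "nat \<Rightarrow> real"
    unfolding N_def A_def B_def by (simp only: sum_lessThan_mult sum.cartesian_product)
  define p where "p = (\<lambda>(a, b). pS a * pE b)"
  define q where "q = (\<lambda>(a, b). qS a * qE b)"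
  define w where "w = (\<lambda>(a, b). diag_in K \<rho>' (a * dE + b))"
  have pPQ: "p i = P (fst i * dE + snd i)" "q i = Q (fst i * dE + snd i)" if "i \<in> A \<times> B" for i
    using that by (auto simp: p_def P_def q_def Q_def A_def B_def)

  define sm where "sm = smallest_eigenvalue \<sigma>"
  \<comment> \<open>Input probabilities are at most 1 and reference weights at least
    \<open>sm\<close>, so the ratios are at most \<open>1 / sm = exp l\<close>.\<close>
  define l where "l = - ln sm"
  have N0: "0 < N" using assms(1,2) by (simp add: N_def)
  have sm: "sm = Min (Q ` {..<N})" unfolding sm_def \<sigma>_eig_mat by (rule smallest_eigenvalue_eig_mat[OF G N0])
  have sm_le: "sm \<le> Q i" if "i < N" for i unfolding sm using that by (intro Min_le) auto
  have sm0: "0 < sm" unfolding sm using N0 Q0 by (subst Min_gr_iff) auto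
  have Q1: "(\<Sum>i<N. Q i) = 1"
    unfolding N_def sum_lessThan_mult Q_def
    by (simp add: in_diag(6,10) flip: sum_distrib_left sum_distrib_right)
  have sm1: "sm \<le> 1"
  proof -
    have "sm \<le> Q 0" by (rule sm_le[OF N0])
    also have "\<dots> \<le> (\<Sum>i<N. Q i)" using N0 less_imp_le[OF Q0] by (intro member_le_sum) auto
    finally show ?thesis using Q1 by simp
  qed
  have l0: "0 \<le> l" using sm0 sm1 by (simp add: l_def)
  have exp_l: "exp l = 1 / sm" using sm0 by (simp add: l_def exp_minus divide_inverse)

  define I where "I = rel_ent N \<rho>' (eig_mat N K Z)"
  have fin: "finite A" "finite B" by (auto simp: A_def B_def)
  have p1: "(\<Sum>i\<in>A \<times> B. p i) = 1"
    unfolding p_def A_def B_def sum.cartesian_product[symmetric]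
    by (simp add: pS1 pE1 flip: sum_distrib_left sum_distrib_right)
  have p0: "0 \<le> p i" if "i \<in> A \<times> B" for i using that pS pE by (auto simp: p_def A_def B_def)
  have q0: "0 < q i" if "i \<in> A \<times> B" for i using that in_diag(5,9) by (auto simp: q_def A_def B_def)
  \<comment> \<open>Transition weights from eigenvectors of the input to outcomes in the output
    basis. Indices are pairs on both sides, since the output must be a product set for its marginals
    to be formed.\<close>
  define T where "T = (\<lambda>j i. diag_in K (\<E> (eig_mat N G (\<lambda>k. if k = fst i * dE + snd i then 1 else 0)))
    (fst j * dE + snd j))"
  have T_sum: "diag_in K (\<E> (eig_mat N G g)) (fst j * dE + snd j) = (\<Sum>i\<in>A \<times> B. T j i * g (fst i * dE + snd i))"
    if "j \<in> A \<times> B" for j g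
  proof -
    have "fst j * dE + snd j < N" using that by (auto simp: A_def B_def il)
    from diag_in_channel_eig_mat[OF E[folded N_def] Kc Gc this, of g]
    show ?thesis by (simp only: sum_AB T_def case_prod_unfold)
  qed
  have core: "(klvar (A \<times> B) p q - klvar A u r - klvar B v s
      - sqrt (2 * ln 2) * (12 * (ln 2)\<^sup>2 + l\<^sup>2) * max (root 4 I) (I\<^sup>2))
      / (2 * sqrt (klvar (A \<times> B) p q + (1 + l - kl (A \<times> B) p q)\<^sup>2)) \<le> kl (A \<times> B) p q - kl A u r - kl B v s"
  proof (rule classical_bound[where T = T and w = w])
    show "finite (A \<times> B)" "finite A" "finite B" using fin by auto
    show "0 \<le> T j i" if "i \<in> A \<times> B" "j \<in> A \<times> B" for i j
    proof -
      have "psd N (\<E> (eig_mat N G (\<lambda>k. if k = fst i * dE + snd i then 1 else 0)))"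
        by (rule channel_psd[OF E[folded N_def] psd_eig_mat[OF G]]) simp
      then show ?thesis unfolding T_def using that by (intro diag_in_nonneg[OF _ Kc]) (auto simp: A_def B_def il)
    qed
    show "(\<Sum>j\<in>A \<times> B. T j i) = 1" if "i \<in> A \<times> B" for i
    proof -
      let ?X = "eig_mat N G (\<lambda>k. if k = fst i * dE + snd i then 1 else 0)"
      have X: "?X \<in> carrier_mat N N" using Gc by simp
      have EX: "\<E> ?X \<in> carrier_mat N N" "mtrace (\<E> ?X) = mtrace ?X" using E X by (auto simp: channel_def N_def)
      have "(\<Sum>j\<in>A \<times> B. T j i) = (\<Sum>k<N. diag_in K (\<E> ?X) k)"
        by (simp only: sum_AB T_def case_prod_unfold)
      also have "\<dots> = (\<Sum>k<N. diag_in G ?X k)" using sum_diag_in[OF K EX(1)] sum_diag_in[OF G X] EX(2) by simp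
      also have "\<dots> = (\<Sum>k<N. if k = fst i * dE + snd i then 1 else 0)"
        by (intro sum.cong refl) (simp add: diag_in_eig_mat[OF G])
      also have "\<dots> = 1" using that il by (auto simp: A_def B_def)
      finally show ?thesis .
    qed
    show "w j = (\<Sum>i\<in>A \<times> B. T j i * p i)" if "j \<in> A \<times> B" for j
    proof -
      have "w j = diag_in K (\<E> (eig_mat N G P)) (fst j * dE + snd j)"
        by (simp add: w_def \<rho>'_def \<rho>_eig_mat case_prod_unfold)
      then show ?thesis unfolding T_sum[OF that] by (simp add: pPQ cong: sum.cong)
    qed
    show "r a * s b = (\<Sum>i\<in>A \<times> B. T (a, b) i * q i)" if "a \<in> A" "b \<in> B" for a b
    proof -
      have "\<E> (eig_mat N G Q) = kron \<sigma>S' \<sigma>E'" using \<sigma>' \<sigma>_eig_mat by (simp add: \<sigma>_def)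
      also have "\<dots> = eig_mat N K (\<lambda>i. r (i div dE) * s (i mod dE))"
        unfolding out_diag(4,8) K_def N_def by (rule kron_eig_mat[OF outc])
      finally have "diag_in K (\<E> (eig_mat N G Q)) (a * dE + b) = r a * s b"
        using that by (simp add: diag_in_eig_mat[OF K] il A_def B_def)
      then show ?thesis using T_sum[of "(a, b)" Q] that by (simp add: pPQ cong: sum.cong)
    qed
    show "u a = (\<Sum>b\<in>B. w (a, b))" if "a \<in> A" for a
      using out_diag(11) that by (simp add: w_def A_def B_def K_def)
    show "v b = (\<Sum>a\<in>A. w (a, b))" if "b \<in> B" for b
      using out_diag(12) that by (simp add: w_def A_def B_def K_def)
    show "p i \<le> exp l * q i" if i: "i \<in> A \<times> B" for i
    proof -
      have "p i \<le> (\<Sum>i\<in>A \<times> B. p i)" using i p0 fin by (intro member_le_sum) auto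
      moreover have "sm \<le> q i" using i by (simp add: pPQ) (auto intro!: sm_le il simp: A_def B_def)
      then have "1 \<le> exp l * q i" using sm0 by (simp add: exp_l field_simps)
      ultimately show ?thesis using p1 by linarith
    qed
    \<comment> \<open>Measuring in \<open>K\<close> leaves the product of the marginals unchanged,
      as it is diagonal there, and cannot raise the mutual information. The factor
      \<open>ln 2\<close> turns bits into nats.\<close>
    show "kl (A \<times> B) w (\<lambda>(a, b). u a * v b) \<le> ln 2 * I"
    proof -
      have "kl (A \<times> B) w (\<lambda>(a, b). u a * v b) = kl {..<N} (diag_in K \<rho>') Z"
        unfolding N_def kl_lessThan_mult A_def B_def by (rule kl_cong) (auto simp: w_def Z_def)
      also have "\<dots> \<le> ln 2 * I" unfolding I_def by (rule kl_diag_in_le_rel_ent[OF K \<rho>' Z0])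
      finally show ?thesis .
    qed
  qed (use p0 p1 q0 out_diag(5,6,9,10) l0 in \<open>simp_all add: A_def B_def\<close>)

  have klpq: "kl (A \<times> B) p q = kl {..<N} P Q" "klvar (A \<times> B) p q = klvar {..<N} P Q"
    unfolding N_def kl_lessThan_mult A_def B_def
    by (rule kl_cong; auto simp: p_def q_def P_def Q_def)+
  have "kl (A \<times> B) p q = kl A pS qS + kl B pE qE" "klvar (A \<times> B) p q = klvar A pS qS + klvar B pE qE"
    unfolding p_def q_def
    by (rule kl_product[OF fin]; use pS pE pS1 pE1 in_diag(5,9) in \<open>simp add: A_def B_def\<close>)+
  note prod = this
  have rel_in: "rel_ent dS \<rho>S \<sigma>S = kl A pS qS / ln 2" "rel_var dS \<rho>S \<sigma>S = klvar A pS qS / (ln 2)\<^sup>2"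
    "rel_ent dE \<rho>E \<sigma>E = kl B pE qE / ln 2" "rel_var dE \<rho>E \<sigma>E = klvar B pE qE / (ln 2)\<^sup>2"
    unfolding in_diag(3,4,7,8) A_def B_def
    by (rule rel_ent_eig_mat; use pS pE in_diag(5,9) in \<open>simp add: in_diag(1,2) less_imp_le\<close>)+
  have rel_out: "rel_ent dS (ptrace_E dS dE \<rho>') \<sigma>S' = kl A u r / ln 2"
    "rel_var dS (ptrace_E dS dE \<rho>') \<sigma>S' = klvar A u r / (ln 2)\<^sup>2"
    "rel_ent dE (ptrace_S dS dE \<rho>') \<sigma>E' = kl B v s / ln 2"
    "rel_var dE (ptrace_S dS dE \<rho>') \<sigma>E' = klvar B v s / (ln 2)\<^sup>2"
    unfolding out_diag(3,4,7,8) A_def B_def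
    by (rule rel_ent_eig_mat; use u0 v0 out_diag(5,9) in \<open>simp add: out_diag(1,2) less_imp_le\<close>)+
  define Mn where "Mn = klvar (A \<times> B) p q + (1 + l - kl (A \<times> B) p q)\<^sup>2"
  have M: "M_x N sm \<rho> \<sigma> = Mn / (ln 2)\<^sup>2"
  proof -
    have "rel_ent N \<rho> \<sigma> = kl (A \<times> B) p q / ln 2" "rel_var N \<rho> \<sigma> = klvar (A \<times> B) p q / (ln 2)\<^sup>2"
      unfolding \<rho>_eig_mat \<sigma>_eig_mat klpq by (rule rel_ent_eig_mat[OF G]; simp add: P0 Q0 less_imp_le)+
    \<comment> \<open>Here the shift of \<open>M_x\<close> in bits becomes the concavity offset
      \<open>1 + l\<close> divided by \<open>ln 2\<close>.\<close>
    moreover have "1 / ln 2 - log 2 sm - kl (A \<times> B) p q / ln 2 = (1 + l - kl (A \<times> B) p q) / ln 2"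
      by (simp add: l_def log_def diff_divide_distrib add_divide_distrib)
    ultimately show ?thesis by (simp add: M_x_def Mn_def power_divide add_divide_distrib)
  qed
  define Kb where "Kb = sqrt (2 * ln 2) * (12 + (log 2 sm)\<^sup>2 + 8 * (log 2 (real N))\<^sup>2)"
  have "sqrt (2 * ln 2) * (12 * (ln 2)\<^sup>2 + l\<^sup>2) \<le> Kb * (ln 2)\<^sup>2"
  proof -
    \<comment> \<open>In bits \<open>l\<close> is \<open>- log 2 sm\<close>, so the factor
      \<open>(ln 2)^2\<close> accounts for both terms at once.\<close>
    have "12 * (ln 2)\<^sup>2 + l\<^sup>2 = (12 + (log 2 sm)\<^sup>2) * (ln 2)\<^sup>2"
      by (simp add: l_def log_def power_divide field_simps)
    also have "\<dots> \<le> (12 + (log 2 sm)\<^sup>2 + 8 * (log 2 (real N))\<^sup>2) * (ln 2)\<^sup>2"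
      by (intro mult_right_mono) auto
    finally show ?thesis unfolding Kb_def mult.assoc by (intro mult_left_mono) auto
  qed
  moreover have "0 \<le> klvar (A \<times> B) p q" by (rule klvar_nonneg[OF p1 p0])
  then have "0 \<le> Mn" unfolding Mn_def by simp
  moreover have "0 \<le> max (root 4 I) (I\<^sup>2)" by (simp add: max.coboundedI2)
  ultimately have "((klvar (A \<times> B) p q - klvar A u r - klvar B v s) / (ln 2)\<^sup>2 - Kb * max (root 4 I) (I\<^sup>2))
      / (2 * sqrt (Mn / (ln 2)\<^sup>2)) \<le> (kl (A \<times> B) p q - kl A u r - kl B v s) / ln 2"
    using core by (intro nats_to_bits) (simp_all add: Mn_def)
  then show ?thesis
    unfolding Let_def \<rho>_def[symmetric] \<sigma>_def[symmetric] \<rho>'_def[symmetric] sm_def[symmetric] marg_eig_mat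
      N_def[symmetric] I_def[symmetric] Kb_def[symmetric] M rel_in rel_out prod
    by (simp add: diff_divide_distrib add_divide_distrib algebra_simps)
qed

end
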